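(* Let $G$ be a finitely generated group hyperbolic relative to a collection $\mathcal{H}=\{H_i\}_{i=1}^m$ of free abelian subgroups. Let $Q$ be a relatively quasiconvex subgroup and let $P$ be a maximal parabolic subgroup of $G$. If $$rank_{\mathbb{Z}}(Q\cap P)<rank_{\mathbb{Z}}(P),$$ then for every positive integer $k$ there exists a relatively quasiconvex subgroup of $G$ isomorphic to $\Delta_k(Q,Q\cap P)$.
   Context: For a subgroup $K$ of a group $Q$ and a positive integer $k$, $\Delta_k(Q,K)$ denotes the amalgamated free product of $k$ copies of $Q$ along $K$. Setting. $G$ is a group, $X$ a finite generating set of $G$ closed under inverses, $\mathcal{H}=\{H_i\}_{i=1}^m$ a finite collection of subgroups. $|g|_X$ is the word length and $dist_X(f,g)=|f^{-1}g|_X$. Let $\widetilde{\mathcal{H}}=\bigsqcup_{i=1}^m(\widetilde{H_i}\setminus\{1\})$, where $\widetilde{H_i}$ is a copy of $H_i$, and let $\Gamma=Cayley(G,X\cup\widetilde{\mathcal{H}})$ be the graph with vertex set $G$ and, for each $g\in G$ and each letter $a\in X\sqcup\widetilde{\mathcal{H}}$, an edge from $g$ to $ga$ with label $a$; all edges have length 1. For a path $p$, $p_-$ and $p_+$ are its initial and terminal vertices and $l(p)$ its length. A path $p$ is a $(\lambda,c)$-quasi-geodesic if $l(q)\leq\lambda d(q_-,q_+)+c$ for every subpath $q$ of $p$, $d$ being the metric of $\Gamma$. Components. An $H_i$-component of a path $q$ in $\Gamma$ is a maximal subpath with at least one edge whose label is a word in the alphabet $\widetilde{H_i}\setminus\{1\}$;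 an $\mathcal{H}$-component is an $H_i$-component for some $i$. Two $\mathcal{H}$-components (of one path or of two paths) are connected if, for some $i$, both are $H_i$-components and their vertices belong to the same left coset of $H_i$. An $\mathcal{H}$-component of $q$ is isolated if it is not connected to a different $\mathcal{H}$-component of $q$. A path is without backtracking if all its $\mathcal{H}$-components are isolated. A vertex of $q$ is phase if it is not an inner vertex of an $\mathcal{H}$-component of $q$. Two paths $p,q$ are $k$-similar if $\max\{dist_X(p_-,q_-),dist_X(p_+,q_+)\}\leq k$. Bounded coset penetration (BCP). $(G,\mathcal{H})$ satisfies BCP if for all $\lambda\geq1$, $c\geq0$, $k\geq0$ there is an integer $\epsilon(\lambda,c,k)>0$ such that for any two $k$-similar $(\lambda,c)$-quasi-geodesics $p,q$ in $\Gamma$ without backtracking: (i) the sets of phase vertices of $p$ and $q$ are contained in the closed $\epsilon(\lambda,c,k)$-neighborhoods of each other with respect to $dist_X$; (ii) if $s$ is an $\mathcal{H}$-component of $p$ with $dist_X(s_-,s_+)>\epsilon(\lambda,c,k)$, then some $\mathcal{H}$-component of $q$ is connected to $s$; (iii) if $s,t$ are connected $\mathcal{H}$-components of $p,q$ respectively, then $\max\{dist_X(s_-,t_-),dist_X(s_+,t_+)\}\leq\epsilon(\lambda,c,k)$. $G$ is hyperbolic relative to $\mathcal{H}$ if $\Gamma$ is a $\delta$-hyperbolic metric space for some $\delta\ge 0$ and $(G,\mathcal{H})$ satisfies BCP. A subgroup $Q\leq G$ is relatively quasiconvex if there is $\sigma\geq0$ (and then $Q$ is called $\sigma$-quasiconvex)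 such that for all $f,g\in Q$, every geodesic $p$ in $\Gamma$ from $f$ to $g$ and every vertex $v$ of $p$, there is $w\in Q$ with $dist_X(v,w)\leq\sigma$. A subgroup of $G$ is parabolic if it can be conjugated in $G$ into one of the subgroups in $\mathcal{H}$; a maximal parabolic subgroup of $G$ is a parabolic subgroup not properly contained in another parabolic subgroup. *)

theory Defs
  imports Complex_Main "HOL-Library.Extended_Nat" "HOL-Algebra.Generated_Groups"
    "HOL-Algebra.Free_Abelian_Groups"
begin

section \<open>Words and the relative Cayley graph\<close>

definition word_prod :: "('a, 'b) monoid_scheme \<Rightarrow> 'a list \<Rightarrow> 'a" where
  "word_prod G xs = foldr (\<lambda>x y. x \<otimes>\<^bsub>G\<^esub> y) xs \<one>\<^bsub>G\<^esub>"

definition word_length :: "('a, 'b) monoid_scheme \<Rightarrow> 'a set \<Rightarrow> 'a \<Rightarrow> nat" where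
  "word_length G X g = (LEAST n. \<exists>xs \<in> lists X. length xs = n \<and> word_prod G xs = g)"

definition word_dist :: "('a, 'b) monoid_scheme \<Rightarrow> 'a set \<Rightarrow> 'a \<Rightarrow> 'a \<Rightarrow> nat" where
  "word_dist G X f g = word_length G X (inv\<^bsub>G\<^esub> f \<otimes>\<^bsub>G\<^esub> g)"

text \<open>
  The collection of peripheral subgroups is a list \<open>Hs\<close>; \<open>Per i h\<close> is the copy of
  \<open>h\<close> in the \<open>i\<close>-th summand of the disjoint union, so letters of different
  summands are different even when the subgroups intersect or coincide.
\<close>

datatype 'a letter = Gen 'a | Per nat 'a

fun letter_val :: "'a letter \<Rightarrow> 'a" where
  "letter_val (Gen x) = x"
| "letter_val (Per i h) = h"

definition alphabet :: "('a, 'b) monoid_scheme \<Rightarrow> 'a set \<Rightarrow> 'a set list \<Rightarrow> 'a letter set" where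
  "alphabet G X Hs = Gen ` X \<union> {Per i h |i h. i < length Hs \<and> h \<in> Hs ! i - {\<one>\<^bsub>G\<^esub>}}"

text \<open>
  A path is given by its initial vertex and its label.  As the alphabet is closed under
  inverses, running backwards through the edge from \<open>g\<close> to \<open>ga\<close> with label \<open>a\<close> is
  the same as following the edge from \<open>ga\<close> with the inverse label.
\<close>

type_synonym 'a path = "'a \<times> 'a letter list"

definition paths :: "('a, 'b) monoid_scheme \<Rightarrow> 'a set \<Rightarrow> 'a set list \<Rightarrow> 'a path set" where
  "paths G X Hs = carrier G \<times> lists (alphabet G X Hs)"

definition path_length :: "'a path \<Rightarrow> nat" where
  "path_length p = length (snd p)"

definition vertex :: "('a, 'b) monoid_scheme \<Rightarrow> 'a path \<Rightarrow> nat \<Rightarrow> 'a" where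
  "vertex G p n = fst p \<otimes>\<^bsub>G\<^esub> word_prod G (map letter_val (take n (snd p)))"

definition path_start :: "('a, 'b) monoid_scheme \<Rightarrow> 'a path \<Rightarrow> 'a" where
  "path_start G p = vertex G p 0"

definition path_end :: "('a, 'b) monoid_scheme \<Rightarrow> 'a path \<Rightarrow> 'a" where
  "path_end G p = vertex G p (path_length p)"

definition cayley_dist ::
  "('a, 'b) monoid_scheme \<Rightarrow> 'a set \<Rightarrow> 'a set list \<Rightarrow> 'a \<Rightarrow> 'a \<Rightarrow> nat" where
  "cayley_dist G X Hs f g =
    (LEAST n. \<exists>p \<in> paths G X Hs. path_start G p = f \<and> path_end G p = g \<and> path_length p = n)"

definition geodesic :: "('a, 'b) monoid_scheme \<Rightarrow> 'a set \<Rightarrow> 'a set list \<Rightarrow> 'a path \<Rightarrow> bool" where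
  "geodesic G X Hs p \<longleftrightarrow> p \<in> paths G X Hs \<and>
     path_length p = cayley_dist G X Hs (path_start G p) (path_end G p)"

text \<open>
  A subpath of \<open>p\<close> is given by the positions \<open>i \<le> j \<le> path_length p\<close> of its
  endpoints on \<open>p\<close>.
\<close>

definition quasi_geodesic ::
  "('a, 'b) monoid_scheme \<Rightarrow> 'a set \<Rightarrow> 'a set list \<Rightarrow> real \<Rightarrow> real \<Rightarrow> 'a path \<Rightarrow> bool" where
  "quasi_geodesic G X Hs l c p \<longleftrightarrow> p \<in> paths G X Hs \<and>
     (\<forall>i j. i \<le> j \<and> j \<le> path_length p \<longrightarrow>
        real (j - i) \<le> l * real (cayley_dist G X Hs (vertex G p i) (vertex G p j)) + c)"


section \<open>The Cayley graph as a metric space\<close>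

text \<open>
  Points of the graph with all edges of length 1: \<open>Inner g a t\<close> is the point at
  distance \<open>t\<close> from \<open>g\<close>, \<open>0 < t < 1\<close>, on the edge from \<open>g\<close> with label \<open>a\<close>.
\<close>

datatype 'a graph_point = Vertex 'a | Inner 'a "'a letter" real

definition graph_points ::
  "('a, 'b) monoid_scheme \<Rightarrow> 'a set \<Rightarrow> 'a set list \<Rightarrow> 'a graph_point set" where
  "graph_points G X Hs = Vertex ` carrier G \<union>
     {Inner g a t |g a t. g \<in> carrier G \<and> a \<in> alphabet G X Hs \<and> 0 < t \<and> t < 1}"

fun edge_ends :: "('a, 'b) monoid_scheme \<Rightarrow> 'a graph_point \<Rightarrow> ('a \<times> real) set" where
  "edge_ends G (Vertex g) = {(g, 0)}"
| "edge_ends G (Inner g a t) = {(g, t), (g \<otimes>\<^bsub>G\<^esub> letter_val a, 1 - t)}"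

fun along_edge :: "'a graph_point \<Rightarrow> 'a graph_point \<Rightarrow> real set" where
  "along_edge (Inner g a s) (Inner h b t) = (if g = h \<and> a = b then {\<bar>s - t\<bar>} else {})"
| "along_edge _ _ = {}"

text \<open>
  Length metric: a shortest path either stays inside one edge or leaves both points
  through endpoints of their edges.
\<close>

definition graph_dist ::
  "('a, 'b) monoid_scheme \<Rightarrow> 'a set \<Rightarrow> 'a set list \<Rightarrow> 'a graph_point \<Rightarrow> 'a graph_point \<Rightarrow> real" where
  "graph_dist G X Hs x y = Min (along_edge x y \<union>
     {r + real (cayley_dist G X Hs u v) + s |u r v s. (u, r) \<in> edge_ends G x \<and> (v, s) \<in> edge_ends G y})"

definition geodesic_segment :: "'p set \<Rightarrow> ('p \<Rightarrow> 'p \<Rightarrow> real) \<Rightarrow> 'p set \<Rightarrow> 'p \<Rightarrow> 'p \<Rightarrow> bool" where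
  "geodesic_segment M d S x y \<longleftrightarrow>
     (\<exists>L \<gamma>. 0 \<le> L \<and> \<gamma> ` {0..L} = S \<and> S \<subseteq> M \<and> \<gamma> 0 = x \<and> \<gamma> L = y \<and>
        (\<forall>s \<in> {0..L}. \<forall>t \<in> {0..L}. d (\<gamma> s) (\<gamma> t) = \<bar>s - t\<bar>))"

text \<open>Rips' condition; it is only used for the geodesic metric space \<open>graph_points\<close>.\<close>

definition hyperbolic_metric :: "'p set \<Rightarrow> ('p \<Rightarrow> 'p \<Rightarrow> real) \<Rightarrow> real \<Rightarrow> bool" where
  "hyperbolic_metric M d \<delta> \<longleftrightarrow>
     (\<forall>x y z A B C. geodesic_segment M d A x y \<and> geodesic_segment M d B y z \<and>
        geodesic_segment M d C z x \<longrightarrow> (\<forall>p \<in> A. \<exists>q \<in> B \<union> C. d p q \<le> \<delta>))"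


section \<open>Components and relative hyperbolicity\<close>

definition per_subpath :: "'a path \<Rightarrow> nat \<Rightarrow> nat \<times> nat \<Rightarrow> bool" where
  "per_subpath p k s \<longleftrightarrow> fst s < snd s \<and> snd s \<le> path_length p \<and>
     (\<forall>n \<in> {fst s..<snd s}. \<exists>h. snd p ! n = Per k h)"

definition component :: "'a path \<Rightarrow> nat \<Rightarrow> nat \<times> nat \<Rightarrow> bool" where
  "component p k s \<longleftrightarrow> per_subpath p k s \<and>
     (\<forall>t. per_subpath p k t \<and> fst t \<le> fst s \<and> snd s \<le> snd t \<longrightarrow> t = s)"

definition connected_components ::
  "('a, 'b) monoid_scheme \<Rightarrow> 'a set list \<Rightarrow> 'a path \<Rightarrow> nat \<times> nat \<Rightarrow> 'a path \<Rightarrow> nat \<times> nat \<Rightarrow> bool" where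
  "connected_components G Hs p s q t \<longleftrightarrow>
     (\<exists>k < length Hs. component p k s \<and> component q k t \<and>
        (\<exists>g \<in> carrier G. vertex G p ` {fst s..snd s} \<union> vertex G q ` {fst t..snd t}
           \<subseteq> g <#\<^bsub>G\<^esub> (Hs ! k)))"

definition without_backtracking ::
  "('a, 'b) monoid_scheme \<Rightarrow> 'a set list \<Rightarrow> 'a path \<Rightarrow> bool" where
  "without_backtracking G Hs p \<longleftrightarrow>
     (\<forall>s k. component p k s \<longrightarrow> \<not> (\<exists>t. t \<noteq> s \<and> connected_components G Hs p s p t))"

text \<open>Being phase is a property of the position on the path, not of the group element.\<close>

definition phase_vertices :: "('a, 'b) monoid_scheme \<Rightarrow> 'a path \<Rightarrow> 'a set" where
  "phase_vertices G p = {vertex G p n |n. n \<le> path_length p \<and>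
     \<not> (\<exists>k s. component p k s \<and> fst s < n \<and> n < snd s)}"

definition similar_paths ::
  "('a, 'b) monoid_scheme \<Rightarrow> 'a set \<Rightarrow> real \<Rightarrow> 'a path \<Rightarrow> 'a path \<Rightarrow> bool" where
  "similar_paths G X k p q \<longleftrightarrow>
     real (max (word_dist G X (path_start G p) (path_start G q))
               (word_dist G X (path_end G p) (path_end G q))) \<le> k"

definition bounded_coset_penetration ::
  "('a, 'b) monoid_scheme \<Rightarrow> 'a set \<Rightarrow> 'a set list \<Rightarrow> bool" where
  "bounded_coset_penetration G X Hs \<longleftrightarrow>
     (\<forall>l c k. 1 \<le> l \<and> 0 \<le> c \<and> 0 \<le> k \<longrightarrow>
       (\<exists>\<epsilon>::nat. 0 < \<epsilon> \<and>
         (\<forall>p q. quasi_geodesic G X Hs l c p \<and> quasi_geodesic G X Hs l c q \<and>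
            without_backtracking G Hs p \<and> without_backtracking G Hs q \<and>
            similar_paths G X k p q \<longrightarrow>
              (\<forall>u \<in> phase_vertices G p. \<exists>v \<in> phase_vertices G q. word_dist G X u v \<le> \<epsilon>) \<and>
              (\<forall>v \<in> phase_vertices G q. \<exists>u \<in> phase_vertices G p. word_dist G X v u \<le> \<epsilon>) \<and>
              (\<forall>i s. component p i s \<and>
                 \<epsilon> < word_dist G X (vertex G p (fst s)) (vertex G p (snd s)) \<longrightarrow>
                 (\<exists>t. connected_components G Hs p s q t)) \<and>
              (\<forall>s t. connected_components G Hs p s q t \<longrightarrow>
                 max (word_dist G X (vertex G p (fst s)) (vertex G q (fst t)))
                     (word_dist G X (vertex G p (snd s)) (vertex G q (snd t))) \<le> \<epsilon>))))"

definition relatively_hyperbolic ::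
  "('a, 'b) monoid_scheme \<Rightarrow> 'a set \<Rightarrow> 'a set list \<Rightarrow> bool" where
  "relatively_hyperbolic G X Hs \<longleftrightarrow>
     (\<exists>\<delta> \<ge> 0. hyperbolic_metric (graph_points G X Hs) (graph_dist G X Hs) \<delta>) \<and>
     bounded_coset_penetration G X Hs"

definition relatively_quasiconvex ::
  "('a, 'b) monoid_scheme \<Rightarrow> 'a set \<Rightarrow> 'a set list \<Rightarrow> 'a set \<Rightarrow> bool" where
  "relatively_quasiconvex G X Hs Q \<longleftrightarrow> subgroup Q G \<and>
     (\<exists>\<sigma>::real. 0 \<le> \<sigma> \<and>
       (\<forall>p. geodesic G X Hs p \<and> path_start G p \<in> Q \<and> path_end G p \<in> Q \<longrightarrow>
          (\<forall>n \<le> path_length p. \<exists>w \<in> Q. real (word_dist G X (vertex G p n) w) \<le> \<sigma>)))"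

definition parabolic :: "('a, 'b) monoid_scheme \<Rightarrow> 'a set list \<Rightarrow> 'a set \<Rightarrow> bool" where
  "parabolic G Hs P \<longleftrightarrow> subgroup P G \<and>
     (\<exists>g \<in> carrier G. \<exists>i < length Hs. (\<lambda>x. g \<otimes>\<^bsub>G\<^esub> x \<otimes>\<^bsub>G\<^esub> inv\<^bsub>G\<^esub> g) ` P \<subseteq> Hs ! i)"

definition maximal_parabolic :: "('a, 'b) monoid_scheme \<Rightarrow> 'a set list \<Rightarrow> 'a set \<Rightarrow> bool" where
  "maximal_parabolic G Hs P \<longleftrightarrow> parabolic G Hs P \<and> \<not> (\<exists>P'. parabolic G Hs P' \<and> P \<subset> P')"


section \<open>Free abelian groups and rank\<close>

text \<open>
  A basis of a group can be taken inside the group, so nothing is lost by letting \<open>S\<close>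
  have the element type of the group.
\<close>

definition free_abelian :: "('a, 'b) monoid_scheme \<Rightarrow> bool" where
  "free_abelian A \<longleftrightarrow> (\<exists>S :: 'a set. A \<cong> free_Abelian_group S)"

definition Z_independent :: "('a, 'b) monoid_scheme \<Rightarrow> 'a set \<Rightarrow> bool" where
  "Z_independent A B \<longleftrightarrow> finite B \<and> B \<subseteq> carrier A \<and>
     (\<forall>n :: 'a \<Rightarrow> int. finprod A (\<lambda>b. b [^]\<^bsub>A\<^esub> n b) B = \<one>\<^bsub>A\<^esub> \<longrightarrow> (\<forall>b \<in> B. n b = 0))"

definition Z_rank :: "('a, 'b) monoid_scheme \<Rightarrow> enat" where
  "Z_rank A = Sup {enat (card B) |B. Z_independent A B}"


section \<open>Amalgamated products of copies of a group\<close>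

text \<open>
  \<open>Amalgam k Q K\<close> is the quotient of the monoid of words in the letters \<open>(i, a)\<close>
  (the element \<open>a\<close> of the \<open>i\<close>-th copy of \<open>Q\<close>, \<open>i < k\<close>) by the congruence
  generated by the multiplication of each copy and by the identification of the \<open>k\<close>
  copies of \<open>K\<close>.
\<close>

inductive amalgam_eq ::
  "nat \<Rightarrow> ('a, 'b) monoid_scheme \<Rightarrow> 'a set \<Rightarrow> (nat \<times> 'a) list \<Rightarrow> (nat \<times> 'a) list \<Rightarrow> bool"
  for k Q K where
  mult: "i < k \<Longrightarrow> a \<in> carrier Q \<Longrightarrow> b \<in> carrier Q \<Longrightarrow>
           amalgam_eq k Q K [(i, a), (i, b)] [(i, a \<otimes>\<^bsub>Q\<^esub> b)]"
| one: "i < k \<Longrightarrow> amalgam_eq k Q K [(i, \<one>\<^bsub>Q\<^esub>)] []"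
| amalgamate: "i < k \<Longrightarrow> j < k \<Longrightarrow> c \<in> K \<Longrightarrow> amalgam_eq k Q K [(i, c)] [(j, c)]"
| refl: "u \<in> lists ({..<k} \<times> carrier Q) \<Longrightarrow> amalgam_eq k Q K u u"
| sym: "amalgam_eq k Q K u v \<Longrightarrow> amalgam_eq k Q K v u"
| trans: "amalgam_eq k Q K u v \<Longrightarrow> amalgam_eq k Q K v w \<Longrightarrow> amalgam_eq k Q K u w"
| append: "amalgam_eq k Q K u u' \<Longrightarrow> amalgam_eq k Q K v v' \<Longrightarrow> amalgam_eq k Q K (u @ v) (u' @ v')"

definition amalgam_class ::
  "nat \<Rightarrow> ('a, 'b) monoid_scheme \<Rightarrow> 'a set \<Rightarrow> (nat \<times> 'a) list \<Rightarrow> (nat \<times> 'a) list set" where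
  "amalgam_class k Q K u = {v. amalgam_eq k Q K u v}"

definition Amalgam ::
  "nat \<Rightarrow> ('a, 'b) monoid_scheme \<Rightarrow> 'a set \<Rightarrow> (nat \<times> 'a) list set monoid" where
  "Amalgam k Q K = \<lparr>carrier = amalgam_class k Q K ` lists ({..<k} \<times> carrier Q),
     monoid.mult = (\<lambda>A B. \<Union>u \<in> A. \<Union>v \<in> B. amalgam_class k Q K (u @ v)),
     one = amalgam_class k Q K []\<rparr>"

lemma amalgam_class_eq_iff:
  assumes "v \<in> lists ({..<k} \<times> carrier Q)"
  shows "amalgam_class k Q K u = amalgam_class k Q K v \<longleftrightarrow> amalgam_eq k Q K u v"
proof
  assume "amalgam_class k Q K u = amalgam_class k Q K v"
  then show "amalgam_eq k Q K u v"
    using amalgam_eq.refl[OF assms, of K] unfolding amalgam_class_def by blast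
next
  assume uv: "amalgam_eq k Q K u v"
  then show "amalgam_class k Q K u = amalgam_class k Q K v"
    using amalgam_eq.trans[OF uv] amalgam_eq.trans[OF amalgam_eq.sym[OF uv]]
    unfolding amalgam_class_def by blast
qed

lemma mult_Amalgam:
  assumes "u \<in> lists ({..<k} \<times> carrier Q)" "v \<in> lists ({..<k} \<times> carrier Q)"
  shows "amalgam_class k Q K u \<otimes>\<^bsub>Amalgam k Q K\<^esub> amalgam_class k Q K v = amalgam_class k Q K (u @ v)"
proof -
  have "amalgam_class k Q K (u' @ v') = amalgam_class k Q K (u @ v)"
    if "u' \<in> amalgam_class k Q K u" "v' \<in> amalgam_class k Q K v" for u' v'
  proof -
    have "amalgam_eq k Q K (u' @ v') (u @ v)"
      using that unfolding amalgam_class_def mem_Collect_eq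
      by (rule amalgam_eq.append[OF amalgam_eq.sym amalgam_eq.sym])
    moreover have "u @ v \<in> lists ({..<k} \<times> carrier Q)"
      using assms by simp
    ultimately show ?thesis by (simp only: amalgam_class_eq_iff)
  qed
  moreover have "u \<in> amalgam_class k Q K u" "v \<in> amalgam_class k Q K v"
    using assms(1)[THEN amalgam_eq.refl, of K] assms(2)[THEN amalgam_eq.refl, of K] by (simp_all add: amalgam_class_def)
  ultimately have "(\<Union>u' \<in> amalgam_class k Q K u. \<Union>v' \<in> amalgam_class k Q K v.
      amalgam_class k Q K (u' @ v')) = amalgam_class k Q K (u @ v)"
    by blast
  then show ?thesis by (simp add: Amalgam_def)
qed

lemma group_Amalgam:
  assumes Q: "group Q"
  shows "group (Amalgam k Q K)"
proof -
  define W where "W = lists ({..<k} \<times> carrier Q)"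
  let ?c = "amalgam_class k Q K" and ?A = "Amalgam k Q K"
  have carr: "carrier ?A = ?c ` W" and one: "\<one>\<^bsub>?A\<^esub> = ?c []"
    by (simp_all add: Amalgam_def W_def)
  have app: "u @ v \<in> W" if "u \<in> W" "v \<in> W" for u v
    using that by (simp add: W_def)
  have nil: "[] \<in> W" by (simp add: W_def)
  have mult: "?c u \<otimes>\<^bsub>?A\<^esub> ?c v = ?c (u @ v)" if "u \<in> W" "v \<in> W" for u v
    using that unfolding W_def by (rule mult_Amalgam)
  have inv: "\<exists>v \<in> W. amalgam_eq k Q K (v @ u) []" if "u \<in> W" for u
    using that[unfolded W_def]
  proof (induction u)
    case Nil
    have "amalgam_eq k Q K ([] @ []) []" by (simp add: amalgam_eq.refl)
    then show ?case using nil by blast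
  next
    case (Cons ia u)
    obtain i a where ia: "ia = (i, a)" "i < k" "a \<in> carrier Q"
      using Cons.hyps by blast
    obtain v where v: "v \<in> W" "amalgam_eq k Q K (v @ u) []"
      using Cons by blast
    let ?b = "inv\<^bsub>Q\<^esub> a"
    have b: "?b \<in> carrier Q" "?b \<otimes>\<^bsub>Q\<^esub> a = \<one>\<^bsub>Q\<^esub>"
      using Q ia by (simp_all add: group.l_inv)
    have "amalgam_eq k Q K [(i, ?b), (i, a)] []"
      using amalgam_eq.trans[OF amalgam_eq.mult[OF ia(2) b(1) ia(3)]]
        amalgam_eq.one[OF ia(2), of Q K] unfolding b(2) by blast
    then have "amalgam_eq k Q K (v @ ([(i, ?b), (i, a)] @ u)) (v @ ([] @ u))"
      using Cons.hyps v(1) unfolding W_def by (intro amalgam_eq.append amalgam_eq.refl)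
    then have "amalgam_eq k Q K ((v @ [(i, ?b)]) @ ia # u) (v @ u)"
      by (simp add: ia(1))
    then have "amalgam_eq k Q K ((v @ [(i, ?b)]) @ ia # u) []"
      using v(2) by (rule amalgam_eq.trans)
    moreover have "v @ [(i, ?b)] \<in> W"
      using ia(2) b(1) by (intro app v(1)) (simp add: W_def)
    ultimately show ?case by blast
  qed
  show ?thesis
  proof (rule groupI)
    show "\<exists>y \<in> carrier ?A. y \<otimes>\<^bsub>?A\<^esub> x = \<one>\<^bsub>?A\<^esub>" if "x \<in> carrier ?A" for x
    proof -
      obtain u where u: "u \<in> W" "x = ?c u"
        using \<open>x \<in> carrier ?A\<close> unfolding carr by blast
      obtain v where v: "v \<in> W" "amalgam_eq k Q K (v @ u) []"
        using inv[OF u(1)] by blast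
      have "?c v \<otimes>\<^bsub>?A\<^esub> x = \<one>\<^bsub>?A\<^esub>"
        using v(2) amalgam_class_eq_iff[of "[]" k Q "K"] by (simp add: u mult[OF v(1)] one)
      then show ?thesis using v(1) unfolding carr by blast
    qed
    show "x \<otimes>\<^bsub>?A\<^esub> y \<in> carrier ?A" if "x \<in> carrier ?A" "y \<in> carrier ?A" for x y
      using that app unfolding carr by (force simp: mult)
    show "\<one>\<^bsub>?A\<^esub> \<in> carrier ?A"
      unfolding carr one using nil by blast
    show "(x \<otimes>\<^bsub>?A\<^esub> y) \<otimes>\<^bsub>?A\<^esub> z = x \<otimes>\<^bsub>?A\<^esub> (y \<otimes>\<^bsub>?A\<^esub> z)"
      if "x \<in> carrier ?A" "y \<in> carrier ?A" "z \<in> carrier ?A" for x y z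
      using that unfolding carr by (force simp: mult app)
    show "\<one>\<^bsub>?A\<^esub> \<otimes>\<^bsub>?A\<^esub> x = x" if "x \<in> carrier ?A" for x
      using that unfolding carr one by (force simp: mult nil)
  qed
qed

end

theory Submission
  imports Defs
begin

text \<open>
  Let \<open>P\<close> be the stabiliser of a coset \<open>A = b H\<close> of a peripheral subgroup, and \<open>K = Q \<inter> P\<close>.
  As the rank of \<open>K\<close> is smaller than that of \<open>P\<close>, some \<open>h \<in> P\<close> has infinite order modulo
  \<open>K\<close>.  Put \<open>t\<^sub>i = h\<^bsup>L i\<^esup>\<close> for a large number \<open>L\<close>.  Since \<open>P\<close> is abelian, the conjugates
  \<open>t\<^sub>i Q t\<^sub>i\<^bsup>-1\<^esup>\<close>, \<open>i < k\<close>, all contain \<open>K\<close>, and they define a homomorphism from the amalgam of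
  \<open>k\<close> copies of \<open>Q\<close> along \<open>K\<close> to \<open>G\<close>.  It is shown that this homomorphism is injective and
  that its image \<open>R\<close> is relatively quasiconvex.

  The argument is a ping-pong on cosets of \<open>H\<close>, with bounded coset penetration as the geometric input.
  For a point \<open>x\<close> and a coset \<open>B\<close> consider the points at which geodesics from \<open>x\<close> enter
  \<open>B\<close>, the projection of \<open>x\<close> to \<open>B\<close>.  Bounded coset penetration shows that the
  projection of a point, and also that of a different coset of \<open>H\<close>, has bounded diameter with respect
  to \<open>X\<close> (\<open>entry_points_close\<close>, \<open>proj_coset_close\<close>), and that a geodesic from \<open>x\<close> to
  \<open>y\<close> has to pass through \<open>B\<close> as soon as the projections of \<open>x\<close> and \<open>y\<close> to \<open>B\<close> are
  far apart (\<open>far_projections_cross\<close>).  Consequently, if \<open>B\<^sub>0, \<dots>, B\<^sub>n\<close> are cosets such that the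
  projections of \<open>B\<^bsub>j-1\<^esub>\<close> and \<open>B\<^bsub>j+1\<^esub>\<close> to \<open>B\<^sub>j\<close> are far apart for every inner \<open>j\<close>, then a
  geodesic from \<open>B\<^sub>0\<close> to \<open>B\<^sub>n\<close> passes through every \<open>B\<^sub>j\<close>, entering and leaving it where the
  neighbouring cosets project (\<open>chain_crossing\<close>).

  An alternating word \<open>(i\<^sub>1, q\<^sub>1), \<dots>, (i\<^sub>n, q\<^sub>n)\<close> with all \<open>q\<^sub>j\<close> in \<open>Q - K\<close> gives such a chain:
  take \<open>B\<^sub>j = y\<^sub>j A\<close>, where \<open>y\<^sub>j\<close> is the value of its prefix of length \<open>j\<close>.  Since \<open>Q\<close> is
  quasiconvex, the projection of \<open>q A\<close> to \<open>A\<close>, for \<open>q\<close> in \<open>Q - K\<close>, is uniformly close to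
  \<open>K b\<close> (\<open>proj_from_Q_translate\<close>).  So the neighbours of \<open>B\<^sub>j\<close> project near
  \<open>y\<^sub>j t\<^sub>i K b\<close> and \<open>y\<^sub>j t\<^sub>l K b\<close> with \<open>i = i\<^sub>j\<close> and \<open>l = i\<^bsub>j+1\<^esub>\<close>, and these sets are far
  apart by the choice of the \<open>t\<^sub>i\<close>, because \<open>i \<noteq> l\<close>.  Hence a geodesic from \<open>b\<close> to
  \<open>y\<^sub>n b\<close> passes through all inner \<open>B\<^sub>j\<close>.  For \<open>n \<ge> 2\<close> this gives \<open>y\<^sub>n \<noteq> 1\<close>, which is clear for
  \<open>n = 1\<close>; injectivity follows by the normal form of elements of an amalgam (\<open>ev_kernel\<close>).
  Moreover the crossings cut the geodesic into pieces that are close to translates of geodesics between points of \<open>Q b\<close>, and so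
  stay close to \<open>R\<close> (\<open>reduced_geodesic_near_R\<close>).
\<close>

section \<open>Words and metrics on a group\<close>

context group
begin

lemma word_prod_Nil [simp]: "word_prod G [] = \<one>"
  by (simp add: word_prod_def)

lemma word_prod_Cons [simp]: "word_prod G (x # xs) = x \<otimes> word_prod G xs"
  by (simp add: word_prod_def)

lemma word_prod_closed [intro]: "set xs \<subseteq> carrier G \<Longrightarrow> word_prod G xs \<in> carrier G"
  by (induction xs) auto

lemma word_prod_append:
  "set xs \<subseteq> carrier G \<Longrightarrow> set ys \<subseteq> carrier G \<Longrightarrow>
    word_prod G (xs @ ys) = word_prod G xs \<otimes> word_prod G ys"
  by (induction xs) (auto simp: m_assoc word_prod_closed)

lemma word_prod_rev_inv:
  "set xs \<subseteq> carrier G \<Longrightarrow> word_prod G (rev (map (\<lambda>x. inv x) xs)) = inv (word_prod G xs)"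
proof (induction xs)
  case (Cons x xs)
  then have "word_prod G (rev (map (\<lambda>x. inv x) xs) @ [inv x]) = inv (word_prod G xs) \<otimes> inv x"
    by (subst word_prod_append) auto
  then show ?case using Cons by (simp add: inv_mult_group word_prod_closed)
qed simp

lemma mult_inv_cancel [simp]:
  "x \<in> carrier G \<Longrightarrow> y \<in> carrier G \<Longrightarrow> x \<otimes> (inv x \<otimes> y) = y"
  "x \<in> carrier G \<Longrightarrow> y \<in> carrier G \<Longrightarrow> inv x \<otimes> (x \<otimes> y) = y"
  by (simp_all flip: m_assoc)

end

fun letter_inv :: "('a, 'b) monoid_scheme \<Rightarrow> 'a letter \<Rightarrow> 'a letter" where
  "letter_inv G (Gen x) = Gen (inv\<^bsub>G\<^esub> x)"
| "letter_inv G (Per i h) = Per i (inv\<^bsub>G\<^esub> h)"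

definition rev_path :: "('a, 'b) monoid_scheme \<Rightarrow> 'a path \<Rightarrow> 'a path" where
  "rev_path G p = (path_end G p, rev (map (letter_inv G) (snd p)))"

definition subpath :: "('a, 'b) monoid_scheme \<Rightarrow> 'a path \<Rightarrow> nat \<Rightarrow> nat \<Rightarrow> 'a path" where
  "subpath G p i j = (vertex G p i, take (j - i) (drop i (snd p)))"

definition translate :: "('a, 'b) monoid_scheme \<Rightarrow> 'a \<Rightarrow> 'a path \<Rightarrow> 'a path" where
  "translate G g p = (g \<otimes>\<^bsub>G\<^esub> fst p, snd p)"

definition extend :: "'a path \<Rightarrow> 'a letter list \<Rightarrow> 'a path" where
  "extend p w = (fst p, snd p @ w)"

locale relative_cayley = group G for G (structure) +
  fixes X :: "'a set" and Hs :: "'a set list"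
  assumes fin_X: "finite X" and X_carrier: "X \<subseteq> carrier G"
    and gen_X: "generate G X = carrier G"
    and X_inv: "\<And>x. x \<in> X \<Longrightarrow> inv x \<in> X"
    and Hs_subgroup: "\<And>k. k < length Hs \<Longrightarrow> subgroup (Hs ! k) G"
begin

abbreviation dX :: "'a \<Rightarrow> 'a \<Rightarrow> nat" where "dX \<equiv> word_dist G X"
abbreviation d :: "'a \<Rightarrow> 'a \<Rightarrow> nat" where "d \<equiv> cayley_dist G X Hs"
abbreviation wlen :: "'a \<Rightarrow> nat" where "wlen \<equiv> word_length G X"
abbreviation vert :: "'a path \<Rightarrow> nat \<Rightarrow> 'a" where "vert \<equiv> vertex G"
abbreviation alph :: "'a letter set" where "alph \<equiv> alphabet G X Hs"
abbreviation geo :: "'a path \<Rightarrow> bool" where "geo \<equiv> geodesic G X Hs"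

lemma ex_word:
  assumes "g \<in> carrier G" shows "\<exists>xs \<in> lists X. word_prod G xs = g"
proof -
  have "g \<in> generate G X" using assms gen_X by simp
  then show ?thesis
  proof (induction rule: generate.induct)
    case one
    have "[] \<in> lists X" by simp
    then show ?case by (metis word_prod_Nil)
  next
    case (incl h)
    then show ?case using X_carrier by (intro bexI[of _ "[h]"]) auto
  next
    case (inv h)
    then show ?case using X_carrier X_inv by (intro bexI[of _ "[inv h]"]) auto
  next
    case (eng h1 h2)
    then obtain a b where "a \<in> lists X" "word_prod G a = h1" "b \<in> lists X" "word_prod G b = h2"
      by blast
    moreover from this have "word_prod G (a @ b) = h1 \<otimes> h2"
      using X_carrier by (subst word_prod_append) auto
    ultimately show ?case by (intro bexI[of _ "a @ b"]) auto
  qed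
qed

lemma wlen_word:
  assumes "g \<in> carrier G"
  shows "\<exists>xs \<in> lists X. length xs = wlen g \<and> word_prod G xs = g"
proof -
  have "\<exists>n. \<exists>xs \<in> lists X. length xs = n \<and> word_prod G xs = g"
    using ex_word[OF assms] by blast
  then show ?thesis unfolding word_length_def by (rule LeastI_ex)
qed

lemma wlen_le: "xs \<in> lists X \<Longrightarrow> wlen (word_prod G xs) \<le> length xs"
  unfolding word_length_def by (rule Least_le) blast

lemma wlen_one [simp]: "wlen \<one> = 0"
  using wlen_le[of "[]"] by simp

lemma wlen_mult:
  assumes "f \<in> carrier G" "g \<in> carrier G" shows "wlen (f \<otimes> g) \<le> wlen f + wlen g"
proof -
  obtain a b where ab: "a \<in> lists X" "word_prod G a = f" "length a = wlen f"
    "b \<in> lists X" "word_prod G b = g" "length b = wlen g"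
    using wlen_word assms by metis
  then have "word_prod G (a @ b) = f \<otimes> g"
    using X_carrier by (subst word_prod_append) auto
  then show ?thesis using wlen_le[of "a @ b"] ab by auto
qed

lemma wlen_inv_le:
  assumes "f \<in> carrier G" shows "wlen (inv f) \<le> wlen f"
proof -
  obtain a where a: "a \<in> lists X" "word_prod G a = f" "length a = wlen f"
    using wlen_word assms by metis
  then have "word_prod G (rev (map (\<lambda>x. inv x) a)) = inv f"
    using X_carrier by (subst word_prod_rev_inv) auto
  moreover have "rev (map (\<lambda>x. inv x) a) \<in> lists X" using a X_inv by auto
  ultimately show ?thesis using wlen_le[of "rev (map (\<lambda>x. inv x) a)"] a by auto
qed

lemma wlen_inv: "f \<in> carrier G \<Longrightarrow> wlen (inv f) = wlen f"
  using wlen_inv_le[of f] wlen_inv_le[of "inv f"] by (simp add: le_antisym)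

lemma finite_ball: "finite {g \<in> carrier G. wlen g \<le> n}"
proof (rule finite_subset)
  show "{g \<in> carrier G. wlen g \<le> n} \<subseteq> word_prod G ` {xs. set xs \<subseteq> X \<and> length xs \<le> n}"
    using wlen_word by (force simp: lists_eq_set)
  show "finite (word_prod G ` {xs. set xs \<subseteq> X \<and> length xs \<le> n})"
    using fin_X by (intro finite_imageI finite_lists_length_le)
qed

lemma dX_self [simp]: "f \<in> carrier G \<Longrightarrow> dX f f = 0"
  by (simp add: word_dist_def)

lemma dX_sym: "f \<in> carrier G \<Longrightarrow> g \<in> carrier G \<Longrightarrow> dX f g = dX g f"
  using wlen_inv[of "inv f \<otimes> g"] by (simp add: word_dist_def inv_mult_group)

lemma dX_triangle:
  assumes "f \<in> carrier G" "g \<in> carrier G" "h \<in> carrier G"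
  shows "dX f h \<le> dX f g + dX g h"
  using wlen_mult[of "inv f \<otimes> g" "inv g \<otimes> h"] assms by (simp add: word_dist_def m_assoc)

lemma inv_translate:
  assumes "a \<in> carrier G" "f \<in> carrier G" "g \<in> carrier G"
  shows "inv (a \<otimes> f) \<otimes> (a \<otimes> g) = inv f \<otimes> g"
  using assms by (simp add: inv_mult_group m_assoc)

lemma dX_translate:
  "a \<in> carrier G \<Longrightarrow> f \<in> carrier G \<Longrightarrow> g \<in> carrier G \<Longrightarrow> dX (a \<otimes> f) (a \<otimes> g) = dX f g"
  by (simp add: word_dist_def inv_translate)

lemma dX_mult_right: "f \<in> carrier G \<Longrightarrow> g \<in> carrier G \<Longrightarrow> dX f (f \<otimes> g) = wlen g"
  by (simp add: word_dist_def)


section \<open>Paths in the relative Cayley graph\<close>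

lemma Hs_carrier: "k < length Hs \<Longrightarrow> Hs ! k \<subseteq> carrier G"
  using Hs_subgroup subgroup.subset by blast

lemma letter_val_carrier: "a \<in> alph \<Longrightarrow> letter_val a \<in> carrier G"
  using X_carrier subsetD[OF Hs_carrier] unfolding alphabet_def by auto

lemma letters_carrier: "w \<in> lists alph \<Longrightarrow> set (map letter_val w) \<subseteq> carrier G"
  using letter_val_carrier by auto

lemma letter_inv_alph:
  assumes "a \<in> alph" shows "letter_inv G a \<in> alph"
proof -
  have "inv h \<in> Hs ! k - {\<one>}" if "k < length Hs" "h \<in> Hs ! k - {\<one>}" for k h
    using that Hs_subgroup[OF that(1)] Hs_carrier[OF that(1)]
    by (auto simp: subgroup.m_inv_closed inv_eq_1_iff)
  then show ?thesis using assms X_inv unfolding alphabet_def by auto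
qed

lemma letter_val_inv: "letter_val (letter_inv G a) = inv (letter_val a)"
  by (cases a) auto

lemma paths_iff: "p \<in> paths G X Hs \<longleftrightarrow> fst p \<in> carrier G \<and> snd p \<in> lists alph"
  unfolding paths_def by (cases p) auto

lemma vert_carrier: "p \<in> paths G X Hs \<Longrightarrow> vert p n \<in> carrier G"
  unfolding vertex_def paths_iff using letters_carrier
  by (intro m_closed word_prod_closed) (auto dest!: in_set_takeD)

lemma vert_Suc:
  assumes "p \<in> paths G X Hs" "n < path_length p"
  shows "vert p (Suc n) = vert p n \<otimes> letter_val (snd p ! n)"
proof -
  have l: "set (map letter_val (snd p)) \<subseteq> carrier G"
    using assms letters_carrier by (simp add: paths_iff)
  have "take (Suc n) (snd p) = take n (snd p) @ [snd p ! n]"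
    using assms by (simp add: path_length_def take_Suc_conv_app_nth)
  moreover have "letter_val (snd p ! n) \<in> carrier G" "set (map letter_val (take n (snd p))) \<subseteq> carrier G"
    using l assms(2) by (auto simp: path_length_def dest: in_set_takeD nth_mem)
  ultimately show ?thesis using assms
    by (simp add: vertex_def word_prod_append paths_iff m_assoc word_prod_closed)
qed

lemma vert_0: "p \<in> paths G X Hs \<Longrightarrow> vert p 0 = fst p"
  by (simp add: vertex_def paths_iff)

lemma nth_alph: "p \<in> paths G X Hs \<Longrightarrow> n < path_length p \<Longrightarrow> snd p ! n \<in> alph"
  by (auto simp: paths_iff path_length_def dest: nth_mem)

text \<open>The induction for subpaths and reversed paths: comparing one step at a time avoids
  computing with products of sublists.\<close>

lemma vert_unique:
  assumes "p \<in> paths G X Hs" "f 0 = fst p"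
    and "\<And>n. n < path_length p \<Longrightarrow> f (Suc n) = f n \<otimes> letter_val (snd p ! n)"
  shows "n \<le> path_length p \<Longrightarrow> vert p n = f n"
proof (induction n)
  case 0 then show ?case using assms by (simp add: vert_0)
next
  case (Suc n) then show ?case using assms by (simp add: vert_Suc)
qed

lemma length_extend [simp]: "path_length (extend p w) = path_length p + length w"
  by (simp add: extend_def path_length_def)

lemma extend_paths: "p \<in> paths G X Hs \<Longrightarrow> w \<in> lists alph \<Longrightarrow> extend p w \<in> paths G X Hs"
  by (simp add: extend_def paths_iff)

lemma vert_extend_left: "n \<le> path_length p \<Longrightarrow> vert (extend p w) n = vert p n"
  by (simp add: vertex_def extend_def path_length_def)

lemma vert_extend_right:
  assumes "p \<in> paths G X Hs" "w \<in> lists alph" "g = path_end G p"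
  shows "vert (extend p w) (path_length p + n) = vert (g, w) n"
proof -
  have "set (map letter_val (snd p)) \<subseteq> carrier G" "set (map letter_val (take n w)) \<subseteq> carrier G"
    using assms letters_carrier by (auto simp: paths_iff dest: in_set_takeD)
  then show ?thesis using assms
    by (simp add: vertex_def extend_def path_length_def path_end_def word_prod_append m_assoc
        paths_iff word_prod_closed)
qed

lemma letter_extend_right: "snd (extend p w) ! (path_length p + n) = w ! n"
  by (simp add: extend_def path_length_def)

lemma subpath_paths: "p \<in> paths G X Hs \<Longrightarrow> subpath G p i j \<in> paths G X Hs"
  using vert_carrier[of p i]
  by (auto simp: subpath_def paths_iff dest!: in_set_takeD in_set_dropD)

lemma length_subpath: "i \<le> j \<Longrightarrow> j \<le> path_length p \<Longrightarrow> path_length (subpath G p i j) = j - i"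
  by (simp add: subpath_def path_length_def)

lemma vert_subpath:
  assumes "p \<in> paths G X Hs" "i \<le> j" "j \<le> path_length p" "n \<le> j - i"
  shows "vert (subpath G p i j) n = vert p (i + n)"
  using assms
  by (intro vert_unique[where f = "\<lambda>n. vert p (i + n)"])
    (auto simp: subpath_paths length_subpath, auto simp: subpath_def path_length_def vert_Suc)

lemma translate_paths: "p \<in> paths G X Hs \<Longrightarrow> g \<in> carrier G \<Longrightarrow> translate G g p \<in> paths G X Hs"
  by (simp add: translate_def paths_iff)

lemma length_translate [simp]: "path_length (translate G g p) = path_length p"
  by (simp add: translate_def path_length_def)

lemma vert_translate:
  assumes "p \<in> paths G X Hs" "g \<in> carrier G"
  shows "vert (translate G g p) n = g \<otimes> vert p n"
proof -
  have "set (map letter_val (take n (snd p))) \<subseteq> carrier G"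
    using assms letters_carrier by (auto simp: paths_iff dest: in_set_takeD)
  then show ?thesis using assms
    by (simp add: vertex_def translate_def m_assoc paths_iff word_prod_closed)
qed

lemma rev_path_paths: "p \<in> paths G X Hs \<Longrightarrow> rev_path G p \<in> paths G X Hs"
  using letter_inv_alph vert_carrier[of p]
  by (auto simp: rev_path_def paths_iff path_end_def in_lists_conv_set)

lemma length_rev_path [simp]: "path_length (rev_path G p) = path_length p"
  by (simp add: rev_path_def path_length_def)

lemma vert_rev_path:
  assumes p: "p \<in> paths G X Hs" and n: "n \<le> path_length p"
  shows "vert (rev_path G p) n = vert p (path_length p - n)"
proof -
  have "vert p (path_length p - Suc n)
    = vert p (path_length p - n) \<otimes> letter_val (snd (rev_path G p) ! n)"
    if "n < path_length p" for n
  proof -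
    let ?m = "path_length p - Suc n"
    have m: "?m < path_length p" "Suc ?m = path_length p - n" using that by auto
    have "snd (rev_path G p) ! n = letter_inv G (snd p ! ?m)"
      using that by (simp add: rev_path_def path_length_def rev_nth)
    then show ?thesis
      using vert_Suc[OF p m(1)] vert_carrier[OF p] letter_val_carrier[OF nth_alph[OF p m(1)]] m(2)
      by (simp add: letter_val_inv m_assoc)
  qed
  then show ?thesis
    using n by (intro vert_unique[where f = "\<lambda>n. vert p (path_length p - n)"] rev_path_paths p)
      (simp_all, simp add: rev_path_def path_end_def)
qed

lemma ex_path:
  assumes "f \<in> carrier G" "g \<in> carrier G"
  shows "\<exists>p \<in> paths G X Hs. path_start G p = f \<and> path_end G p = g \<and> path_length p = dX f g"
proof -
  obtain xs where xs: "xs \<in> lists X" "length xs = wlen (inv f \<otimes> g)" "word_prod G xs = inv f \<otimes> g"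
    using wlen_word[of "inv f \<otimes> g"] assms by auto
  have "map (letter_val \<circ> Gen) xs = xs" by (simp add: comp_def)
  then show ?thesis using assms xs
    by (intro bexI[of _ "(f, map Gen xs)"])
      (auto simp: path_start_def path_end_def path_length_def vertex_def word_dist_def paths_iff
        alphabet_def)
qed

lemma ex_shortest_path:
  assumes "f \<in> carrier G" "g \<in> carrier G"
  shows "\<exists>p \<in> paths G X Hs. path_start G p = f \<and> path_end G p = g \<and> path_length p = d f g"
proof -
  have "\<exists>n. \<exists>p \<in> paths G X Hs. path_start G p = f \<and> path_end G p = g \<and> path_length p = n"
    using ex_path[OF assms] by blast
  then show ?thesis unfolding cayley_dist_def by (rule LeastI_ex)
qed

lemma d_le: "p \<in> paths G X Hs \<Longrightarrow> d (path_start G p) (path_end G p) \<le> path_length p"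
  unfolding cayley_dist_def by (rule Least_le) blast

lemma d_vert_le:
  assumes "p \<in> paths G X Hs" "i \<le> j" "j \<le> path_length p"
  shows "d (vert p i) (vert p j) \<le> j - i"
  using d_le[OF subpath_paths[OF assms(1), of i j]] assms
  by (simp add: path_start_def path_end_def vert_subpath length_subpath)

lemma ex_geodesic:
  assumes "f \<in> carrier G" "g \<in> carrier G"
  shows "\<exists>p. geo p \<and> vert p 0 = f \<and> vert p (path_length p) = g"
  using ex_shortest_path[OF assms] unfolding geodesic_def path_start_def path_end_def by metis

lemma d_le_dX: "f \<in> carrier G \<Longrightarrow> g \<in> carrier G \<Longrightarrow> d f g \<le> dX f g"
  using ex_path[of f g] d_le by force

lemma d_self [simp]: "f \<in> carrier G \<Longrightarrow> d f f = 0"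
  using d_le_dX[of f f] by simp

lemma d_translate_le:
  assumes "a \<in> carrier G" "f \<in> carrier G" "g \<in> carrier G"
  shows "d (a \<otimes> f) (a \<otimes> g) \<le> d f g"
proof -
  obtain p where p: "p \<in> paths G X Hs" "path_start G p = f" "path_end G p = g" "path_length p = d f g"
    using ex_shortest_path assms by blast
  then show ?thesis using d_le[OF translate_paths[OF p(1) assms(1)]] assms
    by (simp add: path_start_def path_end_def vert_translate)
qed

lemma d_translate:
  assumes "a \<in> carrier G" "f \<in> carrier G" "g \<in> carrier G"
  shows "d (a \<otimes> f) (a \<otimes> g) = d f g"
  using d_translate_le[OF assms] d_translate_le[of "inv a" "a \<otimes> f" "a \<otimes> g"] assms by simp

lemma d_triangle:
  assumes "f \<in> carrier G" "g \<in> carrier G" "h \<in> carrier G"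
  shows "d f h \<le> d f g + d g h"
proof -
  obtain p where p: "p \<in> paths G X Hs" "path_start G p = f" "path_end G p = g" "path_length p = d f g"
    using ex_shortest_path assms by blast
  obtain q where q: "q \<in> paths G X Hs" "path_start G q = g" "path_end G q = h" "path_length q = d g h"
    using ex_shortest_path assms by blast
  have "q = (path_end G p, snd q)"
    using p q vert_0[OF q(1)] by (simp add: path_start_def prod_eq_iff)
  moreover have "snd q \<in> lists alph" using q by (simp add: paths_iff)
  moreover have "length (snd q) = path_length q" by (simp add: path_length_def)
  ultimately show ?thesis
    using d_le[OF extend_paths[OF p(1), of "snd q"]] vert_extend_right[OF p(1) _ HOL.refl, of "snd q" "path_length q"]
      vert_extend_left[of 0 p] p q
    by (simp add: path_start_def path_end_def)
qed

lemma d_sym: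
  assumes "f \<in> carrier G" "g \<in> carrier G" shows "d f g = d g f"
proof -
  have "d g f \<le> d f g" if "f \<in> carrier G" "g \<in> carrier G" for f g
  proof -
    obtain p where p: "p \<in> paths G X Hs" "path_start G p = f" "path_end G p = g" "path_length p = d f g"
      using ex_shortest_path \<open>f \<in> carrier G\<close> \<open>g \<in> carrier G\<close> by blast
    then show ?thesis using d_le[OF rev_path_paths[OF p(1)]]
      by (simp add: path_start_def path_end_def vert_rev_path)
  qed
  then show ?thesis using assms by (simp add: le_antisym)
qed

lemma geo_paths: "geo p \<Longrightarrow> p \<in> paths G X Hs"
  by (simp add: geodesic_def)

lemma geo_d:
  assumes "geo p" "i \<le> j" "j \<le> path_length p"
  shows "d (vert p i) (vert p j) = j - i"
proof (rule antisym)
  have p: "p \<in> paths G X Hs" using assms by (simp add: geo_paths)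
  show "d (vert p i) (vert p j) \<le> j - i" using p assms by (intro d_vert_le) auto
  have "path_length p = d (vert p 0) (vert p (path_length p))"
    using assms by (simp add: geodesic_def path_start_def path_end_def)
  also have "\<dots> \<le> d (vert p 0) (vert p i) + d (vert p i) (vert p j) + d (vert p j) (vert p (path_length p))"
    using d_triangle[of "vert p 0" "vert p j" "vert p (path_length p)"]
      d_triangle[of "vert p 0" "vert p i" "vert p j"] p vert_carrier by fastforce
  also have "\<dots> \<le> i + d (vert p i) (vert p j) + (path_length p - j)"
    using d_vert_le[OF p, of 0 i] d_vert_le[OF p, of j "path_length p"] assms by auto
  finally show "j - i \<le> d (vert p i) (vert p j)" using assms by linarith
qed

lemma geoI:
  "p \<in> paths G X Hs \<Longrightarrow> d (vert p 0) (vert p (path_length p)) = path_length p \<Longrightarrow> geo p"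
  by (simp add: geodesic_def path_start_def path_end_def)

lemma geo_subpath: "geo p \<Longrightarrow> i \<le> j \<Longrightarrow> j \<le> path_length p \<Longrightarrow> geo (subpath G p i j)"
  by (intro geoI) (auto simp: subpath_paths geo_paths length_subpath vert_subpath geo_d)

lemma geo_translate: "geo p \<Longrightarrow> g \<in> carrier G \<Longrightarrow> geo (translate G g p)"
  by (intro geoI)
    (auto simp: translate_paths geo_paths vert_translate d_translate vert_carrier geo_d)

lemma geo_rev: "geo p \<Longrightarrow> geo (rev_path G p)"
  by (intro geoI)
    (auto simp: rev_path_paths geo_paths vert_rev_path d_sym vert_carrier geo_d)

lemma geo_qg: "geo p \<Longrightarrow> 1 \<le> l \<Longrightarrow> 0 \<le> c \<Longrightarrow> quasi_geodesic G X Hs l c p"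
  unfolding quasi_geodesic_def
proof (intro conjI allI impI)
  fix i j assume a: "geo p" "1 \<le> l" "0 \<le> c" "i \<le> j \<and> j \<le> path_length p"
  have "1 * real (j - i) \<le> l * real (j - i)" using a by (intro mult_right_mono) auto
  then show "real (j - i) \<le> l * real (d (vert p i) (vert p j)) + c"
    using a by (simp add: geo_d)
qed (simp add: geo_paths)

end

section \<open>Cosets, projections and bounded coset penetration\<close>

context relative_cayley
begin

definition cosets :: "nat \<Rightarrow> 'a set set" where
  "cosets k = {g <# (Hs ! k) |g. g \<in> carrier G}"

text \<open>Such a path has no component in \<open>A\<close>; this is what lets bounded coset penetration bite below.\<close>

definition hits :: "'a set \<Rightarrow> 'a path \<Rightarrow> bool" where
  "hits A p \<longleftrightarrow> vert p (path_length p) \<in> A \<and> (\<forall>n<path_length p. vert p n \<notin> A)"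

text \<open>A coarse projection onto \<open>A\<close>.  Entrance points are used rather than nearest points, because a
  geodesic that passes through \<open>A\<close> can be cut at them.\<close>

definition proj :: "'a set \<Rightarrow> 'a \<Rightarrow> 'a set" where
  "proj A x = {a. \<exists>p. geo p \<and> vert p 0 = x \<and> hits A p \<and> vert p (path_length p) = a}"

lemma l_coset_mem:
  assumes "k < length Hs" "g \<in> carrier G"
  shows "b \<in> g <# (Hs ! k) \<longleftrightarrow> b \<in> carrier G \<and> inv g \<otimes> b \<in> Hs ! k"
proof
  assume "b \<in> g <# (Hs ! k)"
  then obtain h where "h \<in> Hs ! k" "b = g \<otimes> h" by (auto simp: l_coset_def)
  then show "b \<in> carrier G \<and> inv g \<otimes> b \<in> Hs ! k"
    using assms subsetD[OF Hs_carrier[OF assms(1)]] by auto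
next
  assume b: "b \<in> carrier G \<and> inv g \<otimes> b \<in> Hs ! k"
  then have "b = g \<otimes> (inv g \<otimes> b)" using assms by simp
  then show "b \<in> g <# (Hs ! k)" using b unfolding l_coset_def by blast
qed

lemma coset_carrier: "k < length Hs \<Longrightarrow> A \<in> cosets k \<Longrightarrow> A \<subseteq> carrier G"
  unfolding cosets_def using l_coset_mem by blast

lemma coset_mem_iff:
  assumes k: "k < length Hs" and A: "A \<in> cosets k" and a: "a \<in> A" and b: "b \<in> carrier G"
  shows "b \<in> A \<longleftrightarrow> inv a \<otimes> b \<in> Hs ! k"
proof -
  obtain g where g: "g \<in> carrier G" "A = g <# (Hs ! k)" using A unfolding cosets_def by blast
  have a': "a \<in> carrier G" "inv g \<otimes> a \<in> Hs ! k" using a l_coset_mem[OF k g(1)] g(2) by auto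
  interpret H: subgroup "Hs ! k" G using Hs_subgroup[OF k] .
  have "inv g \<otimes> b = (inv g \<otimes> a) \<otimes> (inv a \<otimes> b)" using a' g b by (simp add: m_assoc)
  moreover have "inv a \<otimes> b = inv (inv g \<otimes> a) \<otimes> (inv g \<otimes> b)"
    using a' g b by (simp add: m_assoc inv_mult_group)
  ultimately show ?thesis
    using a' l_coset_mem[OF k g(1), of b] g(2) b by (metis H.m_closed H.m_inv_closed)
qed

lemma coset_eq:
  assumes "k < length Hs" "A \<in> cosets k" "B \<in> cosets k" "a \<in> A" "a \<in> B"
  shows "A = B"
proof (rule Set.set_eqI)
  fix b
  show "b \<in> A \<longleftrightarrow> b \<in> B"
    using coset_mem_iff[OF assms(1,2,4), of b] coset_mem_iff[OF assms(1,3,5), of b]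
      subsetD[OF coset_carrier[OF assms(1,2)], of b] subsetD[OF coset_carrier[OF assms(1,3)], of b]
    by argo
qed

lemma l_coset_self: "k < length Hs \<Longrightarrow> g \<in> carrier G \<Longrightarrow> g \<in> g <# (Hs ! k)"
  using l_coset_mem[of k g g] subgroup.one_closed[OF Hs_subgroup, of k] by simp

lemma l_coset_cosets: "g \<in> carrier G \<Longrightarrow> g <# (Hs ! k) \<in> cosets k"
  unfolding cosets_def by blast

lemma coset_nonempty:
  assumes "k < length Hs" "A \<in> cosets k"
  shows "A \<noteq> {}"
proof -
  obtain g where "g \<in> carrier G" "A = g <# (Hs ! k)" using assms unfolding cosets_def by blast
  then show ?thesis using l_coset_self[OF assms(1), of g] by blast
qed

lemma coset_translate:
  assumes "k < length Hs" "A \<in> cosets k" "f \<in> carrier G"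
  shows "f <# A \<in> cosets k"
proof -
  obtain g where "g \<in> carrier G" "A = g <# (Hs ! k)" using assms unfolding cosets_def by blast
  then have "f <# A = (f \<otimes> g) <# (Hs ! k)" using assms Hs_carrier by (simp add: lcos_m_assoc)
  then show ?thesis unfolding cosets_def using assms \<open>g \<in> carrier G\<close> by blast
qed

lemma translate_mem_iff:
  assumes "k < length Hs" "A \<in> cosets k" "f \<in> carrier G" "a \<in> carrier G"
  shows "f \<otimes> a \<in> f <# A \<longleftrightarrow> a \<in> A"
  using assms(3,4) subsetD[OF coset_carrier[OF assms(1,2)]] by (auto simp: l_coset_def)

lemma ex_coset: "k < length Hs \<Longrightarrow> x \<in> carrier G \<Longrightarrow> \<exists>A \<in> cosets k. x \<in> A"
  using l_coset_self l_coset_cosets by blast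

lemma per_letter:
  assumes "p \<in> paths G X Hs" "n < path_length p" "snd p ! n = Per k h"
  shows "k < length Hs" "h \<in> Hs ! k"
  using nth_alph[OF assms(1,2)] assms(3) unfolding alphabet_def by auto

lemma per_step:
  assumes p: "p \<in> paths G X Hs" and n: "n < path_length p" and k: "snd p ! n = Per k h"
    and A: "A \<in> cosets k"
  shows "vert p n \<in> A \<longleftrightarrow> vert p (Suc n) \<in> A"
proof -
  have k': "k < length Hs" "h \<in> Hs ! k" using per_letter[OF p n k] .
  obtain B where B: "B \<in> cosets k" "vert p n \<in> B" using ex_coset k' vert_carrier[OF p] by metis
  have "inv (vert p n) \<otimes> vert p (Suc n) = h"
    using vert_Suc[OF p n] k vert_carrier[OF p] subsetD[OF Hs_carrier k'(2)] k'(1) by simp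
  then have "vert p (Suc n) \<in> B"
    using coset_mem_iff[OF k'(1) B vert_carrier[OF p]] k' by simp
  then show ?thesis using coset_eq[OF k'(1) A B(1)] B(2) by auto
qed

lemma coset_letter:
  assumes "k < length Hs" "A \<in> cosets k" "a \<in> A" "b \<in> A" "a \<noteq> b"
  shows "Per k (inv a \<otimes> b) \<in> alph"
proof -
  have ab: "a \<in> carrier G" "b \<in> carrier G" using assms coset_carrier by auto
  have "inv a \<otimes> b \<noteq> \<one>"
  proof
    assume "inv a \<otimes> b = \<one>"
    then have "a \<otimes> (inv a \<otimes> b) = a \<otimes> \<one>" by simp
    then show False using assms(5) ab by simp
  qed
  then show ?thesis
    using assms ab coset_mem_iff[OF assms(1-3) ab(2)] unfolding alphabet_def by auto
qed

lemma coset_d: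
  assumes "k < length Hs" "A \<in> cosets k" "a \<in> A" "b \<in> A"
  shows "d a b \<le> 1"
proof (cases "a = b")
  case True
  then show ?thesis using assms subsetD[OF coset_carrier[OF assms(1,2)]] by simp
next
  case False
  have ab: "a \<in> carrier G" "b \<in> carrier G" using assms coset_carrier by auto
  then have "(a, [Per k (inv a \<otimes> b)]) \<in> paths G X Hs"
    using coset_letter[OF assms False] by (simp add: paths_iff)
  from d_le[OF this] show ?thesis
    using ab by (simp add: path_start_def path_end_def path_length_def vertex_def)
qed

text \<open>Peripheral cosets have diameter at most one in the relative Cayley graph.\<close>

lemma geo_coset:
  assumes "geo p" "k < length Hs" "A \<in> cosets k" "i \<le> j" "j \<le> path_length p"
    "vert p i \<in> A" "vert p j \<in> A"
  shows "j \<le> Suc i"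
  using geo_d[OF assms(1,4,5)] coset_d[OF assms(2,3,6,7)] by linarith

lemma translate_hits:
  assumes "p \<in> paths G X Hs" "k < length Hs" "A \<in> cosets k" "f \<in> carrier G"
  shows "hits (f <# A) (translate G f p) \<longleftrightarrow> hits A p"
  using assms by (simp add: hits_def vert_translate translate_mem_iff vert_carrier)

lemma proj_translate:
  assumes "a \<in> proj A x" "k < length Hs" "A \<in> cosets k" "f \<in> carrier G"
  shows "f \<otimes> a \<in> proj (f <# A) (f \<otimes> x)"
proof -
  obtain p where p: "geo p" "vert p 0 = x" "hits A p" "vert p (path_length p) = a"
    using assms unfolding proj_def by blast
  then show ?thesis using assms unfolding proj_def
    by (intro CollectI exI[of _ "translate G f p"])
      (auto simp: geo_translate translate_hits geo_paths vert_translate)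
qed

lemma proj_subset: "a \<in> proj A x \<Longrightarrow> a \<in> A"
  unfolding proj_def hits_def by auto

lemma proj_carrier: "a \<in> proj A x \<Longrightarrow> a \<in> carrier G" "a \<in> proj A x \<Longrightarrow> x \<in> carrier G"
  unfolding proj_def using vert_carrier geo_paths by auto

lemma first_hit:
  assumes "geo p" "n \<le> path_length p" "vert p n \<in> A"
  shows "\<exists>m \<le> n. vert p m \<in> proj A (vert p 0)"
proof -
  define m where "m = (LEAST m. vert p m \<in> A)"
  have m: "vert p m \<in> A" "m \<le> n" "\<And>i. i < m \<Longrightarrow> vert p i \<notin> A"
    unfolding m_def using assms(3) by (auto intro: LeastI Least_le dest: not_less_Least)
  have "vert p m \<in> proj A (vert p 0)"
    using m assms unfolding proj_def hits_def
    by (intro CollectI exI[of _ "subpath G p 0 m"])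
      (auto simp: geo_subpath geo_paths vert_subpath length_subpath)
  then show ?thesis using m by blast
qed

lemma first_hit_from:
  assumes "geo p" "i \<le> n" "n \<le> path_length p" "vert p n \<in> A"
  shows "\<exists>m. i \<le> m \<and> m \<le> n \<and> vert p m \<in> proj A (vert p i)"
proof -
  have "\<exists>m \<le> n - i. vert (subpath G p i n) m \<in> proj A (vert (subpath G p i n) 0)"
    using assms by (intro first_hit) (auto simp: geo_subpath geo_paths length_subpath vert_subpath)
  then obtain m where "m \<le> n - i" "vert p (i + m) \<in> proj A (vert p i)"
    using assms by (auto simp: geo_paths vert_subpath)
  then show ?thesis using assms by (intro exI[of _ "i + m"]) auto
qed

lemma last_hit:
  assumes "geo p" "n \<le> path_length p" "vert p n \<in> A"
  shows "\<exists>m. n \<le> m \<and> m \<le> path_length p \<and> vert p m \<in> proj A (vert p (path_length p))"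
proof -
  have "\<exists>m \<le> path_length p - n. vert (rev_path G p) m \<in> proj A (vert (rev_path G p) 0)"
    using assms by (intro first_hit) (auto simp: geo_rev geo_paths vert_rev_path)
  then obtain m where "m \<le> path_length p - n"
    "vert p (path_length p - m) \<in> proj A (vert p (path_length p))"
    using assms by (auto simp: geo_paths vert_rev_path)
  then show ?thesis using assms by (intro exI[of _ "path_length p - m"]) auto
qed

lemma proj_nonempty:
  assumes "k < length Hs" "A \<in> cosets k" "x \<in> carrier G"
  shows "\<exists>a. a \<in> proj A x"
proof -
  obtain b where b: "b \<in> A" "b \<in> carrier G"
    using coset_nonempty[OF assms(1,2)] coset_carrier[OF assms(1,2)] by blast
  then obtain p where "geo p" "vert p 0 = x" "vert p (path_length p) = b"
    using ex_geodesic assms by metis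
  then show ?thesis using first_hit[of p "path_length p" A] b by auto
qed

text \<open>The vertices of two connected components of type \<open>k\<close> lie in one coset, so the hypothesis applies
  to the first letter of the earlier and the last letter of the later component.  If these letters
  coincide or are adjacent, all letters from the one to the other have type \<open>k\<close>, and by maximality
  both components are equal to this stretch.\<close>

lemma without_backtrackingI:
  assumes p: "p \<in> paths G X Hs"
    and step: "\<And>k A i j h h'. k < length Hs \<Longrightarrow> A \<in> cosets k \<Longrightarrow> i < j \<Longrightarrow> j < path_length p \<Longrightarrow>
      snd p ! i = Per k h \<Longrightarrow> snd p ! j = Per k h' \<Longrightarrow> vert p i \<in> A \<Longrightarrow> vert p (Suc j) \<in> A \<Longrightarrow>
      j = Suc i"
  shows "without_backtracking G Hs p"
  unfolding without_backtracking_def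
proof (intro allI impI notI, elim exE conjE)
  fix s k0 t
  assume ts: "t \<noteq> s" and con: "connected_components G Hs p s p t"
  obtain k g where k: "k < length Hs" "component p k s" "component p k t" and g: "g \<in> carrier G"
    and sub: "vert p ` {fst s..snd s} \<union> vert p ` {fst t..snd t} \<subseteq> g <# (Hs ! k)"
    using con unfolding connected_components_def by blast
  \<comment> \<open>the convex hull of the two components\<close>
  define i j where "i = min (fst s) (fst t)" and "j = max (snd s) (snd t) - 1"
  have per: "fst s < snd s" "snd s \<le> path_length p" "fst t < snd t" "snd t \<le> path_length p"
    "\<And>n. n \<in> {fst s..<snd s} \<Longrightarrow> \<exists>h. snd p ! n = Per k h"
    "\<And>n. n \<in> {fst t..<snd t} \<Longrightarrow> \<exists>h. snd p ! n = Per k h"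
    using k(2,3) unfolding component_def per_subpath_def by auto
  have ij: "i \<le> j" "j < path_length p" using per unfolding i_def j_def by auto
  have "i \<in> {fst s..<snd s} \<or> i \<in> {fst t..<snd t}" using per unfolding i_def by (auto simp: min_def)
  then obtain h where h: "snd p ! i = Per k h" using per by blast
  have "j \<in> {fst s..<snd s} \<or> j \<in> {fst t..<snd t}" using per unfolding j_def by (auto simp: max_def)
  then obtain h' where h': "snd p ! j = Per k h'" using per by blast
  have "i \<in> {fst s..snd s} \<union> {fst t..snd t}" "Suc j \<in> {fst s..snd s} \<union> {fst t..snd t}"
    using per unfolding i_def j_def by (auto simp: min_def max_def)
  then have "vert p i \<in> g <# (Hs ! k)" "vert p (Suc j) \<in> g <# (Hs ! k)" using sub by auto
  then have "i < j \<Longrightarrow> j = Suc i"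
    using step[OF k(1) _ _ ij(2) h h'] g unfolding cosets_def by blast
  then have "{i..<Suc j} = {i, j}" using ij(1) by (cases "i < j") auto
  then have "per_subpath p k (i, Suc j)" using ij h h' unfolding per_subpath_def by simp
  moreover have "i \<le> fst s" "i \<le> fst t" "snd s \<le> Suc j" "snd t \<le> Suc j"
    unfolding i_def j_def by auto
  ultimately have "(i, Suc j) = s" "(i, Suc j) = t"
    using k(2,3) unfolding component_def by auto
  then show False using ts by simp
qed

lemma geo_no_return:
  assumes "geo p" "k < length Hs" "A \<in> cosets k" "i < j" "j < path_length p"
    "vert p i \<in> A" "vert p (Suc j) \<in> A"
  shows False
  using geo_coset[OF assms(1-3), of i "Suc j"] assms by simp

lemma geo_without_backtracking: "geo p \<Longrightarrow> without_backtracking G Hs p"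
  by (rule without_backtrackingI) (auto simp: geo_paths dest: geo_no_return)

lemma geo_phase:
  assumes p: "geo p"
  shows "phase_vertices G p = vert p ` {..path_length p}"
proof -
  have "\<not> (component p k s \<and> fst s < n \<and> n < snd s)" for n k s
  proof
    assume a: "component p k s \<and> fst s < n \<and> n < snd s"
    then have n: "n - 1 < n" "n < path_length p" "Suc (n - 1) = n"
      and per: "\<And>m. m \<in> {fst s..<snd s} \<Longrightarrow> \<exists>h. snd p ! m = Per k h"
      unfolding component_def per_subpath_def by auto
    have "n - 1 \<in> {fst s..<snd s}" using a by auto
    then obtain h where h: "snd p ! (n - 1) = Per k h" using per by blast
    obtain h' where h': "snd p ! n = Per k h'" using per[of n] a by auto
    have k: "k < length Hs" using per_letter[OF geo_paths[OF p] n(2) h'] by simp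
    obtain A where A: "A \<in> cosets k" "vert p n \<in> A"
      using ex_coset[OF k vert_carrier[OF geo_paths[OF p]]] by blast
    have "vert p (n - 1) \<in> A" using per_step[OF geo_paths[OF p] _ h A(1)] n A by simp
    moreover have "vert p (Suc n) \<in> A" using per_step[OF geo_paths[OF p] n(2) h' A(1)] A by simp
    ultimately show False using geo_no_return[OF p k A(1) n(1,2)] by simp
  qed
  then show ?thesis unfolding phase_vertices_def by auto
qed

end

locale bcp_cayley = relative_cayley +
  assumes bcp: "bounded_coset_penetration G X Hs"
begin

text \<open>All vertices of a geodesic are phase, because an inner vertex of a component could be bypassed by
  a single edge.\<close>

lemma fellow_travel:
  "\<exists>\<epsilon>. \<forall>p q. geo p \<and> geo q \<and> dX (vert p 0) (vert q 0) \<le> \<kappa> \<and>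
      dX (vert p (path_length p)) (vert q (path_length q)) \<le> \<kappa> \<longrightarrow>
      (\<forall>n \<le> path_length p. \<exists>m \<le> path_length q. dX (vert p n) (vert q m) \<le> \<epsilon>)"
proof -
  have 1: "(1::real) \<le> 1 \<and> (0::real) \<le> 0 \<and> 0 \<le> real \<kappa>" by simp
  obtain \<epsilon> where \<epsilon>: "\<And>p q. quasi_geodesic G X Hs 1 0 p \<and> quasi_geodesic G X Hs 1 0 q \<and>
      without_backtracking G Hs p \<and> without_backtracking G Hs q \<and> similar_paths G X (real \<kappa>) p q \<Longrightarrow>
      (\<forall>u \<in> phase_vertices G p. \<exists>v \<in> phase_vertices G q. dX u v \<le> \<epsilon>)"
    using bcp[unfolded bounded_coset_penetration_def, rule_format, OF 1]
    by (elim exE conjE) (rule that, blast)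
  show ?thesis
  proof (rule exI[of _ \<epsilon>], intro allI impI)
    fix p q n
    assume a: "geo p \<and> geo q \<and> dX (vert p 0) (vert q 0) \<le> \<kappa> \<and>
      dX (vert p (path_length p)) (vert q (path_length q)) \<le> \<kappa>" and n: "n \<le> path_length p"
    have "\<forall>u \<in> phase_vertices G p. \<exists>v \<in> phase_vertices G q. dX u v \<le> \<epsilon>"
      using a by (intro \<epsilon>)
        (auto simp: geo_qg geo_without_backtracking similar_paths_def path_start_def path_end_def)
    then show "\<exists>m \<le> path_length q. dX (vert p n) (vert q m) \<le> \<epsilon>"
      using a n by (auto simp: geo_phase)
  qed
qed

text \<open>The form in which the second clause of bounded coset penetration is used.  Extend the geodesic
  \<open>q\<close> by the edge inside \<open>A\<close> from its end to the end of \<open>p\<close>.  The result is still a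
  quasigeodesic without backtracking, and its last edge is a component.  If that edge were long
  with respect to \<open>X\<close>, then \<open>p\<close> would have a component in \<open>A\<close>; but \<open>p\<close> meets \<open>A\<close>
  only once.  The constants 3 and 2 accommodate all the paths \<open>p\<close> that occur below.\<close>

lemma entry_points_close:
  "\<exists>\<epsilon>. \<forall>p q k A. k < length Hs \<and> A \<in> cosets k \<and>
      quasi_geodesic G X Hs 3 2 p \<and> without_backtracking G Hs p \<and> hits A p \<and>
      geo q \<and> hits A q \<and> dX (vert p 0) (vert q 0) \<le> \<kappa> \<longrightarrow>
      dX (vert p (path_length p)) (vert q (path_length q)) \<le> \<epsilon>"
proof -
  have 1: "(1::real) \<le> 3 \<and> (0::real) \<le> 2 \<and> 0 \<le> real \<kappa>" by simp
  obtain \<epsilon> where \<epsilon>: "\<And>p q i s. quasi_geodesic G X Hs 3 2 p \<and> quasi_geodesic G X Hs 3 2 q \<and>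
      without_backtracking G Hs p \<and> without_backtracking G Hs q \<and> similar_paths G X (real \<kappa>) p q \<Longrightarrow>
      component p i s \<Longrightarrow> \<epsilon> < dX (vert p (fst s)) (vert p (snd s)) \<Longrightarrow>
      \<exists>t. connected_components G Hs p s q t"
    using bcp[unfolded bounded_coset_penetration_def, rule_format, OF 1]
    by (elim exE conjE) (rule that, blast)
  show ?thesis
  proof (rule exI[of _ \<epsilon>], intro allI impI)
    fix p q k A
    assume a: "k < length Hs \<and> A \<in> cosets k \<and>
      quasi_geodesic G X Hs 3 2 p \<and> without_backtracking G Hs p \<and> hits A p \<and>
      geo q \<and> hits A q \<and> dX (vert p 0) (vert q 0) \<le> \<kappa>"
    define L a' b where "L = path_length q" and "a' = vert q L" and "b = vert p (path_length p)"
    have k: "k < length Hs" and A: "A \<in> cosets k" and p: "p \<in> paths G X Hs" and q: "geo q"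
      using a by (auto simp: quasi_geodesic_def)
    have q': "q \<in> paths G X Hs" using geo_paths[OF q] .
    have aA: "a' \<in> A" "b \<in> A" and qA: "\<And>n. n < L \<Longrightarrow> vert q n \<notin> A"
      and pA: "\<And>n. n < path_length p \<Longrightarrow> vert p n \<notin> A"
      using a unfolding a'_def b_def L_def hits_def by auto
    have car: "a' \<in> carrier G" "b \<in> carrier G" using aA coset_carrier[OF k A] by auto
    show "dX (vert p (path_length p)) (vert q (path_length q)) \<le> \<epsilon>"
    proof (rule ccontr)
      assume "\<not> ?thesis"
      then have far: "\<epsilon> < dX a' b" using dX_sym car unfolding a'_def b_def L_def by simp
      then have neq: "a' \<noteq> b" using car by auto
      define r where "r = extend q [Per k (inv a' \<otimes> b)]"
      have w: "[Per k (inv a' \<otimes> b)] \<in> lists alph" using coset_letter[OF k A aA neq] by simp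
      have r: "r \<in> paths G X Hs" unfolding r_def by (rule extend_paths[OF q' w])
      have len: "path_length r = Suc L" unfolding r_def L_def by simp
      have vl: "n \<le> L \<Longrightarrow> vert r n = vert q n" for n
        unfolding r_def L_def by (rule vert_extend_left)
      have vr: "vert r (Suc L) = b"
        using vert_extend_right[OF q' w, of a' 1] car unfolding r_def L_def a'_def path_end_def
        by (simp add: vertex_def)
      have lr: "snd r ! L = Per k (inv a' \<otimes> b)"
        using letter_extend_right[of q _ 0] unfolding r_def L_def by simp
      have qg: "quasi_geodesic G X Hs 3 2 r"
        unfolding quasi_geodesic_def
      proof (intro conjI allI impI r)
        fix i j assume ij: "i \<le> j \<and> j \<le> path_length r"
        consider "j \<le> L" | "i = Suc L" "j = Suc L" | "i \<le> L" "j = Suc L" using ij len by linarith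
        then have "j - i \<le> d (vert r i) (vert r j) + 2"
        proof cases
          case 1
          then show ?thesis using ij geo_d[OF q, of i j] by (simp add: vl L_def)
        next
          case 3
          have "L - i \<le> d (vert q i) a'" using geo_d[OF q, of i L] 3 by (simp add: L_def a'_def)
          also have "\<dots> \<le> d (vert q i) b + d b a'" using car vert_carrier[OF q'] by (intro d_triangle)
          also have "d b a' \<le> 1" using coset_d[OF k A] aA by simp
          finally show ?thesis using 3 by (simp add: vl vr)
        qed simp
        then have "real (j - i) \<le> real (d (vert r i) (vert r j)) + 2" by linarith
        also have "\<dots> \<le> 3 * real (d (vert r i) (vert r j)) + 2" by simp
        finally show "real (j - i) \<le> 3 * real (d (vert r i) (vert r j)) + 2" .
      qed
      have wb: "without_backtracking G Hs r"
      proof (rule without_backtrackingI[OF r])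
        fix k' B i j h h'
        assume b: "k' < length Hs" "B \<in> cosets k'" "i < j" "j < path_length r"
          "snd r ! i = Per k' h" "snd r ! j = Per k' h'" "vert r i \<in> B" "vert r (Suc j) \<in> B"
        show "j = Suc i"
        proof (cases "j < L")
          case True
          then show ?thesis using geo_no_return[OF q b(1-3)] b by (simp add: vl L_def)
        next
          case False
          then have j: "j = L" using b len by simp
          then have "k' = k" using b lr by simp
          then have "B = A" using coset_eq[OF k _ A, of B b] b j vr aA by simp
          then show ?thesis using qA[of i] b j by (simp add: vl)
        qed
      qed
      have comp: "component r k (L, Suc L)"
        unfolding component_def
      proof (intro conjI allI impI)
        show "per_subpath r k (L, Suc L)" using lr len unfolding per_subpath_def by simp
        fix t assume t: "per_subpath r k t \<and> fst t \<le> fst (L, Suc L) \<and> snd (L, Suc L) \<le> snd t"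
        then have st: "snd t = Suc L" using len unfolding per_subpath_def by simp
        have "\<not> fst t < L"
        proof
          assume lt: "fst t < L"
          then have "L - 1 \<in> {fst t..<snd t}" using st by auto
          then obtain h where h: "snd r ! (L - 1) = Per k h"
            using t unfolding per_subpath_def by blast
          have "vert r (L - 1) \<in> A"
            using per_step[OF r _ h A] lt len vl[of L] aA unfolding a'_def by simp
          then show False using qA[of "L - 1"] lt by (simp add: vl)
        qed
        then show "t = (L, Suc L)" using t st by (simp add: prod_eq_iff)
      qed
      have "similar_paths G X (real \<kappa>) r p"
        using a dX_sym[of "vert p 0" "vert q 0"] car vert_carrier[OF p] vert_carrier[OF q']
        by (simp add: similar_paths_def path_start_def path_end_def vl vr len b_def[symmetric])
      then obtain t where t: "connected_components G Hs r (L, Suc L) p t"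
        using \<epsilon>[of r p k "(L, Suc L)"] qg wb a comp far vl[of L] by (auto simp: vr a'_def)
      then obtain k' g where k': "component r k' (L, Suc L)" "component p k' t" and g: "g \<in> carrier G"
        and sub: "vert r ` {L..Suc L} \<union> vert p ` {fst t..snd t} \<subseteq> g <# (Hs ! k')"
        unfolding connected_components_def by auto
      have "k' = k" using k'(1) lr unfolding component_def per_subpath_def by auto
      moreover have "vert r (Suc L) \<in> g <# (Hs ! k')" using sub by auto
      ultimately have "g <# (Hs ! k') = A"
        using coset_eq[OF k _ A, of "g <# (Hs ! k')" b] g vr aA unfolding cosets_def by auto
      moreover have "fst t < snd t" "snd t \<le> path_length p"
        using k'(2) unfolding component_def per_subpath_def by auto
      ultimately have "vert p (fst t) \<in> A" "fst t < path_length p" using sub by auto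
      then show False using pA by simp
    qed
  qed
qed

end

section \<open>Geodesics between points with distant projections\<close>

context relative_cayley
begin

lemma vert_self: "geo q \<Longrightarrow> (vert q 0, snd q) = q"
  using vert_0[OF geo_paths] by (simp add: prod_eq_iff)

lemma geo_end_le:
  assumes q: "geo q" and far: "M \<le> d u (vert q (path_length q))" and M: "M = path_length q"
    and u: "u \<in> carrier G" and n: "n \<le> M"
  shows "n \<le> d u (vert q n)"
proof -
  have "M \<le> d u (vert q n) + d (vert q n) (vert q M)"
    using far d_triangle[OF u, of "vert q n" "vert q M"] vert_carrier[OF geo_paths[OF q]] M
    by (meson le_trans)
  moreover have "d (vert q n) (vert q M) = M - n" using geo_d[OF q n] M by simp
  ultimately show ?thesis using n by linarith
qed

text \<open>Follow a geodesic \<open>p\<close> that misses the coset \<open>A\<close>, and at its end turn off along a shortest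
  connection \<open>q\<close> from \<open>p\<close> to \<open>A\<close>.  For \<open>u\<close> on \<open>p\<close> and \<open>v\<close> on \<open>q\<close>, at distances
  \<open>i\<close> and \<open>n\<close> from the corner, minimality gives \<open>n \<le> d u v\<close>, hence
  \<open>i \<le> d u v + n \<le> 2 * d u v\<close>, and the part of the detour between them has length
  \<open>i + n \<le> 3 * d u v\<close>.  Minimality also excludes backtracking: a coset that meets both \<open>p\<close>
  and \<open>q\<close> in an edge can only do so in the two edges at the corner, which then belong to one
  component.\<close>

lemma detour:
  assumes p: "geo p" and q: "geo q" and joint: "vert q 0 = vert p (path_length p)"
    and k: "k < length Hs" and A: "A \<in> cosets k" and qA: "vert q (path_length q) \<in> A"
    and miss: "\<And>n. n \<le> path_length p \<Longrightarrow> vert p n \<notin> A"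
    and shortest: "\<And>n c. n \<le> path_length p \<Longrightarrow> c \<in> A \<Longrightarrow> path_length q \<le> d (vert p n) c"
  defines "r \<equiv> extend p (snd q)"
  shows "quasi_geodesic G X Hs 3 2 r" "without_backtracking G Hs r" "hits A r"
    "vert r 0 = vert p 0" "vert r (path_length r) = vert q (path_length q)"
proof -
  define L M where "L = path_length p" and "M = path_length q"
  have p': "p \<in> paths G X Hs" and q': "q \<in> paths G X Hs" using p q geo_paths by auto
  have w: "snd q \<in> lists alph" using q' by (simp add: paths_iff)
  have r: "r \<in> paths G X Hs" unfolding r_def by (rule extend_paths[OF p' w])
  have len: "path_length r = L + M" unfolding r_def L_def M_def length_extend by (simp add: path_length_def)
  have vl: "n \<le> L \<Longrightarrow> vert r n = vert p n" for n
    unfolding r_def L_def by (rule vert_extend_left)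
  have vr: "vert r (L + n) = vert q n" for n
    using vert_extend_right[OF p' w, of "vert q 0" n] vert_self[OF q] joint
    unfolding r_def L_def path_end_def by simp
  have dp: "d (vert p i) (vert p j) = j - i" if "i \<le> j" "j \<le> L" for i j
    using geo_d[OF p] that by (simp add: L_def)
  have dq: "d (vert q i) (vert q j) = j - i" if "i \<le> j" "j \<le> M" for i j
    using geo_d[OF q] that by (simp add: M_def)
  have cp: "vert p n \<in> carrier G" and cq: "vert q n \<in> carrier G" for n
    using vert_carrier p' q' by auto
  have far: "n \<le> d (vert p i) (vert q n)" if "i \<le> L" "n \<le> M" for i n
    using geo_end_le[OF q shortest[OF _ qA] HOL.refl cp] that by (simp add: L_def M_def)
  show "vert r 0 = vert p 0" by (simp add: vl)
  show "vert r (path_length r) = vert q (path_length q)" using vr[of M] by (simp add: len M_def)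
  show "quasi_geodesic G X Hs 3 2 r"
    unfolding quasi_geodesic_def
  proof (intro conjI allI impI r)
    fix i j assume ij: "i \<le> j \<and> j \<le> path_length r"
    consider "j \<le> L" | "L \<le> i" | "i < L" "L < j" by linarith
    then have "j - i \<le> 3 * d (vert r i) (vert r j) + 2"
    proof cases
      case 1
      then show ?thesis using ij dp[of i j] by (simp add: vl)
    next
      case 2
      have "j - L \<le> M" "i - L \<le> j - L" using ij len by auto
      then have "j - i = d (vert q (i - L)) (vert q (j - L))" using dq[of "i - L" "j - L"] 2 by simp
      then show ?thesis using vr[of "i - L"] vr[of "j - L"] 2 ij by simp
    next
      case 3
      define n where "n = j - L"
      have n: "j = L + n" "n \<le> M" using 3 ij len unfolding n_def by auto
      have "L - i = d (vert p i) (vert p L)" using dp[of i L] 3 by simp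
      also have "\<dots> \<le> d (vert p i) (vert q n) + d (vert q n) (vert q 0)"
        using d_triangle[OF cp cq cp] joint by (simp add: L_def)
      also have "d (vert q n) (vert q 0) = n" using dq[of 0 n] n d_sym[OF cq cq] by simp
      finally have "L - i \<le> d (vert p i) (vert q n) + n" .
      then show ?thesis using far[of i n] 3 n by (simp add: vl vr)
    qed
    then show "real (j - i) \<le> 3 * real (d (vert r i) (vert r j)) + 2" by linarith
  qed
  show "without_backtracking G Hs r"
  proof (rule without_backtrackingI[OF r])
    fix k' B i j h h'
    assume b: "k' < length Hs" "B \<in> cosets k'" "i < j" "j < path_length r"
      "snd r ! i = Per k' h" "snd r ! j = Per k' h'" "vert r i \<in> B" "vert r (Suc j) \<in> B"
    consider "j < L" | "L \<le> i" | "i < L" "L \<le> j" by linarith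
    then show "j = Suc i"
    proof cases
      case 1
      then show ?thesis using geo_no_return[OF p b(1-3)] b by (simp add: vl L_def)
    next
      case 2
      have "i - L < j - L" "j - L < path_length q" using 2 b(3,4) len by (auto simp: M_def)
      then show ?thesis
        using geo_no_return[OF q b(1,2), of "i - L" "j - L"] b(7,8) 2 b(3) vr[of "i - L"]
          vr[of "Suc j - L"] by (simp add: Suc_diff_le)
    next
      case 3
      define n where "n = j - L"
      have n: "j = L + n" "n < M" using 3 b len unfolding n_def by auto
      have i1: "vert r (Suc i) \<in> B" using per_step[OF r _ b(5) b(2)] b by simp
      have jB: "vert r j \<in> B" using per_step[OF r b(4,6,2)] b by simp
      have "Suc n \<le> d (vert p (Suc i)) (vert q (Suc n))" using far[of "Suc i" "Suc n"] 3 n by simp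
      also have "\<dots> \<le> 1"
        using coset_d[OF b(1,2) i1 b(8)] vr[of "Suc n"] 3 n by (simp add: vl)
      finally have "j = L" using n by simp
      then show ?thesis using geo_coset[OF p b(1,2), of i L] b jB 3 by (simp add: vl L_def)
    qed
  qed
  show "hits A r"
    unfolding hits_def
  proof (intro conjI allI impI)
    show "vert r (path_length r) \<in> A" using vr[of M] qA by (simp add: len M_def)
    fix n assume n: "n < path_length r"
    show "vert r n \<notin> A"
    proof (cases "n \<le> L")
      case True then show ?thesis using miss by (simp add: vl L_def)
    next
      case False
      then obtain m where m: "n = L + m" "m < M" using n len by (metis add_less_cancel_left le_add_diff_inverse nat_le_linear)
      show ?thesis
      proof
        assume "vert r n \<in> A"
        then have "M \<le> d (vert p L) (vert q m)" using shortest[of L "vert q m"] m(1) vr[of m] by (simp add: L_def M_def)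
        moreover have "d (vert p L) (vert q m) = m" using dq[of 0 m] m joint by (simp add: L_def)
        ultimately show False using m by simp
      qed
    qed
  qed
qed

lemma ex_shortest_to_coset:
  assumes "p \<in> paths G X Hs" "k < length Hs" "A \<in> cosets k"
  shows "\<exists>q m. m \<le> path_length p \<and> geo q \<and> vert q 0 = vert p m \<and> vert q (path_length q) \<in> A \<and>
    (\<forall>n \<le> path_length p. \<forall>c \<in> A. path_length q \<le> d (vert p n) c)"
proof -
  define P where "P e \<longleftrightarrow> (\<exists>n \<le> path_length p. \<exists>c \<in> A. d (vert p n) c = e)" for e
  have "\<exists>e. P e" using coset_nonempty[OF assms(2,3)] unfolding P_def by blast
  then have "P (LEAST e. P e)" by (rule LeastI_ex)
  then obtain m c where m: "m \<le> path_length p" "c \<in> A" "d (vert p m) c = (LEAST e. P e)"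
    unfolding P_def by auto
  obtain q where q: "geo q" "vert q 0 = vert p m" "vert q (path_length q) = c"
    using ex_geodesic[OF vert_carrier[OF assms(1)], of c m] coset_carrier[OF assms(2,3)] m by blast
  have "path_length q = (LEAST e. P e)" using geo_d[OF q(1), of 0 "path_length q"] q m by simp
  moreover have "(LEAST e. P e) \<le> d (vert p n) c'" if "n \<le> path_length p" "c' \<in> A" for n c'
    using that unfolding P_def by (intro Least_le) blast
  ultimately show ?thesis using q m by metis
qed

end

context bcp_cayley
begin

text \<open>Two distinct points \<open>x\<close>, \<open>y\<close> of the coset \<open>D\<close> are joined by a single edge, and this edge
  followed by a geodesic from \<open>y\<close> to \<open>A\<close> can be compared with a geodesic from \<open>x\<close> to \<open>A\<close>.
  A geodesic from \<open>y\<close> that begins with an edge in \<open>D\<close> does not cause backtracking, because this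
  edge and the added one form one component.\<close>

lemma proj_coset_close:
  "\<exists>\<epsilon>. \<forall>k D A x y a b. k < length Hs \<and> D \<in> cosets k \<and> A \<in> cosets k \<and> D \<noteq> A \<and>
      x \<in> D \<and> y \<in> D \<and> a \<in> proj A x \<and> b \<in> proj A y \<longrightarrow> dX a b \<le> \<epsilon>"
proof -
  obtain \<epsilon> where \<epsilon>: "\<And>p q k A. k < length Hs \<Longrightarrow> A \<in> cosets k \<Longrightarrow> quasi_geodesic G X Hs 3 2 p \<Longrightarrow>
      without_backtracking G Hs p \<Longrightarrow> hits A p \<Longrightarrow> geo q \<Longrightarrow> hits A q \<Longrightarrow>
      dX (vert p 0) (vert q 0) \<le> 0 \<Longrightarrow> dX (vert p (path_length p)) (vert q (path_length q)) \<le> \<epsilon>"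
    using entry_points_close[of 0] by blast
  show ?thesis
  proof (rule exI[of _ \<epsilon>], intro allI impI)
    fix k D A x y a b
    assume asm: "k < length Hs \<and> D \<in> cosets k \<and> A \<in> cosets k \<and> D \<noteq> A \<and>
      x \<in> D \<and> y \<in> D \<and> a \<in> proj A x \<and> b \<in> proj A y"
    then have k: "k < length Hs" and D: "D \<in> cosets k" and A: "A \<in> cosets k" and xy: "x \<in> D" "y \<in> D"
      by auto
    have xA: "x \<notin> A" using coset_eq[OF k D A] asm by blast
    obtain p where p: "geo p" "vert p 0 = y" "hits A p" "vert p (path_length p) = b"
      using asm unfolding proj_def by blast
    obtain q where q: "geo q" "vert q 0 = x" "hits A q" "vert q (path_length q) = a"
      using asm unfolding proj_def by blast
    have car: "x \<in> carrier G" "y \<in> carrier G" "a \<in> carrier G" "b \<in> carrier G"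
      using vert_carrier[OF geo_paths[OF p(1)]] vert_carrier[OF geo_paths[OF q(1)]] p q by auto
    show "dX a b \<le> \<epsilon>"
    proof (cases "x = y")
      case True
      then show ?thesis
        using \<epsilon>[OF k A geo_qg[OF q(1)] geo_without_backtracking[OF q(1)] q(3) p(1,3)] p q car by simp
    next
      case False
      define e where "e = (x, [Per k (inv x \<otimes> y)])"
      define L where "L = path_length p"
      define r where "r = extend e (snd p)"
      have p': "p \<in> paths G X Hs" and w: "snd p \<in> lists alph" using geo_paths[OF p(1)] by (auto simp: paths_iff)
      have e: "e \<in> paths G X Hs" using coset_letter[OF k D xy False] car by (simp add: e_def paths_iff)
      have le: "path_length e = 1" by (simp add: e_def path_length_def)
      have ee: "path_end G e = y" using car by (simp add: e_def path_end_def path_length_def vertex_def)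
      have r: "r \<in> paths G X Hs" unfolding r_def by (rule extend_paths[OF e w])
      have len: "path_length r = Suc L" unfolding r_def length_extend le L_def by (simp add: path_length_def)
      have v0: "vert r 0 = x" using vert_extend_left[of 0 e "snd p"] vert_0[OF e] by (simp add: r_def e_def)
      have vS: "vert r (Suc n) = vert p n" for n
        using vert_extend_right[OF e w, of y n] vert_self[OF p(1)] p(2) ee le unfolding r_def by simp
      have "quasi_geodesic G X Hs 3 2 r"
        unfolding quasi_geodesic_def
      proof (intro conjI allI impI r)
        fix i j assume ij: "i \<le> j \<and> j \<le> path_length r"
        have "j - i \<le> 3 * d (vert r i) (vert r j) + 2"
        proof (cases i)
          case (Suc i')
          then show ?thesis using ij len geo_d[OF p(1), of i' "j - 1"] vS[of "j - 1"] 
            by (cases j) (auto simp: vS L_def)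
        next
          case 0
          show ?thesis
          proof (cases j)
            case (Suc j')
            have "j' = d y (vert p j')" using geo_d[OF p(1), of 0 j'] ij len Suc p(2) by (simp add: L_def)
            also have "\<dots> \<le> d y x + d x (vert p j')" using car vert_carrier[OF p'] by (intro d_triangle)
            also have "d y x \<le> 1" using coset_d[OF k D] xy by simp
            finally show ?thesis using 0 Suc by (simp add: v0 vS)
          qed simp
        qed
        then show "real (j - i) \<le> 3 * real (d (vert r i) (vert r j)) + 2" by linarith
      qed
      moreover have "without_backtracking G Hs r"
      proof (rule without_backtrackingI[OF r])
        fix k' B i j h h'
        assume b: "k' < length Hs" "B \<in> cosets k'" "i < j" "j < path_length r"
          "snd r ! i = Per k' h" "snd r ! j = Per k' h'" "vert r i \<in> B" "vert r (Suc j) \<in> B"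
        obtain j' where j': "j = Suc j'" using b(3) by (cases j) auto
        show "j = Suc i"
        proof (cases i)
          case (Suc i')
          then show ?thesis using geo_no_return[OF p(1) b(1,2), of i' j'] b len j' by (simp add: vS L_def)
        next
          case 0
          have "vert r (Suc 0) \<in> B" using per_step[OF r _ b(5,2)] b 0 by simp
          then show ?thesis
            using geo_coset[OF p(1) b(1,2), of 0 "Suc j'"] b 0 j' len by (simp add: vS L_def)
        qed
      qed
      moreover have "hits A r"
      proof -
        have "vert r n \<notin> A" if "n < Suc L" for n
          using that p(3) xA by (cases n) (auto simp: vS v0 hits_def L_def)
        then show ?thesis using p(3) by (simp add: hits_def len vS L_def)
      qed
      ultimately have "dX b a \<le> \<epsilon>"
        using \<epsilon>[OF k A _ _ _ q(1,3), of r] p(4) q car by (simp add: v0 len vS L_def)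
      then show ?thesis using dX_sym car by simp
    qed
  qed
qed

text \<open>If a geodesic from \<open>x\<close> to \<open>y\<close> misses \<open>A\<close>, let \<open>c\<close> be the end of a shortest
  connection from it to \<open>A\<close>.  The detours to \<open>c\<close> from both ends of the geodesic show that
  \<open>c\<close> is close to every entrance point from \<open>x\<close> and to every entrance point from \<open>y\<close>, so
  these are close to each other.\<close>

lemma far_projections_cross:
  "\<exists>C. \<forall>k A x y a b p. k < length Hs \<and> A \<in> cosets k \<and> a \<in> proj A x \<and> b \<in> proj A y \<and> C < dX a b \<and>
      geo p \<and> vert p 0 = x \<and> vert p (path_length p) = y \<longrightarrow> (\<exists>n \<le> path_length p. vert p n \<in> A)"
proof -
  obtain \<epsilon> where \<epsilon>: "\<And>p q k A. k < length Hs \<Longrightarrow> A \<in> cosets k \<Longrightarrow> quasi_geodesic G X Hs 3 2 p \<Longrightarrow>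
      without_backtracking G Hs p \<Longrightarrow> hits A p \<Longrightarrow> geo q \<Longrightarrow> hits A q \<Longrightarrow>
      dX (vert p 0) (vert q 0) \<le> 0 \<Longrightarrow> dX (vert p (path_length p)) (vert q (path_length q)) \<le> \<epsilon>"
    using entry_points_close[of 0] by blast
  have near: "dX a b \<le> 2 * \<epsilon>"
    if k: "k < length Hs" and A: "A \<in> cosets k" and a: "a \<in> proj A x" and b: "b \<in> proj A y"
      and p: "geo p" "vert p 0 = x" "vert p (path_length p) = y"
      and miss: "\<And>n. n \<le> path_length p \<Longrightarrow> vert p n \<notin> A" for k A a b p x y
  proof -
    have p': "p \<in> paths G X Hs" using geo_paths[OF p(1)] .
    obtain q m where m: "m \<le> path_length p" and q: "geo q" "vert q 0 = vert p m" "vert q (path_length q) \<in> A"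
      and shortest: "\<And>n c. n \<le> path_length p \<Longrightarrow> c \<in> A \<Longrightarrow> path_length q \<le> d (vert p n) c"
      using ex_shortest_to_coset[OF p' k A] by blast
    define c where "c = vert q (path_length q)"
    have close: "dX c e \<le> \<epsilon>"
      if s: "geo s" "vert s (path_length s) = vert p m" "vert s 0 = z" and e: "e \<in> proj A z"
        and sub: "\<And>n. n \<le> path_length s \<Longrightarrow> \<exists>i \<le> path_length p. vert s n = vert p i" for s z e
    proof -
      obtain t where t: "geo t" "vert t 0 = z" "hits A t" "vert t (path_length t) = e"
        using e unfolding proj_def by blast
      have "vert s n \<notin> A" if "n \<le> path_length s" for n using sub[OF that] miss by force
      moreover have "path_length q \<le> d (vert s n) c" if "n \<le> path_length s" "c \<in> A" for n c
        using sub[OF that(1)] shortest that(2) by force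
      ultimately show ?thesis
        using detour[OF s(1) q(1) _ k A q(3)] \<epsilon>[OF k A _ _ _ t(1,3), of "extend s (snd q)"] s t q(2)
          proj_carrier[OF e]
        by (simp add: c_def)
    qed
    have "dX c a \<le> \<epsilon>"
      by (rule close[of "subpath G p 0 m"])
        (use m p a in \<open>auto simp: geo_subpath vert_subpath p' length_subpath intro: le_trans\<close>)
    moreover have "dX c b \<le> \<epsilon>"
    proof (rule close[of "rev_path G (subpath G p m (path_length p))"])
      show "\<exists>i \<le> path_length p. vert (rev_path G (subpath G p m (path_length p))) n = vert p i"
        if "n \<le> path_length (rev_path G (subpath G p m (path_length p)))" for n
        using that m
        by (intro exI[of _ "path_length p - n"])
          (auto simp: vert_rev_path subpath_paths p' length_subpath vert_subpath)
    qed (use m p b in \<open>auto simp: geo_rev geo_subpath vert_rev_path subpath_paths vert_subpath p' length_subpath\<close>)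
    moreover have "dX a b \<le> dX a c + dX c b" "dX a c = dX c a"
      using proj_carrier(1)[OF a] proj_carrier(1)[OF b] vert_carrier[OF geo_paths[OF q(1)]]
      by (auto simp: c_def intro!: dX_triangle dX_sym)
    ultimately show ?thesis by linarith
  qed
  show ?thesis
  proof (rule exI[of _ "2 * \<epsilon>"], intro allI impI, rule ccontr)
    fix k A x y a b p
    assume a: "k < length Hs \<and> A \<in> cosets k \<and> a \<in> proj A x \<and> b \<in> proj A y \<and> 2 * \<epsilon> < dX a b \<and>
      geo p \<and> vert p 0 = x \<and> vert p (path_length p) = y" and "\<not> (\<exists>n \<le> path_length p. vert p n \<in> A)"
    then have "dX a b \<le> 2 * \<epsilon>" using near[of k A a x b y p] by blast
    then show False using a by simp
  qed
qed

end

section \<open>Chains of cosets\<close>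

text \<open>Each inner coset of the sequence sees its two neighbours in different directions: their
  projections to it are far apart.  By \<open>cross\<close>, the constant \<open>C\<close> is one as in
  \<open>far_projections_cross\<close>.\<close>

locale coset_chain = bcp_cayley +
  fixes k C n and B :: "nat \<Rightarrow> 'a set"
  assumes k: "k < length Hs" and B: "\<And>j. j \<le> n \<Longrightarrow> B j \<in> cosets k"
    and cross: "\<And>A x y a b p. A \<in> cosets k \<Longrightarrow> a \<in> proj A x \<Longrightarrow> b \<in> proj A y \<Longrightarrow> C < dX a b \<Longrightarrow>
      geo p \<Longrightarrow> vert p 0 = x \<Longrightarrow> vert p (path_length p) = y \<Longrightarrow> \<exists>n \<le> path_length p. vert p n \<in> A"
    and far: "\<And>j u v a b. Suc j < n \<Longrightarrow> u \<in> B j \<Longrightarrow> v \<in> B (Suc (Suc j)) \<Longrightarrow>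
      a \<in> proj (B (Suc j)) u \<Longrightarrow> b \<in> proj (B (Suc j)) v \<Longrightarrow> C < dX a b"
begin

text \<open>By induction, a projection of \<open>x\<close> to \<open>B (Suc j)\<close> is also one of a point of \<open>B j\<close>, hence far from
  every projection of a point of \<open>B (Suc (Suc j))\<close>.  So a geodesic from \<open>x\<close> to
  \<open>B (Suc (Suc j))\<close> meets \<open>B (Suc j)\<close>, and its remaining part starts there.  No constant grows in
  this induction, because the conclusion is about projections of points in the neighbouring coset and
  not about points near them.\<close>

lemma proj_chain:
  assumes x: "x \<in> B 0" "x \<in> carrier G"
  shows "j < n \<Longrightarrow> a \<in> proj (B (Suc j)) x \<Longrightarrow> \<exists>u \<in> B j. a \<in> proj (B (Suc j)) u"
proof (induction j arbitrary: a)
  case 0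
  then show ?case using x by blast
next
  case (Suc j)
  obtain p where p: "geo p" "vert p 0 = x" "hits (B (Suc (Suc j))) p" "vert p (path_length p) = a"
    using Suc.prems unfolding proj_def by blast
  have aB: "a \<in> B (Suc (Suc j))" "a \<in> carrier G"
    using proj_subset proj_carrier Suc.prems by blast+
  have Bj: "B (Suc j) \<in> cosets k" using B Suc.prems by simp
  obtain a0 where a0: "a0 \<in> proj (B (Suc j)) x" using proj_nonempty[OF k Bj x(2)] by blast
  obtain u where u: "u \<in> B j" "a0 \<in> proj (B (Suc j)) u" using Suc.IH[OF _ a0] Suc.prems by auto
  obtain b0 where b0: "b0 \<in> proj (B (Suc j)) a" using proj_nonempty[OF k Bj aB(2)] by blast
  have "C < dX a0 b0" using far[OF _ u(1) aB(1) u(2) b0] Suc.prems by simp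
  then obtain i where i: "i \<le> path_length p" "vert p i \<in> B (Suc j)"
    using cross[OF Bj a0 b0 _ p(1,2,4)] by blast
  obtain m where m: "i \<le> m" "m \<le> path_length p" "vert p m \<in> proj (B (Suc (Suc j))) (vert p i)"
    using first_hit_from[OF p(1) i(1), of "B (Suc (Suc j))"] aB p(4) by auto
  have "m = path_length p" using p(3) proj_subset[OF m(3)] m(2) unfolding hits_def
    by (meson le_neq_implies_less)
  then show ?case using m(3) i(2) p(4) by auto
qed

end

context bcp_cayley
begin

text \<open>By \<open>proj_chain\<close> for the chain and for the reversed chain, the geodesic enters an inner coset
  at a projection of the previous coset and leaves it at one of the next coset.  These are far apart,
  hence different, and different vertices of a geodesic in one coset are neighbours on it.\<close>

lemma chain_crossing:
  assumes chain: "coset_chain G X Hs k C n B"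
    and x: "x \<in> B 0" and y: "y \<in> B n" and j: "Suc j < n"
    and p: "geo p" "vert p 0 = x" "vert p (path_length p) = y"
  shows "\<exists>m u v. m < path_length p \<and> u \<in> B j \<and> v \<in> B (Suc (Suc j)) \<and>
    vert p m \<in> proj (B (Suc j)) u \<and> vert p (Suc m) \<in> proj (B (Suc j)) v"
proof -
  interpret coset_chain G X Hs k C n B by (rule chain)
  interpret rev: coset_chain G X Hs k C n "\<lambda>i. B (n - i)"
  proof unfold_locales
    fix i u v a b
    assume i: "Suc i < n" "u \<in> B (n - i)" "v \<in> B (n - Suc (Suc i))"
      "a \<in> proj (B (n - Suc i)) u" "b \<in> proj (B (n - Suc i)) v"
    have "Suc (n - Suc (Suc i)) = n - Suc i" "Suc (n - Suc i) = n - i" using i(1) by auto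
    then have "C < dX b a" using far[of "n - Suc (Suc i)" v u b a] i by simp
    then show "C < dX a b" using dX_sym proj_carrier(1) i by metis
  qed (use k B cross in auto)
  have xy: "x \<in> carrier G" "y \<in> carrier G" using p vert_carrier[OF geo_paths[OF p(1)]] by auto
  have Bj: "B (Suc j) \<in> cosets k" using B j by simp
  have left: "\<exists>u \<in> B j. a \<in> proj (B (Suc j)) u" if "a \<in> proj (B (Suc j)) x" for a
    using proj_chain[OF x xy(1) _ that] j by simp
  have right: "\<exists>v \<in> B (Suc (Suc j)). b \<in> proj (B (Suc j)) v" if "b \<in> proj (B (Suc j)) y" for b
  proof -
    have "n - Suc (n - Suc (Suc j)) = Suc j" "n - (n - Suc (Suc j)) = Suc (Suc j)" using j by auto
    then show ?thesis using rev.proj_chain[of y "n - Suc (Suc j)" b] y xy(2) that j by simp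
  qed
  have separated: "C < dX a b" if "a \<in> proj (B (Suc j)) x" "b \<in> proj (B (Suc j)) y" for a b
    using left[OF that(1)] right[OF that(2)] far[OF j] by blast
  obtain a where a: "a \<in> proj (B (Suc j)) x" using proj_nonempty[OF k Bj xy(1)] by blast
  obtain b where b: "b \<in> proj (B (Suc j)) y" using proj_nonempty[OF k Bj xy(2)] by blast
  obtain i where i: "i \<le> path_length p" "vert p i \<in> B (Suc j)"
    using cross[OF Bj a b separated[OF a b] p] by blast
  obtain m where m: "m \<le> i" "vert p m \<in> proj (B (Suc j)) x" using first_hit[OF p(1) i] p(2) by auto
  obtain m' where m': "i \<le> m'" "m' \<le> path_length p" "vert p m' \<in> proj (B (Suc j)) y"
    using last_hit[OF p(1) i] p(3) by auto
  have "m \<noteq> m'"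
    using separated[OF m(2) m'(3)] dX_self[OF proj_carrier(1)[OF m(2)]] by auto
  then have "m' = Suc m"
    using geo_coset[OF p(1) k Bj _ m'(2) proj_subset[OF m(2)] proj_subset[OF m'(3)]] m(1) m'(1)
    by linarith
  then show ?thesis using m m' left[OF m(2)] right[of "vert p m'"] by (metis Suc_le_lessD)
qed

end

section \<open>Quasiconvex subgroups and a parabolic coset\<close>

context relative_cayley
begin

text \<open>Relative quasiconvexity with a base point: the geodesics join points of the orbit \<open>S b\<close>, but
  are required to stay close to \<open>S\<close>.  Working at \<open>b\<close> replaces conjugating the parabolic subgroup
  into a peripheral one.\<close>

definition quasiconvex_orbit :: "'a set \<Rightarrow> 'a \<Rightarrow> bool" where
  "quasiconvex_orbit S b \<longleftrightarrow> (\<exists>\<sigma>::nat. \<forall>p. geo p \<and> (\<exists>s \<in> S. vert p 0 = s \<otimes> b) \<and>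
     (\<exists>s \<in> S. vert p (path_length p) = s \<otimes> b) \<longrightarrow>
     (\<forall>n \<le> path_length p. \<exists>w \<in> S. dX (vert p n) w \<le> \<sigma>))"

lemma relatively_quasiconvex_iff:
  "relatively_quasiconvex G X Hs S \<longleftrightarrow> subgroup S G \<and> quasiconvex_orbit S \<one>"
proof (cases "subgroup S G")
  case True
  then have S: "x \<in> S \<Longrightarrow> x \<otimes> \<one> = x" for x by (simp add: subgroup.mem_carrier)
  have ends: "(\<exists>s \<in> S. v = s \<otimes> \<one>) \<longleftrightarrow> v \<in> S" for v using S by auto
  show ?thesis
  proof
    assume "relatively_quasiconvex G X Hs S"
    then obtain \<sigma> :: real where \<sigma>: "\<And>p n. geo p \<Longrightarrow> path_start G p \<in> S \<Longrightarrow> path_end G p \<in> S \<Longrightarrow>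
        n \<le> path_length p \<Longrightarrow> \<exists>w \<in> S. real (dX (vert p n) w) \<le> \<sigma>"
      unfolding relatively_quasiconvex_def by blast
    have "dX v w \<le> nat \<lfloor>\<sigma>\<rfloor>" if "real (dX v w) \<le> \<sigma>" for v w using that by linarith
    then show "subgroup S G \<and> quasiconvex_orbit S \<one>"
      using \<sigma> True unfolding quasiconvex_orbit_def ends path_start_def path_end_def by meson
  next
    assume "subgroup S G \<and> quasiconvex_orbit S \<one>"
    then obtain \<sigma> where \<sigma>: "\<And>p n. geo p \<Longrightarrow> vert p 0 \<in> S \<Longrightarrow> vert p (path_length p) \<in> S \<Longrightarrow>
        n \<le> path_length p \<Longrightarrow> \<exists>w \<in> S. dX (vert p n) w \<le> \<sigma>"
      unfolding quasiconvex_orbit_def ends by meson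
    then show "relatively_quasiconvex G X Hs S"
      unfolding relatively_quasiconvex_def path_start_def path_end_def
      using True by (intro conjI exI[of _ "real \<sigma>"]) auto
  qed
qed (simp add: relatively_quasiconvex_def)

end

lemma finite_image_bound: "finite S \<Longrightarrow> \<exists>T::nat. \<forall>x \<in> S. f x \<le> T"
  using finite_imageI[of S f] unfolding finite_nat_set_iff_bounded_le by blast

context bcp_cayley
begin

text \<open>Right multiplication by a fixed element moves every point by a bounded distance with respect
  to \<open>X\<close>, and geodesics with close endpoints are close.\<close>

lemma quasiconvex_orbit_basepoint:
  assumes S: "S \<subseteq> carrier G" and qc: "quasiconvex_orbit S b"
    and b: "b \<in> carrier G" and b': "b' \<in> carrier G"
  shows "quasiconvex_orbit S b'"
proof -
  obtain \<sigma> where \<sigma>: "\<And>p n. geo p \<Longrightarrow> \<exists>s \<in> S. vert p 0 = s \<otimes> b \<Longrightarrow>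
      \<exists>s \<in> S. vert p (path_length p) = s \<otimes> b \<Longrightarrow> n \<le> path_length p \<Longrightarrow>
      \<exists>w \<in> S. dX (vert p n) w \<le> \<sigma>"
    using qc unfolding quasiconvex_orbit_def by meson
  obtain \<epsilon> where \<epsilon>: "\<And>p q n. geo p \<Longrightarrow> geo q \<Longrightarrow> dX (vert p 0) (vert q 0) \<le> dX b' b \<Longrightarrow>
      dX (vert p (path_length p)) (vert q (path_length q)) \<le> dX b' b \<Longrightarrow> n \<le> path_length p \<Longrightarrow>
      \<exists>m \<le> path_length q. dX (vert p n) (vert q m) \<le> \<epsilon>"
    using fellow_travel[of "dX b' b"] by meson
  have "\<exists>w \<in> S. dX (vert p n) w \<le> \<epsilon> + \<sigma>"
    if p: "geo p" "s \<in> S" "vert p 0 = s \<otimes> b'" "s' \<in> S" "vert p (path_length p) = s' \<otimes> b'"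
      and n: "n \<le> path_length p" for p s s' n
  proof -
    have ss: "s \<in> carrier G" "s' \<in> carrier G" using p S by auto
    obtain q where q: "geo q" "vert q 0 = s \<otimes> b" "vert q (path_length q) = s' \<otimes> b"
      using ex_geodesic[of "s \<otimes> b" "s' \<otimes> b"] ss b by auto
    obtain m where m: "m \<le> path_length q" "dX (vert p n) (vert q m) \<le> \<epsilon>"
      using \<epsilon>[OF p(1) q(1) _ _ n] p q ss b b' by (auto simp: dX_translate)
    obtain w where w: "w \<in> S" "dX (vert q m) w \<le> \<sigma>" using \<sigma>[OF q(1) _ _ m(1)] q p by blast
    have "dX (vert p n) w \<le> dX (vert p n) (vert q m) + dX (vert q m) w"
      using p q w S vert_carrier geo_paths by (intro dX_triangle) auto
    then show ?thesis using m w by (intro bexI[of _ w]) auto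
  qed
  then show ?thesis unfolding quasiconvex_orbit_def by (intro exI[of _ "\<epsilon> + \<sigma>"]) blast
qed

end

text \<open>\<open>P\<close> is the stabiliser of the coset \<open>b H\<close> of a peripheral subgroup \<open>H\<close>, that is
  \<open>P = b H b\<^bsup>-1\<^esup>\<close>, and \<open>P\<close> acts simply transitively on that coset.\<close>

locale parabolic_coset = bcp_cayley +
  fixes k b P Q
  assumes k: "k < length Hs" and b: "b \<in> carrier G"
    and P_def: "P = {g \<in> carrier G. g \<otimes> b \<in> b <# (Hs ! k)}"
    and P_subgroup: "subgroup P G" and Q_subgroup: "subgroup Q G"
    and Q_quasiconvex: "quasiconvex_orbit Q b"
begin

definition A :: "'a set" where "A = b <# (Hs ! k)"

lemma A_coset: "A \<in> cosets k" and b_in_A: "b \<in> A"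
  unfolding A_def using l_coset_cosets l_coset_self k b by auto

lemma A_carrier: "a \<in> A \<Longrightarrow> a \<in> carrier G"
  using coset_carrier[OF k A_coset] by blast

lemma P_iff: "g \<in> P \<longleftrightarrow> g \<in> carrier G \<and> g \<otimes> b \<in> A"
  unfolding P_def A_def by blast

lemma Q_carrier: "q \<in> Q \<Longrightarrow> q \<in> carrier G"
  using Q_subgroup subgroup.mem_carrier by fast

lemma P_carrier: "g \<in> P \<Longrightarrow> g \<in> carrier G"
  using P_iff by blast

lemma A_orbit: "a \<in> A \<Longrightarrow> \<exists>g \<in> P. a = g \<otimes> b"
  using A_carrier b by (intro bexI[of _ "a \<otimes> inv b"]) (auto simp: P_iff m_assoc)

lemma P_stabilizes_A:
  assumes "g \<in> P" shows "g <# A = A"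
  using coset_eq[OF k coset_translate[OF k A_coset] A_coset, of g "g \<otimes> b"] assms
    translate_mem_iff[OF k A_coset _ b, of g] b_in_A unfolding P_iff by blast

text \<open>Write \<open>a = f b\<close> with \<open>f \<in> P\<close>.  The difference \<open>u\<close> of \<open>f\<close> and \<open>w\<close> lies in a finite
  ball.  For each \<open>u\<close> in the ball that is such a difference fix one pair in \<open>P \<times> Q\<close>
  realising it; the quotient of \<open>f\<close> by the chosen element of \<open>P\<close> is also a quotient of elements of \<open>Q\<close>, so it is in the
  intersection.\<close>

lemma near_Q_near_intersection:
  "\<exists>M'. \<forall>a \<in> A. \<forall>w \<in> Q. dX a w \<le> M \<longrightarrow> (\<exists>c \<in> Q \<inter> P. dX a (c \<otimes> b) \<le> M')"
proof -
  define U where "U = {u \<in> carrier G. wlen u \<le> wlen b + M}"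
  define g where "g u = (SOME g. g \<in> P \<and> g \<otimes> u \<in> Q)" for u
  obtain M' where M': "\<And>u. u \<in> U \<Longrightarrow> dX (g u \<otimes> b) b \<le> M'"
    using finite_image_bound[OF finite_ball, of "wlen b + M" "\<lambda>u. dX (g u \<otimes> b) b"]
    unfolding U_def by blast
  interpret P: subgroup P G by (rule P_subgroup)
  interpret Q: subgroup Q G by (rule Q_subgroup)
  have "\<exists>c \<in> Q \<inter> P. dX a (c \<otimes> b) \<le> M'" if a: "a \<in> A" and w: "w \<in> Q" and near: "dX a w \<le> M" for a w
  proof -
    obtain f where f: "f \<in> P" "a = f \<otimes> b" using A_orbit[OF a] by blast
    have car: "f \<in> carrier G" "w \<in> carrier G" using f w by auto
    define u where "u = inv f \<otimes> w"
    have "wlen u = dX f w" by (simp add: u_def word_dist_def)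
    also have "\<dots> \<le> dX f (f \<otimes> b) + dX (f \<otimes> b) w" using car b by (intro dX_triangle) auto
    finally have u: "u \<in> U" using near car b f by (simp add: U_def u_def dX_mult_right)
    have "f \<in> P \<and> f \<otimes> u \<in> Q" using f w car by (simp add: u_def)
    then have gu: "g u \<in> P \<and> g u \<otimes> u \<in> Q" unfolding g_def by (rule someI)
    define c where "c = f \<otimes> inv (g u)"
    have gc: "g u \<in> carrier G" "u \<in> carrier G" using gu car by (auto simp: u_def)
    have "c = w \<otimes> inv (g u \<otimes> u)"
      using gc car by (simp add: c_def u_def inv_mult_group m_assoc)
    then have "c \<in> Q" using gu w by simp
    moreover have "c \<in> P" using gu f by (simp add: c_def)
    ultimately have "c \<in> Q \<inter> P" by simp
    moreover have "a = c \<otimes> (g u \<otimes> b)" using gc car b f by (simp add: c_def m_assoc)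
    then have "dX a (c \<otimes> b) = dX (g u \<otimes> b) b" using gc car b by (simp add: c_def dX_translate)
    ultimately show ?thesis using M'[OF u] by (intro bexI[of _ c]) auto
  qed
  then show ?thesis by blast
qed

text \<open>A geodesic from \<open>q b\<close> to \<open>b\<close> stays close to \<open>Q\<close>, so it enters \<open>A\<close> close to
  \<open>Q\<close> and hence close to \<open>(Q \<inter> P) b\<close>.  All other points of \<open>q A\<close> project to nearby
  points because \<open>q A \<noteq> A\<close>.  The bound is uniform in \<open>q\<close>.\<close>

lemma proj_from_Q_translate:
  "\<exists>M. \<forall>q \<in> Q - P. \<forall>v \<in> A. \<forall>a \<in> proj A (q \<otimes> v). \<exists>c \<in> Q \<inter> P. dX a (c \<otimes> b) \<le> M"
proof -
  obtain \<sigma> where \<sigma>: "\<And>p n. geo p \<Longrightarrow> \<exists>s \<in> Q. vert p 0 = s \<otimes> b \<Longrightarrow>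
      \<exists>s \<in> Q. vert p (path_length p) = s \<otimes> b \<Longrightarrow> n \<le> path_length p \<Longrightarrow>
      \<exists>w \<in> Q. dX (vert p n) w \<le> \<sigma>"
    using Q_quasiconvex unfolding quasiconvex_orbit_def by meson
  obtain M' where M': "\<And>a w. a \<in> A \<Longrightarrow> w \<in> Q \<Longrightarrow> dX a w \<le> \<sigma> \<Longrightarrow> \<exists>c \<in> Q \<inter> P. dX a (c \<otimes> b) \<le> M'"
    using near_Q_near_intersection[of \<sigma>] by meson
  obtain \<epsilon> where \<epsilon>: "\<forall>k D A x y a b. k < length Hs \<and> D \<in> cosets k \<and> A \<in> cosets k \<and> D \<noteq> A \<and>
      x \<in> D \<and> y \<in> D \<and> a \<in> proj A x \<and> b \<in> proj A y \<longrightarrow> dX a b \<le> \<epsilon>"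
    using proj_coset_close by (rule exE)
  have "\<exists>c \<in> Q \<inter> P. dX a (c \<otimes> b) \<le> \<epsilon> + M'"
    if q: "q \<in> Q" "q \<notin> P" and v: "v \<in> A" and a: "a \<in> proj A (q \<otimes> v)" for q v a
  proof -
    have qc: "q \<in> carrier G" using q Q_carrier by blast
    have "q \<otimes> b \<in> q <# A" "q \<otimes> v \<in> q <# A"
      using translate_mem_iff[OF k A_coset qc] b b_in_A v A_carrier by auto
    moreover have "q \<otimes> b \<notin> A" using q qc P_iff by blast
    moreover obtain p where p: "geo p" "vert p 0 = q \<otimes> b" "vert p (path_length p) = b"
      using ex_geodesic[of "q \<otimes> b" b] qc b by auto
    moreover obtain m where m: "m \<le> path_length p" "vert p m \<in> proj A (q \<otimes> b)"
      using first_hit[OF p(1), of "path_length p" A] p b_in_A by auto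
    ultimately have close: "dX a (vert p m) \<le> \<epsilon>"
      using \<epsilon>[rule_format, of k "q <# A" A "q \<otimes> v" "q \<otimes> b" a "vert p m"] k A_coset
        coset_translate[OF k A_coset qc] a m(2) by blast
    have "\<one> \<in> Q" using Q_subgroup subgroup.one_closed by blast
    then have "\<exists>s \<in> Q. vert p (path_length p) = s \<otimes> b" using p b by (intro bexI[of _ \<one>]) auto
    then obtain w where w: "w \<in> Q" "dX (vert p m) w \<le> \<sigma>" using \<sigma>[OF p(1) _ _ m(1)] p q by blast
    obtain c where c: "c \<in> Q \<inter> P" "dX (vert p m) (c \<otimes> b) \<le> M'"
      using M'[OF proj_subset[OF m(2)] w] by blast
    have "dX a (c \<otimes> b) \<le> dX a (vert p m) + dX (vert p m) (c \<otimes> b)"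
      using proj_carrier a m c P_carrier b by (intro dX_triangle) auto
    then show ?thesis using c close by (intro bexI[of _ c]) auto
  qed
  then show ?thesis by (intro exI[of _ "\<epsilon> + M'"]) blast
qed

end

section \<open>Copies of a quasiconvex subgroup conjugated far apart\<close>

definition alternating :: "nat \<Rightarrow> 'a set \<Rightarrow> (nat \<times> 'a) list \<Rightarrow> bool" where
  "alternating k S w \<longleftrightarrow> w \<in> lists ({..<k} \<times> S) \<and> distinct_adj (map fst w)"

text \<open>The conjugates of \<open>Q\<close> by \<open>t 0\<close>, \<dots>, \<open>t (N - 1)\<close>.  The elements \<open>t i\<close> lie in the
  abelian group \<open>P\<close>, so all these conjugates contain \<open>Q \<inter> P\<close>; and the sets
  \<open>t i (Q \<inter> P) b\<close> are pairwise further apart than \<open>C + 2 M\<close>.  Here \<open>C\<close> makes distant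
  projections force a crossing, and \<open>M\<close> bounds the distance from projections to the centres
  \<open>(Q \<inter> P) b\<close>.\<close>

locale separated_copies = parabolic_coset +
  fixes C M N :: nat and t :: "nat \<Rightarrow> 'a"
  assumes cross: "\<And>A x y a b p. A \<in> cosets k \<Longrightarrow> a \<in> proj A x \<Longrightarrow> b \<in> proj A y \<Longrightarrow> C < dX a b \<Longrightarrow>
      geo p \<Longrightarrow> vert p 0 = x \<Longrightarrow> vert p (path_length p) = y \<Longrightarrow> \<exists>n \<le> path_length p. vert p n \<in> A"
    and proj_M: "\<And>q v a. q \<in> Q - P \<Longrightarrow> v \<in> A \<Longrightarrow> a \<in> proj A (q \<otimes> v) \<Longrightarrow> \<exists>c \<in> Q \<inter> P. dX a (c \<otimes> b) \<le> M"
    and P_comm: "\<And>x y. x \<in> P \<Longrightarrow> y \<in> P \<Longrightarrow> x \<otimes> y = y \<otimes> x"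
    and t_P: "\<And>i. i < N \<Longrightarrow> t i \<in> P"
    and t_far: "\<And>i j c. i < N \<Longrightarrow> j < N \<Longrightarrow> i \<noteq> j \<Longrightarrow> c \<in> Q \<inter> P \<Longrightarrow>
      C + 2 * M < wlen (inv b \<otimes> (inv (t i) \<otimes> t j \<otimes> c) \<otimes> b)"
begin

sublocale P: subgroup P G by (rule P_subgroup)
sublocale Q: subgroup Q G by (rule Q_subgroup)

definition copy_of :: "nat \<times> 'a \<Rightarrow> 'a" where
  "copy_of iq = t (fst iq) \<otimes> snd iq \<otimes> inv (t (fst iq))"

text \<open>The homomorphism from words over the copies of \<open>Q\<close> to \<open>G\<close> that sends the \<open>i\<close>-th copy
  to its conjugate by \<open>t i\<close>.\<close>

definition ev :: "(nat \<times> 'a) list \<Rightarrow> 'a" where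
  "ev w = word_prod G (map copy_of w)"

abbreviation reduced :: "(nat \<times> 'a) list \<Rightarrow> bool" where
  "reduced \<equiv> alternating N (Q - P)"

definition R :: "'a set" where "R = ev ` lists ({..<N} \<times> Q)"

lemma t_carrier: "i < N \<Longrightarrow> t i \<in> carrier G"
  using t_P P.mem_carrier by blast

lemma copy_of_carrier: "iq \<in> {..<N} \<times> Q \<Longrightarrow> copy_of iq \<in> carrier G"
  unfolding copy_of_def using t_carrier by auto

lemma ev_Nil [simp]: "ev [] = \<one>"
  by (simp add: ev_def)

lemma ev_carrier: "w \<in> lists ({..<N} \<times> Q) \<Longrightarrow> ev w \<in> carrier G"
  unfolding ev_def using copy_of_carrier by (intro word_prod_closed) auto

lemma ev_append:
  "u \<in> lists ({..<N} \<times> Q) \<Longrightarrow> v \<in> lists ({..<N} \<times> Q) \<Longrightarrow> ev (u @ v) = ev u \<otimes> ev v"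
  unfolding ev_def map_append using copy_of_carrier by (intro word_prod_append) auto

lemma ev_single: "i < N \<Longrightarrow> q \<in> Q \<Longrightarrow> ev [(i, q)] = t i \<otimes> q \<otimes> inv (t i)"
  by (simp add: ev_def copy_of_def t_carrier)

lemma ev_intersection:
  assumes "i < N" "c \<in> Q \<inter> P" shows "ev [(i, c)] = c"
proof -
  have "t i \<otimes> c = c \<otimes> t i" using assms t_P P_comm by blast
  then show ?thesis using assms t_carrier by (simp add: ev_single m_assoc)
qed

lemma reduced_words: "reduced w \<Longrightarrow> w \<in> lists ({..<N} \<times> Q)"
  unfolding alternating_def by auto

lemma ev_take_Suc:
  assumes "w \<in> lists ({..<N} \<times> Q)" "j < length w" "w ! j = (i, q)"
  shows "ev (take (Suc j) w) = ev (take j w) \<otimes> (t i \<otimes> q \<otimes> inv (t i))" "i < N" "q \<in> Q"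
proof -
  have "(i, q) \<in> {..<N} \<times> Q" using assms by (metis in_lists_conv_set nth_mem)
  then show iq: "i < N" "q \<in> Q" by auto
  have "take j w \<in> lists ({..<N} \<times> Q)" using assms by (auto dest: in_set_takeD)
  then show "ev (take (Suc j) w) = ev (take j w) \<otimes> (t i \<otimes> q \<otimes> inv (t i))"
    using assms iq by (simp add: take_Suc_conv_app_nth ev_append ev_single)
qed

text \<open>For a prefix value \<open>y\<close> of a word and its next letter \<open>(i, q)\<close>, the coset \<open>y A\<close> sees
  the following coset near \<open>y t\<^sub>i (Q \<inter> P) b\<close>: after translating by the inverse of
  \<open>y t\<^sub>i\<close>, which maps \<open>y A\<close> to \<open>A\<close>, the following coset becomes \<open>q A\<close>.\<close>

lemma proj_forward:
  assumes y: "y \<in> carrier G" and i: "i < N" and q: "q \<in> Q - P"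
    and v: "v \<in> (y \<otimes> (t i \<otimes> q \<otimes> inv (t i))) <# A" and a: "a \<in> proj (y <# A) v"
  shows "\<exists>c \<in> Q \<inter> P. dX a (y \<otimes> t i \<otimes> c \<otimes> b) \<le> M"
proof -
  have car: "t i \<in> carrier G" "q \<in> carrier G" "a \<in> carrier G"
    using t_carrier i q proj_carrier a by auto
  define z where "z = inv (y \<otimes> t i)"
  have z: "z \<in> carrier G" using y car by (simp add: z_def)
  have Ac: "A \<subseteq> carrier G" using A_carrier by blast
  have ti: "inv (t i) \<in> P" using t_P i by blast
  have "z <# (y <# A) = inv (t i) <# A"
    using y car Ac by (simp add: z_def lcos_m_assoc inv_mult_group m_assoc)
  then have zA: "z <# (y <# A) = A" using P_stabilizes_A[OF ti] by simp
  obtain v' where v': "v' \<in> A" "v = y \<otimes> (t i \<otimes> q \<otimes> inv (t i)) \<otimes> v'"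
    using v by (auto simp: l_coset_def)
  define v'' where "v'' = inv (t i) \<otimes> v'"
  have "v'' \<in> inv (t i) <# A" using v'(1) unfolding v''_def l_coset_def by blast
  then have "v'' \<in> A" using P_stabilizes_A[OF ti] by simp
  moreover have "z \<otimes> v = q \<otimes> v''"
    using y car A_carrier[OF v'(1)] by (simp add: v' z_def v''_def inv_mult_group m_assoc)
  moreover have "z \<otimes> a \<in> proj A (z \<otimes> v)"
    using proj_translate[OF a k coset_translate[OF k A_coset y] z] zA by simp
  ultimately obtain c where c: "c \<in> Q \<inter> P" "dX (z \<otimes> a) (c \<otimes> b) \<le> M"
    using proj_M[OF q, of v''] by auto
  have "z \<otimes> (y \<otimes> t i \<otimes> c \<otimes> b) = c \<otimes> b" using y car c b by (simp add: z_def inv_mult_group m_assoc)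
  then have "dX (z \<otimes> a) (c \<otimes> b) = dX a (y \<otimes> t i \<otimes> c \<otimes> b)"
    using dX_translate[of z a "y \<otimes> t i \<otimes> c \<otimes> b"] z y car c b by simp
  then show ?thesis using c by auto
qed

text \<open>The same from the other side, reading the letter backwards as \<open>(i, inv q)\<close>.\<close>

lemma proj_backward:
  assumes y: "y \<in> carrier G" and i: "i < N" and q: "q \<in> Q - P"
    and y': "y' = y \<otimes> (t i \<otimes> q \<otimes> inv (t i))"
    and v: "v \<in> y <# A" and a: "a \<in> proj (y' <# A) v"
  shows "\<exists>c \<in> Q \<inter> P. dX a (y' \<otimes> t i \<otimes> c \<otimes> b) \<le> M"
proof -
  have car: "t i \<in> carrier G" "q \<in> carrier G" using t_carrier i q by auto
  have "inv q \<in> Q - P" using q P.m_inv_closed[of "inv q"] by auto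
  moreover have "y = y' \<otimes> (t i \<otimes> inv q \<otimes> inv (t i))"
    unfolding y' using y car by (simp add: m_assoc)
  ultimately show ?thesis using proj_forward[of y' i "inv q" v a] y' y i car v a by simp
qed

text \<open>Commutativity of \<open>P\<close> collects the two elements of \<open>Q \<inter> P\<close> into one.\<close>

lemma far_centres:
  assumes "y \<in> carrier G" "i < N" "j < N" "i \<noteq> j" "c \<in> Q \<inter> P" "c' \<in> Q \<inter> P"
  shows "C + 2 * M < dX (y \<otimes> t i \<otimes> c \<otimes> b) (y \<otimes> t j \<otimes> c' \<otimes> b)"
proof -
  have car: "t i \<in> carrier G" "t j \<in> carrier G" "c \<in> carrier G" "c' \<in> carrier G"
    using t_carrier assms by auto
  have P: "inv c \<in> P" "inv (t i) \<otimes> t j \<in> P" using assms t_P by auto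
  have "inv (y \<otimes> t i \<otimes> c \<otimes> b) \<otimes> (y \<otimes> t j \<otimes> c' \<otimes> b)
      = inv b \<otimes> ((inv c \<otimes> (inv (t i) \<otimes> t j)) \<otimes> c') \<otimes> b"
    using assms(1) car b by (simp add: inv_mult_group m_assoc)
  also have "inv c \<otimes> (inv (t i) \<otimes> t j) = (inv (t i) \<otimes> t j) \<otimes> inv c" using P_comm[OF P] .
  also have "\<dots> \<otimes> c' = inv (t i) \<otimes> t j \<otimes> (inv c \<otimes> c')" using car by (simp add: m_assoc)
  finally show ?thesis
    using t_far[OF assms(2-4), of "inv c \<otimes> c'"] assms by (simp add: word_dist_def)
qed

lemma dX_far_near:
  assumes "D + 2 * M < dX u v" "dX a u \<le> M" "dX a' v \<le> M"
    "u \<in> carrier G" "v \<in> carrier G" "a \<in> carrier G" "a' \<in> carrier G"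
  shows "D < dX a a'"
proof -
  have "dX u v \<le> dX u a + dX a v" "dX a v \<le> dX a a' + dX a' v" "dX u a = dX a u"
    using assms by (auto intro!: dX_triangle dX_sym)
  then show ?thesis using assms(1-3) by linarith
qed

lemma reduced_nth:
  assumes "reduced w" "j < length w"
  obtains i q where "w ! j = (i, q)" "i < N" "q \<in> Q - P"
proof -
  have "w ! j \<in> {..<N} \<times> (Q - P)" using assms unfolding alternating_def by (metis in_lists_conv_set nth_mem)
  then show ?thesis using that by (cases "w ! j") auto
qed

text \<open>The coset reached after a letter \<open>(i, q)\<close> sees its predecessor near the centre given by
  \<open>t i\<close> and its successor near the centre given by the index of the following letter.  In a
  reduced word these indices differ.\<close>

lemma reduced_chain:
  assumes w: "reduced w"
  shows "coset_chain G X Hs k C (length w) (\<lambda>j. ev (take j w) <# A)"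
proof unfold_locales
  have take: "ev (take j w) \<in> carrier G" for j
    using reduced_words[OF w] by (intro ev_carrier) (auto dest: in_set_takeD)
  show "k < length Hs" by (rule k)
  show "ev (take j w) <# A \<in> cosets k" for j using coset_translate[OF k A_coset take] .
  fix j u v a a'
  assume j: "Suc j < length w" and u: "u \<in> ev (take j w) <# A"
    and v: "v \<in> ev (take (Suc (Suc j)) w) <# A"
    and a: "a \<in> proj (ev (take (Suc j) w) <# A) u" and a': "a' \<in> proj (ev (take (Suc j) w) <# A) v"
  obtain i q where iq: "w ! j = (i, q)" "i < N" "q \<in> Q - P" using reduced_nth[OF w, of j] j by auto
  obtain i' q' where iq': "w ! Suc j = (i', q')" "i' < N" "q' \<in> Q - P" using reduced_nth[OF w j] .
  have "i \<noteq> i'"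
    using w j iq iq' unfolding alternating_def distinct_adj_conv_nth by force
  define y where "y = ev (take (Suc j) w)"
  obtain c where c: "c \<in> Q \<inter> P" "dX a (y \<otimes> t i \<otimes> c \<otimes> b) \<le> M"
    using proj_backward[OF take iq(2,3) ev_take_Suc(1)[OF reduced_words[OF w] _ iq(1)] u a] j
    unfolding y_def by auto
  obtain c' where c': "c' \<in> Q \<inter> P" "dX a' (y \<otimes> t i' \<otimes> c' \<otimes> b) \<le> M"
    using proj_forward[OF take iq'(2,3) _ a'] v ev_take_Suc(1)[OF reduced_words[OF w] j iq'(1)]
    unfolding y_def by auto
  show "C < dX a a'"
    using far_centres[OF _ iq(2) iq'(2) \<open>i \<noteq> i'\<close> c(1) c'(1), of y] take c c' iq iq' t_carrier b
      proj_carrier(1)[OF a] proj_carrier(1)[OF a']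
    by (intro dX_far_near[OF _ c(2) c'(2)]) (auto simp: y_def)
qed (rule cross)

text \<open>A word with at least two letters gives a chain with an inner coset; a geodesic between its
  ends has to cross it, so the ends differ.\<close>

lemma reduced_nontrivial:
  assumes w: "reduced w" "w \<noteq> []"
  shows "ev w \<noteq> \<one>"
proof
  assume ev: "ev w = \<one>"
  show False
  proof (cases "length w = 1")
    case True
    then obtain iq where iq: "w = [iq]" by (auto simp: length_Suc_conv)
    obtain i q where *: "iq = (i, q)" "i < N" "q \<in> Q - P"
      using reduced_nth[OF w(1), of 0] iq by auto
    then have "t i \<otimes> q \<otimes> inv (t i) = \<one>" using ev iq ev_single by simp
    then have "t i \<otimes> q = t i" using * t_carrier by (metis DiffD1 Q.mem_carrier inv_closed inv_equality inv_inv m_closed)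
    then have "q = \<one>" using * t_carrier by simp
    then show False using * by auto
  next
    case False
    have "length w \<noteq> 0" using w by simp
    then have n: "Suc 0 < length w" using False by linarith
    obtain p where p: "geo p" "vert p 0 = b" "vert p (path_length p) = b" using ex_geodesic[OF b b] by blast
    have "b \<in> \<one> <# A" using P_stabilizes_A[OF P.one_closed] b_in_A by simp
    then have "\<exists>m u v. m < path_length p \<and> u \<in> ev (take 0 w) <# A \<and> v \<in> ev (take (Suc (Suc 0)) w) <# A \<and>
      vert p m \<in> proj (ev (take (Suc 0) w) <# A) u \<and> vert p (Suc m) \<in> proj (ev (take (Suc 0) w) <# A) v"
      using chain_crossing[OF reduced_chain[OF w(1)] _ _ n p] ev by simp
    then show False using geo_d[OF p(1), of 0 "path_length p"] p b by simp
  qed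
qed

text \<open>A geodesic that follows one letter \<open>(i, q)\<close> of a word, read after the prefix value \<open>y\<close>,
  is a translate by \<open>y t\<^sub>i\<close>, up to bounded distance, of a geodesic between points of \<open>Q b\<close>.
  So it stays close to \<open>y t\<^sub>i Q\<close>, and thus to \<open>y\<close> times the \<open>i\<close>-th conjugate of
  \<open>Q\<close>.\<close>

lemma segment_near_copy:
  "\<exists>\<sigma>. \<forall>y i q c c' p V U s. y \<in> carrier G \<and> i < N \<and> q \<in> Q \<and> c \<in> Q \<inter> P \<and> c' \<in> Q \<inter> P \<and> geo p \<and>
     V \<le> s \<and> s \<le> U \<and> U \<le> path_length p \<and> dX (vert p V) (y \<otimes> t i \<otimes> c \<otimes> b) \<le> \<kappa> \<and>
     dX (vert p U) (y \<otimes> t i \<otimes> q \<otimes> c' \<otimes> b) \<le> \<kappa> \<longrightarrow>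
     (\<exists>x \<in> Q. dX (vert p s) (y \<otimes> ev [(i, x)]) \<le> \<sigma>)"
proof -
  obtain \<sigma> where \<sigma>: "\<And>p n. geo p \<Longrightarrow> \<exists>s \<in> Q. vert p 0 = s \<otimes> b \<Longrightarrow>
      \<exists>s \<in> Q. vert p (path_length p) = s \<otimes> b \<Longrightarrow> n \<le> path_length p \<Longrightarrow>
      \<exists>w \<in> Q. dX (vert p n) w \<le> \<sigma>"
    using Q_quasiconvex unfolding quasiconvex_orbit_def by meson
  obtain \<epsilon> where \<epsilon>: "\<And>p q n. geo p \<Longrightarrow> geo q \<Longrightarrow> dX (vert p 0) (vert q 0) \<le> \<kappa> \<Longrightarrow>
      dX (vert p (path_length p)) (vert q (path_length q)) \<le> \<kappa> \<Longrightarrow> n \<le> path_length p \<Longrightarrow>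
      \<exists>m \<le> path_length q. dX (vert p n) (vert q m) \<le> \<epsilon>"
    using fellow_travel[of \<kappa>] by meson
  obtain T where T: "\<And>i. i < N \<Longrightarrow> wlen (inv (t i)) \<le> T"
    using finite_image_bound[of "{..<N}" "\<lambda>i. wlen (inv (t i))"] by auto
  show ?thesis
  proof (rule exI[of _ "\<epsilon> + \<sigma> + T"], intro allI impI)
    fix y i q c c' p V U s
    assume a: "y \<in> carrier G \<and> i < N \<and> q \<in> Q \<and> c \<in> Q \<inter> P \<and> c' \<in> Q \<inter> P \<and> geo p \<and>
      V \<le> s \<and> s \<le> U \<and> U \<le> path_length p \<and> dX (vert p V) (y \<otimes> t i \<otimes> c \<otimes> b) \<le> \<kappa> \<and>
      dX (vert p U) (y \<otimes> t i \<otimes> q \<otimes> c' \<otimes> b) \<le> \<kappa>"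
    define z where "z = y \<otimes> t i"
    have car: "y \<in> carrier G" "t i \<in> carrier G" "z \<in> carrier G" "c \<in> carrier G" "c' \<in> carrier G" "q \<in> carrier G"
      using a t_carrier by (auto simp: z_def)
    have p: "geo p" "p \<in> paths G X Hs" using a geo_paths by auto
    obtain r where r: "geo r" "vert r 0 = c \<otimes> b" "vert r (path_length r) = (q \<otimes> c') \<otimes> b"
      using ex_geodesic[of "c \<otimes> b" "(q \<otimes> c') \<otimes> b"] car b by auto
    have vr: "vert (translate G z r) m = z \<otimes> vert r m" for m
      using vert_translate[OF geo_paths[OF r(1)] car(3)] .
    have start: "dX (vert p V) (z \<otimes> (c \<otimes> b)) \<le> \<kappa>"
      and finish: "dX (vert p U) (z \<otimes> (q \<otimes> c' \<otimes> b)) \<le> \<kappa>"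
      using a car b by (auto simp: z_def m_assoc)
    have "\<exists>m \<le> path_length (translate G z r).
        dX (vert (subpath G p V U) (s - V)) (vert (translate G z r) m) \<le> \<epsilon>"
      using a r p car(3) start finish
      by (intro \<epsilon>) (auto simp: geo_subpath geo_translate vert_subpath vr length_subpath)
    then obtain m where m: "m \<le> path_length r" "dX (vert p s) (z \<otimes> vert r m) \<le> \<epsilon>"
      using a p by (auto simp: vert_subpath vr)
    have "\<exists>s \<in> Q. vert r 0 = s \<otimes> b" "\<exists>s \<in> Q. vert r (path_length r) = s \<otimes> b" using r a by auto
    then obtain x where x: "x \<in> Q" "dX (vert r m) x \<le> \<sigma>" using \<sigma>[OF r(1) _ _ m(1)] by blast
    have vc: "vert r m \<in> carrier G" "vert p s \<in> carrier G" using vert_carrier geo_paths r p by auto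
    have ev: "y \<otimes> ev [(i, x)] = z \<otimes> x \<otimes> inv (t i)"
      using a x car by (simp add: ev_single z_def m_assoc)
    have "dX (vert p s) (y \<otimes> ev [(i, x)]) \<le> dX (vert p s) (z \<otimes> vert r m)
        + dX (z \<otimes> vert r m) (y \<otimes> ev [(i, x)])"
      unfolding ev using vc x car by (intro dX_triangle) auto
    also have "dX (z \<otimes> vert r m) (y \<otimes> ev [(i, x)]) \<le> dX (z \<otimes> vert r m) (z \<otimes> x)
        + dX (z \<otimes> x) (y \<otimes> ev [(i, x)])"
      unfolding ev using vc x car by (intro dX_triangle) auto
    also have "dX (z \<otimes> vert r m) (z \<otimes> x) = dX (vert r m) x" using vc x car by (simp add: dX_translate)
    also have "dX (z \<otimes> x) (y \<otimes> ev [(i, x)]) = wlen (inv (t i))"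
      unfolding ev using x car by (intro dX_mult_right) auto
    finally show "\<exists>x \<in> Q. dX (vert p s) (y \<otimes> ev [(i, x)]) \<le> \<epsilon> + \<sigma> + T"
      using m x T[of i] a by (intro bexI[of _ x]) auto
  qed
qed

text \<open>The crossings of the inner cosets cut the geodesic into segments that follow one letter each,
  with ends near the centres in the cosets before and after that letter.\<close>

lemma reduced_geodesic_near_R:
  "\<exists>\<sigma>. \<forall>w p s. reduced w \<and> w \<noteq> [] \<and> geo p \<and> vert p 0 = b \<and> vert p (path_length p) = ev w \<otimes> b \<and>
     s \<le> path_length p \<longrightarrow> (\<exists>x \<in> R. dX (vert p s) x \<le> \<sigma>)"
proof -
  obtain T where T: "\<And>i. i < N \<Longrightarrow> dX b (t i \<otimes> b) \<le> T"
    using finite_image_bound[of "{..<N}" "\<lambda>i. dX b (t i \<otimes> b)"] by auto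
  obtain \<sigma> where \<sigma>: "\<forall>y i q c c' p V U s. y \<in> carrier G \<and> i < N \<and> q \<in> Q \<and> c \<in> Q \<inter> P \<and>
      c' \<in> Q \<inter> P \<and> geo p \<and> V \<le> s \<and> s \<le> U \<and> U \<le> path_length p \<and>
      dX (vert p V) (y \<otimes> t i \<otimes> c \<otimes> b) \<le> M + T \<and>
      dX (vert p U) (y \<otimes> t i \<otimes> q \<otimes> c' \<otimes> b) \<le> M + T \<longrightarrow>
      (\<exists>x \<in> Q. dX (vert p s) (y \<otimes> ev [(i, x)]) \<le> \<sigma>)"
    using segment_near_copy[of "M + T"] by (rule exE)
  show ?thesis
  proof (rule exI[of _ \<sigma>], intro allI impI)
    fix w p s
    assume a: "reduced w \<and> w \<noteq> [] \<and> geo p \<and> vert p 0 = b \<and> vert p (path_length p) = ev w \<otimes> b \<and>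
      s \<le> path_length p"
    define n where "n = length w"
    define y where "y j = ev (take j w)" for j
    have w: "reduced w" "w \<in> lists ({..<N} \<times> Q)" using a reduced_words by auto
    have p: "geo p" "vert p 0 = b" "vert p (path_length p) = ev w \<otimes> b" using a by auto
    have tw: "take j w \<in> lists ({..<N} \<times> Q)" for j using w by (auto dest: in_set_takeD)
    have y: "y j \<in> carrier G" for j unfolding y_def by (rule ev_carrier[OF tw])
    have yb: "y j \<otimes> b \<in> y j <# A" for j using b_in_A unfolding l_coset_def by blast
    have ends: "b \<in> ev (take 0 w) <# A" "ev w \<otimes> b \<in> ev (take n w) <# A"
      using yb[of 0] yb[of n] b by (auto simp: y_def n_def)
    have "\<exists>m. \<forall>j. Suc j < n \<longrightarrow> (\<exists>u v. m j < path_length p \<and> u \<in> y j <# A \<and> v \<in> y (Suc (Suc j)) <# A \<and>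
        vert p (m j) \<in> proj (y (Suc j) <# A) u \<and> vert p (Suc (m j)) \<in> proj (y (Suc j) <# A) v)"
      using chain_crossing[OF reduced_chain[OF w(1)] _ _ _ p] ends unfolding y_def n_def
      by (intro choice allI) blast
    then obtain m where m: "\<And>j. Suc j < n \<Longrightarrow> \<exists>u v. m j < path_length p \<and> u \<in> y j <# A \<and>
        v \<in> y (Suc (Suc j)) <# A \<and> vert p (m j) \<in> proj (y (Suc j) <# A) u \<and>
        vert p (Suc (m j)) \<in> proj (y (Suc j) <# A) v"
      by blast
    \<comment> \<open>The segment of the letter \<open>w ! j\<close> starts at \<open>V j\<close>, where the geodesic leaves the
      \<open>j\<close>-th coset.  Taking the last such start before \<open>s\<close> avoids having to show that the
      cosets are crossed in order: the next start is after \<open>s\<close>, so the crossing edge that ends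
      there begins at \<open>s\<close> or later.\<close>
    define V where "V j = (case j of 0 \<Rightarrow> 0 | Suc j \<Rightarrow> Suc (m j))" for j
    define J where "J = (GREATEST j. j < n \<and> V j \<le> s)"
    have "0 < n \<and> V 0 \<le> s" using a by (simp add: n_def V_def)
    then have J: "J < n \<and> V J \<le> s" unfolding J_def
      by (rule GreatestI_nat[where b = n and P = "\<lambda>j. j < n \<and> V j \<le> s"]) auto
    have maxJ: "j \<le> J" if "j < n" "V j \<le> s" for j
      unfolding J_def using that by (intro Greatest_le_nat[where b = n]) auto
    define U where "U = (if Suc J < n then m J else path_length p)"
    obtain i q where iq: "w ! J = (i, q)" "i < N" "q \<in> Q - P"
      using reduced_nth[OF w(1), of J] J n_def by auto
    have ySuc: "y (Suc J) = y J \<otimes> (t i \<otimes> q \<otimes> inv (t i))"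
      unfolding y_def using ev_take_Suc(1)[OF w(2) _ iq(1)] J n_def by simp
    have car: "t i \<in> carrier G" "q \<in> carrier G" using t_carrier iq by auto
    have vc: "vert p j \<in> carrier G" for j using vert_carrier[OF geo_paths[OF p(1)]] .
    have sU: "s \<le> U" "U \<le> path_length p"
    proof -
      have "s \<le> m J" if "Suc J < n"
      proof (rule ccontr)
        assume "\<not> s \<le> m J"
        then have "V (Suc J) \<le> s" by (simp add: V_def)
        then show False using maxJ[OF that] by simp
      qed
      then show "s \<le> U" "U \<le> path_length p" using a m[of J] unfolding U_def by (auto split: if_splits)
    qed
    have "\<exists>c \<in> Q \<inter> P. dX (vert p (V J)) (y J \<otimes> t i \<otimes> c \<otimes> b) \<le> M + T"
    proof (cases J)
      case 0
      have "y J = \<one>" by (simp add: y_def 0)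
      then show ?thesis using T[OF iq(2)] p car by (intro bexI[of _ \<one>]) (auto simp: V_def 0)
    next
      case (Suc j)
      then have "Suc j < n" using J by simp
      from m[OF this] obtain v where v: "v \<in> y (Suc J) <# A" "vert p (V J) \<in> proj (y J <# A) v"
        by (auto simp: V_def Suc)
      show ?thesis
        using proj_forward[OF y iq(2,3) _ v(2)] v(1) ySuc by (auto intro: trans_le_add1)
    qed
    moreover have "\<exists>c \<in> Q \<inter> P. dX (vert p U) (y J \<otimes> t i \<otimes> q \<otimes> c \<otimes> b) \<le> M + T"
    proof -
      have eq: "y (Suc J) \<otimes> t i \<otimes> c \<otimes> b = y J \<otimes> t i \<otimes> q \<otimes> c \<otimes> b" if "c \<in> carrier G" for c
        using that ySuc y car b by (simp add: m_assoc)
      show ?thesis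
      proof (cases "Suc J < n")
        case True
        from m[OF this] obtain u where u: "u \<in> y J <# A" "vert p (m J) \<in> proj (y (Suc J) <# A) u"
          by blast
        obtain c where "c \<in> Q \<inter> P" "dX (vert p (m J)) (y (Suc J) \<otimes> t i \<otimes> c \<otimes> b) \<le> M"
          using proj_backward[OF y iq(2,3) ySuc u] by blast
        then show ?thesis using True eq[of c] by (intro bexI[of _ c]) (auto simp: U_def)
      next
        case False
        then have "Suc J = n" using J by simp
        then have "vert p U = y (Suc J) \<otimes> b" using p by (simp add: U_def y_def n_def)
        then have "dX (vert p U) (y (Suc J) \<otimes> t i \<otimes> \<one> \<otimes> b) = dX b (t i \<otimes> b)"
          using y car b by (simp add: dX_translate m_assoc)
        then have "dX (vert p U) (y J \<otimes> t i \<otimes> q \<otimes> \<one> \<otimes> b) \<le> M + T"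
          using T[OF iq(2)] eq[of \<one>] by simp
        then show ?thesis by (intro bexI[of _ \<one>]) auto
      qed
    qed
    ultimately obtain c c' where "c \<in> Q \<inter> P" "dX (vert p (V J)) (y J \<otimes> t i \<otimes> c \<otimes> b) \<le> M + T"
      "c' \<in> Q \<inter> P" "dX (vert p U) (y J \<otimes> t i \<otimes> q \<otimes> c' \<otimes> b) \<le> M + T"
      by blast
    then have "\<exists>x \<in> Q. dX (vert p s) (y J \<otimes> ev [(i, x)]) \<le> \<sigma>"
      using \<sigma>[rule_format, of "y J" i q c c' p "V J" s U] y[of J] iq p(1) sU J by simp
    then obtain x where x: "x \<in> Q" "dX (vert p s) (y J \<otimes> ev [(i, x)]) \<le> \<sigma>" by blast
    have "y J \<otimes> ev [(i, x)] = ev (take J w @ [(i, x)])"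
      using x iq tw by (simp add: y_def ev_append)
    moreover have "take J w @ [(i, x)] \<in> lists ({..<N} \<times> Q)" using x iq tw by simp
    ultimately have "y J \<otimes> ev [(i, x)] \<in> R" unfolding R_def by blast
    then show "\<exists>x \<in> R. dX (vert p s) x \<le> \<sigma>" using x by blast
  qed
qed

lemma R_subset: "R \<subseteq> carrier G"
  unfolding R_def using ev_carrier by blast

lemma R_subgroup: "subgroup R G"
proof (rule subgroupI)
  show "R \<noteq> {}" unfolding R_def by blast
  fix x assume "x \<in> R"
  then obtain w where w: "w \<in> lists ({..<N} \<times> Q)" "x = ev w" unfolding R_def by blast
  define v where "v = rev (map (\<lambda>(i, q). (i, inv q)) w)"
  have "(i, inv q) \<in> {..<N} \<times> Q" if "(i, q) \<in> set w" for i q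
    using w(1) that by (auto simp: in_lists_conv_set)
  then have v: "v \<in> lists ({..<N} \<times> Q)" unfolding v_def by (auto simp: in_lists_conv_set)
  have "map copy_of v = rev (map (\<lambda>x. inv x) (map copy_of w))"
    using w(1) t_carrier unfolding v_def rev_map map_map
    by (intro arg_cong[where f = rev] map_cong HOL.refl)
      (auto simp: copy_of_def inv_mult_group m_assoc)
  moreover have "set (map copy_of w) \<subseteq> carrier G" using w(1) copy_of_carrier by auto
  ultimately have "ev v = inv x" unfolding w(2) ev_def using word_prod_rev_inv by metis
  then show "inv x \<in> R" using imageI[OF v, of ev] unfolding R_def by simp
next
  fix x y assume x: "x \<in> R" and y: "y \<in> R"
  obtain u where u: "u \<in> lists ({..<N} \<times> Q)" "x = ev u" using x unfolding R_def by (rule imageE)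
  obtain v where v: "v \<in> lists ({..<N} \<times> Q)" "y = ev v" using y unfolding R_def by (rule imageE)
  have "u @ v \<in> lists ({..<N} \<times> Q)" using u v by simp
  then have "ev (u @ v) \<in> R" unfolding R_def by (rule imageI)
  then show "x \<otimes> y \<in> R" using ev_append[OF u(1) v(1)] u v by simp
qed (rule R_subset)

text \<open>The hypothesis \<open>nf\<close> is the normal form of elements of the amalgam, proved below.  It suffices to
  consider geodesics that start at \<open>b\<close>.  Those that end in \<open>(Q \<inter> P) b\<close> join two points of
  the coset \<open>A\<close> and have no inner vertices; the others belong to reduced words.\<close>

lemma R_quasiconvex:
  assumes nf: "\<And>x. x \<in> R \<Longrightarrow> x \<in> Q \<inter> P \<or> (\<exists>w. reduced w \<and> w \<noteq> [] \<and> x = ev w)"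
    and N: "0 < N"
  shows "relatively_quasiconvex G X Hs R"
proof -
  interpret R: subgroup R G by (rule R_subgroup)
  obtain \<sigma> where \<sigma>: "\<And>w p s. reduced w \<Longrightarrow> w \<noteq> [] \<Longrightarrow> geo p \<Longrightarrow> vert p 0 = b \<Longrightarrow>
      vert p (path_length p) = ev w \<otimes> b \<Longrightarrow> s \<le> path_length p \<Longrightarrow> \<exists>x \<in> R. dX (vert p s) x \<le> \<sigma>"
    using reduced_geodesic_near_R by blast
  have from_b: "\<exists>y \<in> R. dX (vert p s) y \<le> \<sigma> + wlen (inv b)"
    if x: "x \<in> R" and p: "geo p" "vert p 0 = b" "vert p (path_length p) = x \<otimes> b" and s: "s \<le> path_length p"
    for x p s
  proof (cases "x \<in> Q \<inter> P")
    case True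
    have "x \<otimes> b \<in> A" using True P_iff by blast
    then have "path_length p \<le> 1"
      using geo_coset[OF p(1) k A_coset, of 0 "path_length p"] p b_in_A by simp
    then have "s = 0 \<or> s = path_length p" using s by linarith
    then obtain y where y: "y \<in> R" "vert p s = y \<otimes> b" using p x b by (metis R.one_closed l_one)
    have "dX (y \<otimes> b) y = wlen (inv b)"
      using dX_mult_right[of "y \<otimes> b" "inv b"] y b by (simp add: m_assoc)
    then show ?thesis using y by (intro bexI[of _ y]) auto
  next
    case False
    then obtain w where "reduced w" "w \<noteq> []" "x = ev w" using nf[OF x] by blast
    then obtain y where "y \<in> R" "dX (vert p s) y \<le> \<sigma>" using \<sigma>[of w p s] p s by blast
    then show ?thesis by (intro bexI[of _ y]) auto
  qed
  have "\<exists>y \<in> R. dX (vert p s) y \<le> \<sigma> + wlen (inv b)"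
    if p: "geo p" "f \<in> R" "vert p 0 = f \<otimes> b" "g \<in> R" "vert p (path_length p) = g \<otimes> b"
      and s: "s \<le> path_length p" for p f g s
  proof -
    have fg: "f \<in> carrier G" "g \<in> carrier G" using p by auto
    let ?p = "translate G (inv f) p"
    have v: "vert ?p n = inv f \<otimes> vert p n" for n using vert_translate[OF geo_paths[OF p(1)]] fg by simp
    have "\<exists>y \<in> R. dX (vert ?p s) y \<le> \<sigma> + wlen (inv b)"
      using p fg b s by (intro from_b[of "inv f \<otimes> g"]) (auto simp: geo_translate v m_assoc)
    then obtain y where y: "y \<in> R" "dX (inv f \<otimes> vert p s) y \<le> \<sigma> + wlen (inv b)" by (auto simp: v)
    have "dX (inv f \<otimes> vert p s) y = dX (vert p s) (f \<otimes> y)"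
      using dX_translate[of f "inv f \<otimes> vert p s" y] fg y vert_carrier[OF geo_paths[OF p(1)]] by simp
    then show ?thesis using y p by (intro bexI[of _ "f \<otimes> y"]) auto
  qed
  then have "quasiconvex_orbit R b" unfolding quasiconvex_orbit_def by blast
  then show ?thesis
    using quasiconvex_orbit_basepoint[OF R_subset _ b one_closed] R_subgroup
    by (simp add: relatively_quasiconvex_iff)
qed

end

section \<open>Normal forms in an amalgam of copies\<close>

lemma alternating_Cons:
  "alternating k S ((i, a) # w) \<longleftrightarrow>
    i < k \<and> a \<in> S \<and> alternating k S w \<and> (w = [] \<or> fst (hd w) \<noteq> i)"
  by (cases w) (auto simp: alternating_def)

locale amalgam_words = S: group S + K: subgroup K S for S (structure) and K +
  fixes k :: nat
begin

abbreviation eq :: "(nat \<times> 'a) list \<Rightarrow> (nat \<times> 'a) list \<Rightarrow> bool" (infix "\<sim>" 50) where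
  "u \<sim> v \<equiv> amalgam_eq k S K u v"

declare amalgam_eq.trans [trans]

lemma eq_append_right: "u \<sim> u' \<Longrightarrow> v \<in> lists ({..<k} \<times> carrier S) \<Longrightarrow> u @ v \<sim> u' @ v"
  by (rule amalgam_eq.append[OF _ amalgam_eq.refl])

lemma eq_Cons: "i < k \<Longrightarrow> a \<in> carrier S \<Longrightarrow> u \<sim> v \<Longrightarrow> (i, a) # u \<sim> (i, a) # v"
  using amalgam_eq.append[OF amalgam_eq.refl[of "[(i, a)]" k S K], of u v] by simp

lemma eq_merge:
  assumes "i < k" "a \<in> carrier S" "b \<in> carrier S" "v \<in> lists ({..<k} \<times> carrier S)"
  shows "(i, a) # (i, b) # v \<sim> (i, a \<otimes> b) # v"
  using eq_append_right[OF amalgam_eq.mult[OF assms(1-3)] assms(4)] by simp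

lemma eq_slide:
  assumes "i < k" "j < k" "c \<in> K" "v \<in> lists ({..<k} \<times> carrier S)"
  shows "(i, c) # v \<sim> (j, c) # v"
  using eq_append_right[OF amalgam_eq.amalgamate[OF assms(1-3)] assms(4)] by simp

lemma alternating_words: "alternating k (carrier S - K) w \<Longrightarrow> w \<in> lists ({..<k} \<times> carrier S)"
  unfolding alternating_def by auto

lemma mult_notin_K:
  assumes "c \<in> K" "a \<in> carrier S" "a \<notin> K" shows "c \<otimes> a \<notin> K"
proof
  assume "c \<otimes> a \<in> K"
  then show False using K.m_closed[OF K.m_inv_closed[OF assms(1)], of "c \<otimes> a"] assms by simp
qed

text \<open>An element of the amalgamated subgroup belongs to every copy, so it can be moved to the copy
  of the first letter and multiplied into it.\<close>

lemma absorb_into_head: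
  assumes "i < k" "c \<in> K" "alternating k (carrier S - K) v" "v \<noteq> []"
  shows "\<exists>v'. alternating k (carrier S - K) v' \<and> v' \<noteq> [] \<and> (i, c) # v \<sim> v'"
proof -
  obtain j a w where v: "v = (j, a) # w" using assms(4) by (cases v) auto
  have *: "j < k" "a \<in> carrier S" "a \<notin> K" "w \<in> lists ({..<k} \<times> carrier S)"
    using assms(3) alternating_words[of w] by (auto simp: v alternating_Cons)
  have "(i, c) # v \<sim> (j, c) # v"
    using assms(1-3) * alternating_words by (intro eq_slide) auto
  also have "(j, c) # v \<sim> (j, c \<otimes> a) # w" unfolding v using * assms(2) by (intro eq_merge) auto
  finally have "(i, c) # v \<sim> (j, c \<otimes> a) # w" .
  moreover have "alternating k (carrier S - K) ((j, c \<otimes> a) # w)"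
    using assms(2,3) * mult_notin_K by (auto simp: v alternating_Cons)
  ultimately show ?thesis by blast
qed

text \<open>The elements of the amalgamated subgroup, the trivial one included, are represented in the copy
  with index 0; so a normal form is never empty.\<close>

definition normal :: "(nat \<times> 'a) list \<Rightarrow> bool" where
  "normal w \<longleftrightarrow> (\<exists>c \<in> K. w = [(0, c)]) \<or> (alternating k (carrier S - K) w \<and> w \<noteq> [])"

lemma normal_Cons:
  assumes k: "0 < k" and i: "i < k" and a: "a \<in> carrier S" and w: "normal w"
  shows "\<exists>w'. normal w' \<and> (i, a) # w \<sim> w'"
proof -
  have single: "\<exists>w'. normal w' \<and> [(i, x)] \<sim> w'" if "x \<in> carrier S" for x
  proof (cases "x \<in> K")
    case True
    then show ?thesis using amalgam_eq.amalgamate[OF i k True, of S] by (auto simp: normal_def)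
  next
    case False
    then show ?thesis using that i amalgam_eq.refl[of "[(i, x)]" k S K]
      by (intro exI[of _ "[(i, x)]"]) (auto simp: normal_def alternating_def)
  qed
  show ?thesis
  proof (cases "\<exists>c \<in> K. w = [(0, c)]")
    case True
    then obtain c where c: "c \<in> K" "w = [(0, c)]" by blast
    have "(i, a) # w \<sim> (i, a) # [(i, c)]"
      unfolding c(2) using i a k c by (intro eq_Cons amalgam_eq.amalgamate)
    also have "(i, a) # [(i, c)] \<sim> [(i, a \<otimes> c)]" using i a c by (intro amalgam_eq.mult) auto
    finally have "(i, a) # w \<sim> [(i, a \<otimes> c)]" .
    moreover have "a \<otimes> c \<in> carrier S" using a c by simp
    then obtain w' where "normal w'" "[(i, a \<otimes> c)] \<sim> w'" using single by blast
    ultimately show ?thesis using amalgam_eq.trans[of k S K "(i, a) # w"] by blast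
  next
    case False
    then have alt: "alternating k (carrier S - K) w" "w \<noteq> []" using w by (auto simp: normal_def)
    show ?thesis
    proof (cases "a \<in> K")
      case True
      then show ?thesis using absorb_into_head[OF i True alt] by (auto simp: normal_def)
    next
      case aK: False
      obtain j x v where wv: "w = (j, x) # v" using alt(2) by (cases w) auto
      have *: "j < k" "x \<in> carrier S" "x \<notin> K" "alternating k (carrier S - K) v"
        "v \<in> lists ({..<k} \<times> carrier S)"
        using alt(1) alternating_words[of v] by (auto simp: wv alternating_Cons)
      show ?thesis
      proof (cases "i = j")
        case False
        then have "alternating k (carrier S - K) ((i, a) # w)"
          using alt i a aK by (simp add: wv alternating_Cons)
        then show ?thesis using amalgam_eq.refl[OF alternating_words] by (auto simp: normal_def)
      next
        case True
        have merge: "(i, a) # w \<sim> (i, a \<otimes> x) # v" unfolding wv using True i a * by (auto intro: eq_merge)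
        show ?thesis
        proof (cases "a \<otimes> x \<in> K")
          case False
          then have "normal ((i, a \<otimes> x) # v)"
            using alt(1) i a * True by (auto simp: normal_def wv alternating_Cons)
          then show ?thesis using merge by blast
        next
          case K: True
          show ?thesis
          proof (cases "v = []")
            case True
            have "a \<otimes> x \<in> carrier S" using a * by simp
            then obtain w' where "normal w'" "[(i, a \<otimes> x)] \<sim> w'" using single by blast
            then show ?thesis using merge True amalgam_eq.trans[of k S K "(i, a) # w"] by blast
          next
            case False
            then obtain w' where "alternating k (carrier S - K) w' \<and> w' \<noteq> []" "(i, a \<otimes> x) # v \<sim> w'"
              using absorb_into_head[OF i K *(4)] by blast
            then show ?thesis
              using merge amalgam_eq.trans[of k S K "(i, a) # w"] unfolding normal_def by blast
          qed
        qed
      qed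
    qed
  qed
qed

lemma ex_normal_form:
  assumes "0 < k" shows "w \<in> lists ({..<k} \<times> carrier S) \<Longrightarrow> \<exists>w'. normal w' \<and> w \<sim> w'"
proof (induction w)
  case Nil
  have "normal [(0, \<one>)]" by (simp add: normal_def)
  moreover have "[] \<sim> [(0, \<one>)]" using amalgam_eq.one[OF assms] by (rule amalgam_eq.sym)
  ultimately show ?case by blast
next
  case (Cons ia w)
  obtain i a where ia: "ia = (i, a)" "i < k" "a \<in> carrier S" using Cons.prems by auto
  obtain w' where w': "normal w'" "w \<sim> w'" using Cons by auto
  obtain w'' where w'': "normal w''" "(i, a) # w' \<sim> w''" using normal_Cons[OF assms ia(2,3) w'(1)] by blast
  then show ?case using eq_Cons[OF ia(2,3) w'(2)] amalgam_eq.trans ia(1) by blast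
qed

end

context separated_copies
begin

abbreviation QG where "QG \<equiv> G\<lparr>carrier := Q\<rparr>"

lemma QG_group: "group QG"
  using subgroup_imp_group[OF Q_subgroup] .

lemma QP_subgroup: "subgroup (Q \<inter> P) QG"
proof -
  have "subgroup (Q \<inter> P) G" using subgroups_Inter_pair[OF Q_subgroup P_subgroup] .
  then show ?thesis by (rule subgroup_incl[OF _ Q_subgroup]) simp
qed

lemma words_amalgam: "amalgam_words QG (Q \<inter> P)"
  using QG_group QP_subgroup by (simp add: amalgam_words_def)

sublocale W: amalgam_words QG "Q \<inter> P" N
  by (rule words_amalgam)

lemma ev_cong: "W.eq u v \<Longrightarrow> ev u = ev v \<and> u \<in> lists ({..<N} \<times> Q) \<and> v \<in> lists ({..<N} \<times> Q)"
proof (induction rule: amalgam_eq.induct)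
  case (mult i a b)
  then have ab: "a \<in> Q" "b \<in> Q" "i < N" by auto
  then have "a \<in> carrier G" "b \<in> carrier G" "t i \<in> carrier G" using t_carrier by auto
  then have "ev [(i, a), (i, b)] = ev [(i, a \<otimes> b)]"
    using ab by (simp add: ev_def copy_of_def m_assoc)
  then show ?case using ab by simp
next
  case (one i)
  then show ?case using t_carrier[of i] by (simp add: ev_def copy_of_def)
next
  case (amalgamate i j c)
  then show ?case using ev_intersection[of i c] ev_intersection[of j c] by simp
next
  case (append u u' v v')
  then show ?case by (simp add: ev_append)
qed auto

lemma ev_normal:
  assumes "W.normal w"
  shows "(\<exists>c \<in> Q \<inter> P. w = [(0, c)]) \<or> (reduced w \<and> w \<noteq> [])"
proof -
  have "Q - Q \<inter> P = Q - P" by blast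
  then show ?thesis using assms by (simp add: W.normal_def)
qed

lemma R_normal_form:
  assumes "0 < N" "x \<in> R"
  shows "x \<in> Q \<inter> P \<or> (\<exists>w. reduced w \<and> w \<noteq> [] \<and> x = ev w)"
proof -
  obtain u where u: "u \<in> lists ({..<N} \<times> Q)" "x = ev u" using assms unfolding R_def by blast
  obtain w where w: "W.normal w" "W.eq u w" using W.ex_normal_form[OF assms(1), of u] u by auto
  then show ?thesis using ev_normal[OF w(1)] ev_cong[OF w(2)] ev_intersection[OF assms(1)] u by auto
qed

text \<open>The normal form of a word in the kernel is not alternating, since reduced words have
  nontrivial value, so it is an element of \<open>Q \<inter> P\<close>, on which \<open>ev\<close> is the identity.\<close>

lemma ev_kernel:
  assumes "0 < N" "u \<in> lists ({..<N} \<times> Q)" "ev u = \<one>"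
  shows "W.eq u []"
proof -
  obtain w where w: "W.normal w" "W.eq u w" using W.ex_normal_form[OF assms(1), of u] assms by auto
  have "ev w = \<one>" using ev_cong[OF w(2)] assms by simp
  then obtain c where c: "c \<in> Q \<inter> P" "w = [(0, c)]" using ev_normal[OF w(1)] reduced_nontrivial by blast
  then have "c = \<one>" using \<open>ev w = \<one>\<close> ev_intersection[OF assms(1)] by simp
  then have "W.eq w []" using amalgam_eq.one[OF assms(1), of QG] c by simp
  then show ?thesis using w(2) amalgam_eq.trans by blast
qed

text \<open>\<open>ev\<close> induces a homomorphism on the amalgam with image \<open>R\<close> and trivial kernel.\<close>

lemma R_iso_Amalgam:
  assumes N: "0 < N" shows "G\<lparr>carrier := R\<rparr> \<cong> Amalgam N QG (Q \<inter> P)"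
proof -
  let ?c = "amalgam_class N QG (Q \<inter> P)" and ?A = "Amalgam N QG (Q \<inter> P)"
  define W where "W = lists ({..<N} \<times> Q)"
  \<comment> \<open>\<open>ev\<close> is constant on each class, so the image of a class is a singleton\<close>
  define \<phi> where "\<phi> x = the_elem (ev ` x)" for x
  have carr: "carrier ?A = ?c ` W" by (simp add: Amalgam_def W_def)
  have \<phi>: "\<phi> (?c u) = ev u" if "u \<in> W" for u
  proof -
    have "u \<in> ?c u" using that amalgam_eq.refl[of u N QG] by (simp add: amalgam_class_def W_def)
    moreover have "ev v = ev u" if "v \<in> ?c u" for v
      using that ev_cong[of u v] by (simp add: amalgam_class_def)
    ultimately have "ev ` ?c u = {ev u}" by blast
    then show ?thesis by (simp add: \<phi>_def)
  qed
  interpret A: group ?A by (rule group_Amalgam[OF QG_group])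
  have mult: "?c u \<otimes>\<^bsub>?A\<^esub> ?c v = ?c (u @ v)" if "u \<in> W" "v \<in> W" for u v
    using that mult_Amalgam[of u N QG v] by (simp add: W_def)
  have app: "u @ v \<in> W" if "u \<in> W" "v \<in> W" for u v using that by (simp add: W_def)
  interpret \<phi>: group_hom ?A G \<phi>
  proof
    show "\<phi> \<in> hom ?A G"
    proof (rule homI)
      show "\<phi> x \<in> carrier G" if "x \<in> carrier ?A" for x
      proof -
        obtain u where "u \<in> W" "x = ?c u" using \<open>x \<in> carrier ?A\<close> unfolding carr by blast
        then show ?thesis using \<phi> ev_carrier by (simp add: W_def)
      qed
      fix x y assume "x \<in> carrier ?A" "y \<in> carrier ?A"
      then obtain u v where "u \<in> W" "x = ?c u" "v \<in> W" "y = ?c v" unfolding carr by blast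
      then show "\<phi> (x \<otimes>\<^bsub>?A\<^esub> y) = \<phi> x \<otimes> \<phi> y"
        using ev_append[of u v] by (simp add: mult \<phi> app) (simp add: W_def)
    qed
  qed
  have "kernel ?A G \<phi> = {\<one>\<^bsub>?A\<^esub>}"
  proof -
    have "x = \<one>\<^bsub>?A\<^esub>" if x: "x \<in> carrier ?A" "\<phi> x = \<one>" for x
    proof -
      obtain u where u: "u \<in> W" "x = ?c u" using x(1) unfolding carr by blast
      then have "W.eq u []" using ev_kernel[OF N] x(2) \<phi> by (simp add: W_def)
      then show ?thesis using amalgam_class_eq_iff[of "[]" N QG] u by (simp add: Amalgam_def)
    qed
    then show ?thesis unfolding kernel_def by auto
  qed
  then have "inj_on \<phi> (carrier ?A)" by (rule \<phi>.trivial_ker_imp_inj)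
  moreover have image: "\<phi> ` carrier ?A = R"
    unfolding carr R_def image_image using \<phi> by (intro image_cong) (auto simp: W_def)
  moreover have "\<phi> \<in> hom ?A (G\<lparr>carrier := R\<rparr>)"
    using \<phi>.homh image unfolding hom_def by auto
  ultimately have "\<phi> \<in> iso ?A (G\<lparr>carrier := R\<rparr>)"
    unfolding iso_def bij_betw_def by simp
  then have "?A \<cong> G\<lparr>carrier := R\<rparr>" unfolding is_iso_def by blast
  then show ?thesis by (rule A.iso_sym)
qed

end

section \<open>Elements of infinite order modulo a subgroup of smaller rank\<close>

context group
begin

lemma subgroup_comm_group:
  assumes "subgroup K G" "\<And>x y. x \<in> K \<Longrightarrow> y \<in> K \<Longrightarrow> x \<otimes> y = y \<otimes> x"
  shows "comm_group (G\<lparr>carrier := K\<rparr>)"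
  using assms by (intro group.group_comm_groupI[OF subgroup_imp_group[OF assms(1)]]) auto

lemma finprod_consistent:
  assumes "comm_group (G\<lparr>carrier := P\<rparr>)" "comm_group (G\<lparr>carrier := K\<rparr>)" "K \<subseteq> P"
    and "finite B" "f \<in> B \<rightarrow> K"
  shows "finprod (G\<lparr>carrier := K\<rparr>) f B = finprod (G\<lparr>carrier := P\<rparr>) f B"
proof -
  interpret P: comm_group "G\<lparr>carrier := P\<rparr>" by fact
  interpret K: comm_group "G\<lparr>carrier := K\<rparr>" by fact
  show ?thesis using assms(4,5)
  proof (induction B)
    case empty
    then show ?case by simp
  next
    case (insert x B)
    moreover have "f \<in> B \<rightarrow> P" "f x \<in> P" "f x \<in> K" "f \<in> B \<rightarrow> K" using insert.prems assms(3) by auto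
    ultimately show ?case by simp
  qed
qed

text \<open>Otherwise every \<open>h\<close> in \<open>P\<close> has a nontrivial power \<open>g h\<close> in \<open>K\<close>.  Replacing the elements of
  an independent subset of \<open>P\<close> by such powers gives an independent subset of \<open>K\<close> with the same
  number of elements, so the rank of \<open>K\<close> is at least that of \<open>P\<close>.\<close>

lemma ex_infinite_order_mod_subgroup:
  assumes P: "subgroup P G" and K: "subgroup K G" "K \<subseteq> P"
    and comm: "\<And>x y. x \<in> P \<Longrightarrow> y \<in> P \<Longrightarrow> x \<otimes> y = y \<otimes> x"
    and rank: "Z_rank (G\<lparr>carrier := K\<rparr>) < Z_rank (G\<lparr>carrier := P\<rparr>)"
  shows "\<exists>h \<in> P. \<forall>n::int. n \<noteq> 0 \<longrightarrow> h [^] n \<notin> K"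
proof (rule ccontr)
  assume "\<not> ?thesis"
  then have "\<forall>h \<in> P. \<exists>n::int. n \<noteq> 0 \<and> h [^] n \<in> K" by blast
  then obtain e :: "'a \<Rightarrow> int" where e: "\<And>h. h \<in> P \<Longrightarrow> e h \<noteq> 0" "\<And>h. h \<in> P \<Longrightarrow> h [^] e h \<in> K"
    by metis
  let ?P = "G\<lparr>carrier := P\<rparr>" and ?K = "G\<lparr>carrier := K\<rparr>"
  interpret P: comm_group ?P using subgroup_comm_group P comm by blast
  interpret K: comm_group ?K using K comm by (intro subgroup_comm_group) auto
  have powP: "x [^]\<^bsub>?P\<^esub> n = x [^] n" if "x \<in> P" for x and n :: int
    using int_pow_consistent[OF P that] by simp
  have powK: "x [^]\<^bsub>?K\<^esub> n = x [^] n" if "x \<in> K" for x and n :: int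
    using int_pow_consistent[OF K(1) that] by simp
  have carP: "x \<in> P \<Longrightarrow> x \<in> carrier G" for x using P subgroup.mem_carrier by fast
  have pow_in: "x [^] n \<in> P" if "x \<in> P" for x and n :: int using subgroup_int_pow_closed[OF P that] .
  have "\<exists>B'. Z_independent ?K B' \<and> card B' = card B" if B: "Z_independent ?P B" for B
  proof -
    have fin: "finite B" and BP: "B \<subseteq> P" using B unfolding Z_independent_def by auto
    have indep: "n b = 0" if "finprod ?P (\<lambda>b. b [^] n b) B = \<one>" "b \<in> B" for n :: "'a \<Rightarrow> int" and b
    proof -
      have "finprod ?P (\<lambda>b. b [^]\<^bsub>?P\<^esub> n b) B = finprod ?P (\<lambda>b. b [^] n b) B"
        using BP powP pow_in by (intro P.finprod_cong') auto
      then show ?thesis using B that unfolding Z_independent_def by auto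
    qed
    define g where "g x = x [^] e x" for x
    have gK: "g x \<in> K" "g x \<in> P" if "x \<in> B" for x using that BP e K(2) unfolding g_def by auto
    have inj: "inj_on g B"
    proof (rule inj_onI, rule ccontr)
      fix x y assume xy: "x \<in> B" "y \<in> B" "g x = g y" "x \<noteq> y"
      define n where "n z = (if z = x then e x else if z = y then - e y else 0)" for z
      have f: "(\<lambda>b. b [^] n b) \<in> C \<rightarrow> P" if "C \<subseteq> B" for C using that BP pow_in by auto
      have xyP: "x \<in> P" "y \<in> P" using xy BP by auto
      have "B = insert x (insert y (B - {x, y}))" using xy by blast
      then have "finprod ?P (\<lambda>b. b [^] n b) B
          = finprod ?P (\<lambda>b. b [^] n b) (insert x (insert y (B - {x, y})))" by simp
      also have "\<dots> = x [^] n x \<otimes> (y [^] n y \<otimes> finprod ?P (\<lambda>b. b [^] n b) (B - {x, y}))"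
        using fin xy f[of "B - {x, y}"] pow_in xyP by simp
      also have "finprod ?P (\<lambda>b. b [^] n b) (B - {x, y}) = \<one>"
        using P.finprod_one_eqI[of "B - {x, y}" "\<lambda>b. b [^] n b"] by (auto simp: n_def)
      also have "x [^] n x \<otimes> (y [^] n y \<otimes> \<one>) = g x \<otimes> inv (g y)"
        using xy carP[OF xyP(1)] carP[OF xyP(2)] by (auto simp: n_def g_def int_pow_neg)
      also have "\<dots> = \<one>" using xy carP gK by simp
      finally have "n x = 0" using indep xy by blast
      then show False using e(1)[OF xyP(1)] by (simp add: n_def)
    qed
    have "Z_independent ?K (g ` B)"
      unfolding Z_independent_def
    proof (intro conjI allI impI)
      show "finite (g ` B)" "g ` B \<subseteq> carrier ?K" using fin gK by auto
      fix n :: "'a \<Rightarrow> int"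
      assume "finprod ?K (\<lambda>b. b [^]\<^bsub>?K\<^esub> n b) (g ` B) = \<one>\<^bsub>?K\<^esub>"
      moreover have "finprod ?K (\<lambda>b. b [^]\<^bsub>?K\<^esub> n b) (g ` B) = finprod ?K (\<lambda>b. b [^] n b) (g ` B)"
        using gK powK subgroup_int_pow_closed[OF K(1)] by (intro K.finprod_cong') auto
      moreover have "\<dots> = finprod ?P (\<lambda>b. b [^] n b) (g ` B)"
        using gK subgroup_int_pow_closed[OF K(1)] fin P.comm_group_axioms K.comm_group_axioms K(2)
        by (intro finprod_consistent) auto
      moreover have "\<dots> = finprod ?P (\<lambda>x. g x [^] n (g x)) B"
        using gK pow_in inj by (intro P.finprod_reindex) auto
      moreover have "\<dots> = finprod ?P (\<lambda>x. x [^] (e x * n (g x))) B"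
        using BP pow_in carP by (intro P.finprod_cong') (auto simp: g_def int_pow_pow subset_iff)
      ultimately have "finprod ?P (\<lambda>x. x [^] (e x * n (g x))) B = \<one>" by simp
      then have "e x * n (g x) = 0" if "x \<in> B" for x
        using indep[of "\<lambda>x. e x * n (g x)" x] that by simp
      then show "\<forall>b \<in> g ` B. n b = 0" using e(1) BP by fastforce
    qed
    then show ?thesis using card_image[OF inj] by blast
  qed
  then have "{enat (card B) |B. Z_independent ?P B} \<subseteq> {enat (card B) |B. Z_independent ?K B}"
    by (smt (verit) Collect_mono)
  then have "Z_rank ?P \<le> Z_rank ?K" unfolding Z_rank_def by (rule Sup_subset_mono)
  then show False using rank by simp
qed

text \<open>Distinct powers of \<open>h\<close> lie in distinct cosets of \<open>K\<close>, so only finitely many exponents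
  lead into the cosets that meet \<open>F\<close>; take for \<open>L\<close> a number larger than all of them in absolute
  value.\<close>

lemma ex_spread_out_powers:
  assumes h: "h \<in> carrier G" and K: "subgroup K G" and inf: "\<And>n::int. n \<noteq> 0 \<Longrightarrow> h [^] n \<notin> K"
    and F: "finite F"
  shows "\<exists>L::int. \<forall>i j::int. \<forall>c \<in> K. i \<noteq> j \<longrightarrow> inv (h [^] (L * i)) \<otimes> h [^] (L * j) \<otimes> c \<notin> F"
proof -
  interpret K: subgroup K G by (rule K)
  define S where "S = {n::int. \<exists>c \<in> K. h [^] n \<otimes> c \<in> F}"
  define c where "c n = (SOME c. c \<in> K \<and> h [^] n \<otimes> c \<in> F)" for n :: int
  have c: "c n \<in> K \<and> h [^] n \<otimes> c n \<in> F" if "n \<in> S" for n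
    using that unfolding S_def c_def by (intro someI_ex[of "\<lambda>c. c \<in> K \<and> h [^] n \<otimes> c \<in> F"]) blast
  have "inj_on (\<lambda>n. h [^] n \<otimes> c n) S"
  proof (rule inj_onI, rule ccontr)
    fix m n assume mn: "m \<in> S" "n \<in> S" "h [^] m \<otimes> c m = h [^] n \<otimes> c n" "m \<noteq> n"
    have car: "c m \<in> carrier G" "c n \<in> carrier G" using c mn by auto
    have "h [^] (m - n) = inv (h [^] n) \<otimes> (h [^] m \<otimes> c m) \<otimes> inv (c m)"
      using h car int_pow_mult[of h "- n" m] by (simp add: m_assoc int_pow_neg)
    also have "\<dots> = c n \<otimes> inv (c m)" unfolding mn(3) using h car by (simp add: m_assoc)
    also have "\<dots> \<in> K" using c mn by auto
    finally show False using inf[of "m - n"] mn(4) by simp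
  qed
  moreover have "(\<lambda>n. h [^] n \<otimes> c n) ` S \<subseteq> F" using c by auto
  ultimately have fin: "finite S" using F by (metis finite_imageD finite_subset)
  define L where "L = 1 + Max (abs ` insert 0 S)"
  have L: "\<bar>n\<bar> < L" if "n \<in> S" for n
  proof -
    have "\<bar>n\<bar> \<le> Max (abs ` insert 0 S)" using that fin by (intro Max_ge) auto
    then show ?thesis by (simp add: L_def)
  qed
  have L0: "0 < L"
  proof -
    have "\<bar>0::int\<bar> \<le> Max (abs ` insert 0 S)" using fin by (intro Max_ge) auto
    then show ?thesis by (simp add: L_def)
  qed
  have "inv (h [^] (L * i)) \<otimes> h [^] (L * j) \<otimes> c \<notin> F" if "c \<in> K" "i \<noteq> j" for i j :: int and c
  proof
    assume "inv (h [^] (L * i)) \<otimes> h [^] (L * j) \<otimes> c \<in> F"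
    moreover have "inv (h [^] (L * i)) \<otimes> h [^] (L * j) = h [^] (L * (j - i))"
      using h int_pow_mult[of h "- (L * i)" "L * j"] by (simp add: int_pow_neg right_diff_distrib)
    ultimately have "L * (j - i) \<in> S" using that unfolding S_def by auto
    then have "\<bar>L * (j - i)\<bar> < L" by (rule L)
    moreover have "L * 1 \<le> L * \<bar>j - i\<bar>" using that L0 by (intro mult_left_mono) auto
    ultimately show False using L0 by (simp add: abs_mult)
  qed
  then show ?thesis by blast
qed

end

section \<open>Amalgams over parabolic intersections of smaller rank\<close>

lemma free_abelian_commute:
  assumes "free_abelian A" "x \<in> carrier A" "y \<in> carrier A" "group A"
  shows "x \<otimes>\<^bsub>A\<^esub> y = y \<otimes>\<^bsub>A\<^esub> x"
proof -
  interpret A: group A by fact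
  obtain S :: "'a set" and f where f: "f \<in> iso A (free_Abelian_group S)"
    using assms(1) unfolding free_abelian_def is_iso_def by blast
  interpret F: comm_group "free_Abelian_group S" by (rule abelian_free_Abelian_group)
  have hom: "f (u \<otimes>\<^bsub>A\<^esub> v) = f u \<otimes>\<^bsub>free_Abelian_group S\<^esub> f v"
    "f u \<in> carrier (free_Abelian_group S)" if "u \<in> carrier A" "v \<in> carrier A" for u v
    using f that unfolding iso_def by (blast dest: hom_mult hom_in_carrier)+
  have "f (x \<otimes>\<^bsub>A\<^esub> y) = f (y \<otimes>\<^bsub>A\<^esub> x)"
    using hom assms(2,3) by (simp add: F.m_comm)
  moreover have "inj_on f (carrier A)" using f unfolding iso_def bij_betw_def by blast
  ultimately show ?thesis using assms(2,3) by (auto dest: inj_onD)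
qed

context relative_cayley
begin

lemma coset_stabilizer:
  assumes k: "k < length Hs" and b: "b \<in> carrier G"
  shows "{g \<in> carrier G. g \<otimes> b \<in> b <# (Hs ! k)} = {g \<in> carrier G. inv b \<otimes> g \<otimes> b \<in> Hs ! k}"
  using l_coset_mem[OF k b] b by (auto simp: m_assoc)

lemma coset_stabilizer_subgroup:
  assumes k: "k < length Hs" and b: "b \<in> carrier G"
  shows "subgroup {g \<in> carrier G. inv b \<otimes> g \<otimes> b \<in> Hs ! k} G"
proof (rule subgroupI)
  interpret H: subgroup "Hs ! k" G by (rule Hs_subgroup[OF k])
  let ?S = "{g \<in> carrier G. inv b \<otimes> g \<otimes> b \<in> Hs ! k}"
  show "?S \<subseteq> carrier G" by blast
  have "\<one> \<in> ?S" using b by simp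
  then show "?S \<noteq> {}" by blast
  show "inv x \<in> ?S" if "x \<in> ?S" for x
  proof -
    have "inv b \<otimes> inv x \<otimes> b = inv (inv b \<otimes> x \<otimes> b)"
      using that b by (simp add: inv_mult_group m_assoc)
    then show ?thesis using that by simp
  qed
  show "x \<otimes> y \<in> ?S" if "x \<in> ?S" "y \<in> ?S" for x y
  proof -
    have "inv b \<otimes> (x \<otimes> y) \<otimes> b = (inv b \<otimes> x \<otimes> b) \<otimes> (inv b \<otimes> y \<otimes> b)"
      using that b by (simp add: m_assoc)
    then show ?thesis using that by simp
  qed
qed

text \<open>A parabolic subgroup is contained in a conjugate of a peripheral subgroup, which is itself
  parabolic; so a maximal one is equal to it.\<close>

lemma maximal_parabolic_stabilizer:
  assumes "maximal_parabolic G Hs P"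
  obtains k b where "k < length Hs" "b \<in> carrier G" "P = {g \<in> carrier G. inv b \<otimes> g \<otimes> b \<in> Hs ! k}"
proof -
  obtain g k where g: "g \<in> carrier G" "k < length Hs" "(\<lambda>x. g \<otimes> x \<otimes> inv g) ` P \<subseteq> Hs ! k"
    and P: "subgroup P G"
    using assms unfolding maximal_parabolic_def parabolic_def by blast
  define S where "S = {x \<in> carrier G. inv (inv g) \<otimes> x \<otimes> inv g \<in> Hs ! k}"
  have "subgroup S G" unfolding S_def using g by (intro coset_stabilizer_subgroup) auto
  moreover have "(\<lambda>x. g \<otimes> x \<otimes> inv g) ` S \<subseteq> Hs ! k" unfolding S_def using g by auto
  ultimately have "parabolic G Hs S" unfolding parabolic_def using g by blast
  moreover have "P \<subseteq> S" unfolding S_def using g subgroup.subset[OF P] by auto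
  ultimately have "P = S" using assms unfolding maximal_parabolic_def by blast
  then show ?thesis using that[of k "inv g"] g unfolding S_def by simp
qed

end

theorem corollary1p7:
  fixes G :: "('a, 'b) monoid_scheme" and X :: "'a set" and Hs :: "'a set list" and Q P :: "'a set"
  assumes "group G"
    and "finite X" and "X \<subseteq> carrier G" and "generate G X = carrier G"
    and "\<forall>x \<in> X. inv\<^bsub>G\<^esub> x \<in> X"
    and "\<forall>H \<in> set Hs. subgroup H G \<and> free_abelian (G\<lparr>carrier := H\<rparr>)"
    and "relatively_hyperbolic G X Hs"
    and "relatively_quasiconvex G X Hs Q"
    and "maximal_parabolic G Hs P"
    and "Z_rank (G\<lparr>carrier := Q \<inter> P\<rparr>) < Z_rank (G\<lparr>carrier := P\<rparr>)"
  shows "\<forall>k::nat. 0 < k \<longrightarrow>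
    (\<exists>R. relatively_quasiconvex G X Hs R \<and>
         G\<lparr>carrier := R\<rparr> \<cong> Amalgam k (G\<lparr>carrier := Q\<rparr>) (Q \<inter> P))"
proof (intro allI impI)
  fix N :: nat assume N: "0 < N"
  interpret group G by fact
  interpret bcp_cayley G X Hs
    using assms(1-7)
    by (intro bcp_cayley.intro relative_cayley.intro relative_cayley_axioms.intro
        bcp_cayley_axioms.intro) (auto simp: relatively_hyperbolic_def)
  obtain k b where k: "k < length Hs" and b: "b \<in> carrier G"
    and P: "P = {g \<in> carrier G. inv\<^bsub>G\<^esub> b \<otimes>\<^bsub>G\<^esub> g \<otimes>\<^bsub>G\<^esub> b \<in> Hs ! k}"
    using maximal_parabolic_stabilizer[OF assms(9)] .
  have subQ: "subgroup Q G" and qcQ: "quasiconvex_orbit Q \<one>\<^bsub>G\<^esub>"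
    using assms(8) by (simp_all add: relatively_quasiconvex_iff)
  have subP: "subgroup P G" unfolding P by (rule coset_stabilizer_subgroup[OF k b])
  interpret parabolic_coset G X Hs k b P Q
  proof (intro parabolic_coset.intro parabolic_coset_axioms.intro bcp_cayley_axioms k b subQ subP)
    show "P = {g \<in> carrier G. g \<otimes>\<^bsub>G\<^esub> b \<in> b <#\<^bsub>G\<^esub> (Hs ! k)}"
      unfolding P coset_stabilizer[OF k b] ..
    show "quasiconvex_orbit Q b"
      using quasiconvex_orbit_basepoint[OF subgroup.subset[OF subQ] qcQ one_closed b] .
  qed
  have comm: "x \<otimes>\<^bsub>G\<^esub> y = y \<otimes>\<^bsub>G\<^esub> x" if "x \<in> P" "y \<in> P" for x y
  proof -
    let ?f = "\<lambda>x. inv\<^bsub>G\<^esub> b \<otimes>\<^bsub>G\<^esub> x \<otimes>\<^bsub>G\<^esub> b"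
    have xy: "x \<in> carrier G" "y \<in> carrier G" "?f x \<in> Hs ! k" "?f y \<in> Hs ! k" using that P by auto
    have "?f x \<otimes>\<^bsub>G\<^esub> ?f y = ?f y \<otimes>\<^bsub>G\<^esub> ?f x"
      using free_abelian_commute[of "G\<lparr>carrier := Hs ! k\<rparr>" "?f x" "?f y"] xy assms(6) nth_mem[OF k]
        subgroup_imp_group by simp
    then have "inv\<^bsub>G\<^esub> b \<otimes>\<^bsub>G\<^esub> (x \<otimes>\<^bsub>G\<^esub> y \<otimes>\<^bsub>G\<^esub> b) = inv\<^bsub>G\<^esub> b \<otimes>\<^bsub>G\<^esub> (y \<otimes>\<^bsub>G\<^esub> x \<otimes>\<^bsub>G\<^esub> b)"
      using xy b by (simp add: m_assoc)
    then show ?thesis using xy b by simp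
  qed
  have subK: "subgroup (Q \<inter> P) G" using subgroups_Inter_pair[OF subQ subP] .
  obtain h where h: "h \<in> P" "\<And>n::int. n \<noteq> 0 \<Longrightarrow> h [^]\<^bsub>G\<^esub> n \<notin> Q \<inter> P"
    using ex_infinite_order_mod_subgroup[OF subP subK _ comm assms(10)] by auto
  obtain C where C: "\<forall>k A x y a b p. k < length Hs \<and> A \<in> cosets k \<and> a \<in> proj A x \<and> b \<in> proj A y \<and>
      C < word_dist G X a b \<and> geodesic G X Hs p \<and> vertex G p 0 = x \<and> vertex G p (path_length p) = y \<longrightarrow>
      (\<exists>n \<le> path_length p. vertex G p n \<in> A)"
    using far_projections_cross by (rule exE)
  obtain M where M: "\<forall>q \<in> Q - P. \<forall>v \<in> A. \<forall>a \<in> proj A (q \<otimes>\<^bsub>G\<^esub> v).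
      \<exists>c \<in> Q \<inter> P. word_dist G X a (c \<otimes>\<^bsub>G\<^esub> b) \<le> M"
    using proj_from_Q_translate by (rule exE)
  \<comment> \<open>the values that \<open>t\<^sub>i\<^bsup>-1\<^esup> t\<^sub>j c\<close> has to avoid: their conjugates by \<open>b\<close> are short\<close>
  define F where "F = (\<lambda>x. b \<otimes>\<^bsub>G\<^esub> x \<otimes>\<^bsub>G\<^esub> inv\<^bsub>G\<^esub> b) `
    {x \<in> carrier G. word_length G X x \<le> C + 2 * M}"
  have "finite F" unfolding F_def by (intro finite_imageI finite_ball)
  then obtain L :: int where L: "\<forall>i j::int. \<forall>c \<in> Q \<inter> P. i \<noteq> j \<longrightarrow>
      inv\<^bsub>G\<^esub> (h [^]\<^bsub>G\<^esub> (L * i)) \<otimes>\<^bsub>G\<^esub> h [^]\<^bsub>G\<^esub> (L * j) \<otimes>\<^bsub>G\<^esub> c \<notin> F"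
    using ex_spread_out_powers[OF P_carrier[OF h(1)] subK h(2)] by blast
  define t where "t i = h [^]\<^bsub>G\<^esub> (L * int i)" for i
  have tP: "t i \<in> P" for i unfolding t_def using subgroup_int_pow_closed[OF subP h(1)] .
  interpret separated_copies G X Hs k b P Q C M N t
  proof unfold_locales
    show "\<exists>n \<le> path_length p. vertex G p n \<in> A"
      if "A \<in> cosets k" "a \<in> proj A x" "b \<in> proj A y" "C < word_dist G X a b" "geodesic G X Hs p"
        "vertex G p 0 = x" "vertex G p (path_length p) = y" for A x y a b p
      using C[rule_format, of k A a x b y p] k that by blast
    show "\<exists>c \<in> Q \<inter> P. word_dist G X a (c \<otimes>\<^bsub>G\<^esub> b) \<le> M"
      if "q \<in> Q - P" "v \<in> A" "a \<in> proj A (q \<otimes>\<^bsub>G\<^esub> v)" for q v a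
      using M that by blast
    show "t i \<in> P" for i by (rule tP)
    fix i j :: nat and c
    assume ij: "i \<noteq> j" and c: "c \<in> Q \<inter> P"
    define x where "x = inv\<^bsub>G\<^esub> (t i) \<otimes>\<^bsub>G\<^esub> t j \<otimes>\<^bsub>G\<^esub> c"
    have x: "x \<in> carrier G" unfolding x_def using P_carrier[OF tP] P_carrier c by simp
    have "x \<notin> F" unfolding x_def t_def using L c ij by simp
    moreover have "x = b \<otimes>\<^bsub>G\<^esub> (inv\<^bsub>G\<^esub> b \<otimes>\<^bsub>G\<^esub> x \<otimes>\<^bsub>G\<^esub> b) \<otimes>\<^bsub>G\<^esub> inv\<^bsub>G\<^esub> b"
      using x b by (simp add: m_assoc)
    ultimately have "\<not> word_length G X (inv\<^bsub>G\<^esub> b \<otimes>\<^bsub>G\<^esub> x \<otimes>\<^bsub>G\<^esub> b) \<le> C + 2 * M"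
      unfolding F_def using x b by blast
    then show "C + 2 * M < word_length G X (inv\<^bsub>G\<^esub> b \<otimes>\<^bsub>G\<^esub>
        (inv\<^bsub>G\<^esub> (t i) \<otimes>\<^bsub>G\<^esub> t j \<otimes>\<^bsub>G\<^esub> c) \<otimes>\<^bsub>G\<^esub> b)"
      unfolding x_def by simp
  qed (rule comm)
  show "\<exists>R. relatively_quasiconvex G X Hs R \<and>
      G\<lparr>carrier := R\<rparr> \<cong> Amalgam N (G\<lparr>carrier := Q\<rparr>) (Q \<inter> P)"
    using R_quasiconvex[OF R_normal_form[OF N] N] R_iso_Amalgam[OF N] by blast
qed

end
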